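(* Let $\overline M$ be a $7$-dimensional Riemannian manifold with a $G_2$-structure of type $\mathcal X_1$ such that $d\varphi=k*\varphi$. Let $\iota:M\to\overline M$ be an orientable hypersurface with unit normal vector field $n$, with the induced $SU(3)$-structure determined by $n$ and a smooth function $\theta$ on $M$. Then $M$ is of type $\mathcal W_1^++\mathcal W_1^-+\mathcal W_2^++\mathcal W_2^-+\mathcal W_3+\mathcal W_5$. Moreover, the $SU(3)$-structure on $M$ is of the type given on the left if and only if the condition on the right holds: 1. $\mathcal W_1^++\mathcal W_1^-+\mathcal W_2^++\mathcal W_2^-+\mathcal W_3$: $\theta$ is constant (i.e. $d\theta=0$). 2. $\mathcal W_1^++\mathcal W_1^-+\mathcal W_2^++\mathcal W_2^-+\mathcal W_5$: $IB=B$. 3. $\mathcal W_1^++\mathcal W_1^-+\mathcal W_2^++\mathcal W_3+\mathcal W_5$: $\sin\theta\,(1+I)B=2h\sin\theta\,\langle\cdot,\cdot\rangle$. 4. $\mathcal W_1^++\mathcal W_1^-+\mathcal W_2^-+\mathcal W_3+\mathcal W_5$: $\cos\theta\,(1+I)B=2h\cos\theta\,\langle\cdot,\cdot\rangle$. 5. $\mathcal W_1^++\mathcal W_2^++\mathcal W_2^-+\mathcal W_3+\mathcal W_5$: $-4h\sin\theta=k\cos\theta$. 6. $\mathcal W_1^-+\mathcal W_2^++\mathcal W_2^-+\mathcal W_3+\mathcal W_5$: $4h\cos\theta=k\sin\theta$. 7. $\mathcal W_1^++\mathcal W_1^-+\mathcal W_3+\mathcal W_5$: $(1+I)B=2h\langle\cdot,\cdot\rangle$.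 8. $\mathcal W_2^++\mathcal W_2^-+\mathcal W_3+\mathcal W_5$: $M$ is a minimal variety and $\overline M$ is of type $\mathcal P$. 9. $\mathcal W_1^++\mathcal W_1^-+\mathcal W_5$: $M$ is totally umbilic. 10. $\mathcal W_2^++\mathcal W_2^-+\mathcal W_5$: $IB=B$, $M$ is a minimal variety and $\overline M$ is of type $\mathcal P$. 11. $\mathcal W_3+\mathcal W_5$: $IB=-B$ and $\overline M$ is of type $\mathcal P$. 12. $\mathcal W_5$: $M$ is totally geodesic and $\overline M$ is of type $\mathcal P$. 13. $\{0\}$: $M$ is totally geodesic, $\theta$ is constant (i.e. $d\theta=0$) and $\overline M$ is of type $\mathcal P$.
   Context: $G_2$-structures: a $G_2$-structure on a Riemannian $7$-manifold $(\overline M,\langle\cdot,\cdot\rangle)$ is given by a global three-form $\varphi$ such that locally there is an orthonormal frame $\{e_0,\dots,e_6\}$ (indices in $\mathbb Z_7$) with $\varphi=\sum_ie_i\wedge e_{i+1}\wedge e_{i+3}$ (vectors are identified with one-forms via the metric). $\langle P(x,y),z\rangle=\varphi(x,y,z)$, and $*\varphi=-\sum_{i}e_{i+2}\wedge e_{i+4}\wedge e_{i+5}\wedge e_{i+6}$ (Hodge dual for the orientation $e_0\wedge\dots\wedge e_6$). $\overline\nabla$ is the Levi-Civita connection and $\overline r(\varphi)(x,y)=\frac14\langle\overline\nabla_x\varphi,y\lrcorner*\varphi\rangle$, where $\langle a,b\rangle=\frac1{p!}\sum a(e_{i_1},\dots)b(e_{i_1},\dots)$ for $p$-forms. Type $\mathcal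 X_1$ (nearly parallel): $\overline r(\varphi)=\frac k4\langle\cdot,\cdot\rangle$ with $k$ constant (then $d\varphi=k*\varphi$). Type $\mathcal P$ (parallel): $\overline r(\varphi)=0$. Induced structure on $M$: the induced metric, $Ix=P(n,x)$, and $\Psi=\psi_++i\psi_-$ with $\psi_+=\cos\theta\,\iota^*\varphi-\sin\theta\,\iota^*(n\lrcorner*\varphi)$, $\psi_-=\sin\theta\,\iota^*\varphi+\cos\theta\,\iota^*(n\lrcorner*\varphi)$. $B(x,y)=\langle II(x,y),n\rangle=\langle\overline\nabla_xy,n\rangle$ is the second fundamental form, $h=\frac16\mathrm{Tr}\,B$ (so $h=\langle H,n\rangle$, $H$ the mean curvature); minimal variety means $h=0$, totally umbilic $B=h\langle\cdot,\cdot\rangle$, totally geodesic $B=0$. For a bilinear form $b$ on $M$, $(Ib)(x,y)=b(Ix,Iy)$; for a one-form $\mu$, $(I\mu)(x)=-\mu(Ix)$. Types of $SU(3)$-structure: $\nabla$ is the Levi-Civita connection of $M$, $\omega(x,y)=\langle x,Iy\rangle$. $\nabla\omega$ lies in $\{\alpha\mid\alpha(x,y,z)=-\alpha(x,z,y)=-\alpha(x,Iy,Iz)\}=\mathcal W_1\oplus\mathcal W_2\oplus\mathcal W_3\oplus\mathcal W_4$ (Gray–Hervella), where $\mathcal W_1$: $\alpha$ totally skew; $\mathcal W_2$: cyclic sum of $\alpha(x,y,z)$ is zero; $\mathcal W_3$: $\alpha(Ix,Iy,z)=\alpha(x,y,z)$ and $\sum_i\alpha(e_i,e_i,z)=0$;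 $\mathcal W_4$: $\alpha(x,y,z)=\langle x,y\rangle\tau(z)-\langle x,z\rangle\tau(y)-\langle x,Iy\rangle\tau(Iz)+\langle x,Iz\rangle\tau(Iy)$ for some one-form $\tau$. With $r(\alpha)(x,y)=\frac12\langle x\lrcorner\alpha,y\lrcorner\psi_+\rangle$, for $i=1,2$ one has $\mathcal W_i=\mathcal W_i^+\oplus\mathcal W_i^-$, where $\mathcal W_i^+$ (resp. $\mathcal W_i^-$) is the set of $\alpha\in\mathcal W_i$ with $r(\alpha)$ symmetric (resp. skew-symmetric). The $\mathcal W_5$-part of the torsion is the one-form $\eta$ determined by requiring that the metric connection $\nabla+\eta+\xi$, with $\eta_XY=(I\eta)(X)IY$ and $\xi_XY=-\frac12I(\nabla_XI)Y$, makes $\omega,\psi_+,\psi_-$ parallel; equivalently $(I\eta)(X)=-\frac1{12}\langle\nabla_X\psi_+,\psi_-\rangle$. $M$ is of type $\mathcal U$, a sum of some of $\mathcal W_1^\pm,\mathcal W_2^\pm,\mathcal W_3,\mathcal W_4,\mathcal W_5$, if the components of $\nabla\omega$ in the $\mathcal W$'s not occurring in $\mathcal U$ vanish everywhere and, when $\mathcal W_5$ does not occur, $\eta=0$; type $\{0\}$ means $\nabla\omega=0$ and $\eta=0$. *)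

theory Defs
  imports "HOL-Analysis.Analysis"
begin

section \<open>Smooth manifolds and tensor fields in charts\<close>

primrec Ck_on :: "nat \<Rightarrow> 'v::euclidean_space set \<Rightarrow> ('v \<Rightarrow> 'w::real_normed_vector) \<Rightarrow> bool" where
  "Ck_on 0 S f \<longleftrightarrow> continuous_on S f"
| "Ck_on (Suc k) S f \<longleftrightarrow> (\<forall>x\<in>S. f differentiable (at x)) \<and>
     (\<forall>v. Ck_on k S (\<lambda>x. frechet_derivative f (at x) v))"

text \<open>C-infinity on an open set \<open>S\<close>.\<close>
definition smooth_on :: "'v::euclidean_space set \<Rightarrow> ('v \<Rightarrow> 'w::real_normed_vector) \<Rightarrow> bool" where
  "smooth_on S f \<longleftrightarrow> (\<forall>k. Ck_on k S f)"

text \<open>A chart is its domain together with the coordinate map. The manifold is the whole type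
  \<open>'a\<close>; its Hausdorff and second countable topology comes from the type classes.\<close>
type_synonym ('a, 'n) chart = "'a set \<times> ('a \<Rightarrow> real ^ 'n)"

abbreviation chart_inv :: "('a, 'n) chart \<Rightarrow> real ^ 'n \<Rightarrow> 'a" where
  "chart_inv c \<equiv> inv_into (fst c) (snd c)"

abbreviation chart_img :: "('a, 'n) chart \<Rightarrow> (real ^ 'n) set" where
  "chart_img c \<equiv> snd c ` fst c"

text \<open>\<open>coord_rep d c f\<close> is the map \<open>f\<close> read in the chart \<open>d\<close> of its domain and the chart \<open>c\<close> of
  its codomain.\<close>
definition coord_rep :: "('b, 'm) chart \<Rightarrow> ('a, 'n) chart \<Rightarrow> ('b \<Rightarrow> 'a) \<Rightarrow> real ^ 'm \<Rightarrow> real ^ 'n" where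
  "coord_rep d c f = (\<lambda>x. snd c (f (chart_inv d x)))"

definition smooth_atlas ::
  "('a::{t2_space, second_countable_topology}, 'n::finite) chart set \<Rightarrow> bool" where
  "smooth_atlas A \<longleftrightarrow>
     (\<Union>c\<in>A. fst c) = UNIV \<and>
     (\<forall>c\<in>A. open (fst c) \<and> open (chart_img c) \<and>
        homeomorphism (fst c) (chart_img c) (snd c) (chart_inv c)) \<and>
     (\<forall>c\<in>A. \<forall>d\<in>A. smooth_on (snd c ` (fst c \<inter> fst d)) (coord_rep c d (\<lambda>p. p)))"

text \<open>The points of a manifold, each in the coordinates of every chart around it.\<close>
definition chart_points :: "('a, 'n) chart set \<Rightarrow> (('a, 'n) chart \<times> (real ^ 'n)) set" where
  "chart_points A = {(c, x). c \<in> A \<and> x \<in> chart_img c}"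

definition chart_at :: "('a, 'n) chart set \<Rightarrow> 'a \<Rightarrow> ('a, 'n) chart" where
  "chart_at A p = (SOME c. c \<in> A \<and> p \<in> fst c)"

text \<open>A covariant tensor of rank \<open>k\<close> at a point is a multilinear function of lists of \<open>k\<close>
  coordinate vectors; only its values on lists of length \<open>k\<close> matter.\<close>
type_synonym 'n tensor = "(real ^ 'n) list \<Rightarrow> real"

definition multilinear :: "nat \<Rightarrow> 'n::finite tensor \<Rightarrow> bool" where
  "multilinear k a \<longleftrightarrow>
     (\<forall>vs i. length vs = k \<and> i < k \<longrightarrow> linear (\<lambda>v. a (vs[i := v])))"

definition alternating :: "nat \<Rightarrow> 'n tensor \<Rightarrow> bool" where
  "alternating k a \<longleftrightarrow>
     (\<forall>vs i j. length vs = k \<and> i < j \<and> j < k \<and> vs ! i = vs ! j \<longrightarrow> a vs = 0)"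

text \<open>A tensor field is given by its expressions in the charts, related by the usual
  transformation law.\<close>
type_synonym ('a, 'n) tensor_field = "('a, 'n) chart \<Rightarrow> real ^ 'n \<Rightarrow> 'n tensor"

definition is_tensor_field ::
  "('a, 'n::finite) chart set \<Rightarrow> nat \<Rightarrow> ('a, 'n) tensor_field \<Rightarrow> bool" where
  "is_tensor_field A k T \<longleftrightarrow>
     (\<forall>(c, x)\<in>chart_points A. multilinear k (T c x)) \<and>
     (\<forall>c\<in>A. \<forall>vs. length vs = k \<longrightarrow> smooth_on (chart_img c) (\<lambda>x. T c x vs)) \<and>
     (\<forall>c\<in>A. \<forall>d\<in>A. \<forall>x\<in>snd c ` (fst c \<inter> fst d). \<forall>vs. length vs = k \<longrightarrow>
        T c x vs = T d (coord_rep c d (\<lambda>p. p) x)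
          (map (frechet_derivative (coord_rep c d (\<lambda>p. p)) (at x)) vs))"

definition is_form ::
  "('a, 'n::finite) chart set \<Rightarrow> nat \<Rightarrow> ('a, 'n) tensor_field \<Rightarrow> bool" where
  "is_form A k T \<longleftrightarrow> is_tensor_field A k T \<and> (\<forall>(c, x)\<in>chart_points A. alternating k (T c x))"

definition riemannian_metric ::
  "('a, 'n::finite) chart set \<Rightarrow> ('a, 'n) tensor_field \<Rightarrow> bool" where
  "riemannian_metric A g \<longleftrightarrow> is_tensor_field A 2 g \<and>
     (\<forall>(c, x)\<in>chart_points A. (\<forall>u v. g c x [u, v] = g c x [v, u]) \<and>
        (\<forall>v. v \<noteq> 0 \<longrightarrow> g c x [v, v] > 0))"

text \<open>Exterior derivative, in a chart, of a form \<open>T\<close> of degree \<open>length vs - 1\<close>.\<close>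
definition ext_deriv :: "(real ^ 'n::finite \<Rightarrow> 'n tensor) \<Rightarrow> real ^ 'n \<Rightarrow> 'n tensor" where
  "ext_deriv T x vs = (\<Sum>i<length vs. (-1) ^ i *
     frechet_derivative (\<lambda>y. T y (take i vs @ drop (Suc i) vs)) (at x) (vs ! i))"

text \<open>The Levi-Civita connection in a chart, as the map taking \<open>u\<close>, \<open>v\<close> to the covariant
  derivative in direction \<open>u\<close> of the coordinate vector field with constant components \<open>v\<close>.
  Coordinate fields commute, so that being torsion-free means being symmetric in \<open>u\<close>, \<open>v\<close>; the
  last clause says that the metric is parallel.\<close>
definition levi_civita ::
  "(real ^ 'n::finite \<Rightarrow> 'n tensor) \<Rightarrow> real ^ 'n \<Rightarrow> real ^ 'n \<Rightarrow> real ^ 'n \<Rightarrow> real ^ 'n" where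
  "levi_civita g x = (THE G. bilinear G \<and> (\<forall>u v. G u v = G v u) \<and>
     (\<forall>u v w. frechet_derivative (\<lambda>y. g y [v, w]) (at x) u = g x [G u v, w] + g x [v, G u w]))"

text \<open>Covariant derivative \<open>(\<nabla>\<^sub>u T)(vs)\<close> at \<open>x\<close>, for the connection with coefficients \<open>G\<close> at \<open>x\<close>.\<close>
definition cov_deriv ::
  "(real ^ 'n::finite \<Rightarrow> real ^ 'n \<Rightarrow> real ^ 'n) \<Rightarrow> (real ^ 'n \<Rightarrow> 'n tensor) \<Rightarrow>
   real ^ 'n \<Rightarrow> real ^ 'n \<Rightarrow> 'n tensor" where
  "cov_deriv G T x u vs = frechet_derivative (\<lambda>y. T y vs) (at x) u
     - (\<Sum>i<length vs. T x (vs[i := G u (vs ! i)]))"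

text \<open>Covariant derivative \<open>(\<nabla>\<^sub>u J) v\<close> of a field \<open>J\<close> of endomorphisms.\<close>
definition cov_deriv_endo ::
  "(real ^ 'n::finite \<Rightarrow> real ^ 'n \<Rightarrow> real ^ 'n) \<Rightarrow> (real ^ 'n \<Rightarrow> real ^ 'n \<Rightarrow> real ^ 'n) \<Rightarrow>
   real ^ 'n \<Rightarrow> real ^ 'n \<Rightarrow> real ^ 'n \<Rightarrow> real ^ 'n" where
  "cov_deriv_endo G J x u v =
     frechet_derivative (\<lambda>y. J y v) (at x) u + G u (J x v) - J x (G u v)"

section \<open>Orthonormal frames\<close>

definition orthonormal_frame :: "'n tensor \<Rightarrow> ('n::finite \<Rightarrow> real ^ 'n) \<Rightarrow> bool" where
  "orthonormal_frame g e \<longleftrightarrow> (\<forall>i j. g [e i, e j] = (if i = j then 1 else 0))"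

definition some_frame :: "'n::finite tensor \<Rightarrow> 'n \<Rightarrow> real ^ 'n" where
  "some_frame g = (SOME e. orthonormal_frame g e)"

text \<open>Inner product of forms of degree \<open>p\<close>; it does not depend on the frame.\<close>
definition form_inner :: "'n::finite tensor \<Rightarrow> nat \<Rightarrow> 'n tensor \<Rightarrow> 'n tensor \<Rightarrow> real" where
  "form_inner g p a b =
     (\<Sum>is | length is = p. a (map (some_frame g) is) * b (map (some_frame g) is)) / fact p"

definition trace_form :: "'n::finite tensor \<Rightarrow> (real ^ 'n \<Rightarrow> real ^ 'n \<Rightarrow> real) \<Rightarrow> real" where
  "trace_form g b = (\<Sum>i\<in>UNIV. b (some_frame g i) (some_frame g i))"

text \<open>The wedge product of the one-forms dual to the vectors \<open>es\<close>.\<close>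
definition wedge :: "'n tensor \<Rightarrow> (real ^ 'n) list \<Rightarrow> 'n tensor" where
  "wedge g es vs = (\<Sum>p | p permutes {..<length es}.
     of_int (sign p) * (\<Prod>i<length es. g [es ! i, vs ! p i]))"

section \<open>\<open>G\<^sub>2\<close>-structures\<close>

text \<open>The indices are elements of the type \<open>7\<close>, whose addition is modulo 7.\<close>
definition g2_frame :: "7 tensor \<Rightarrow> 7 tensor \<Rightarrow> (7 \<Rightarrow> real ^ 7) \<Rightarrow> bool" where
  "g2_frame g \<phi> e \<longleftrightarrow> orthonormal_frame g e \<and>
     (\<forall>u v w. \<phi> [u, v, w] = (\<Sum>i\<in>UNIV. wedge g [e i, e (i + 1), e (i + 3)] [u, v, w]))"

definition g2_structure ::
  "('a, 7) chart set \<Rightarrow> ('a, 7) tensor_field \<Rightarrow> ('a, 7) tensor_field \<Rightarrow> bool" where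
  "g2_structure A g \<phi> \<longleftrightarrow> is_form A 3 \<phi> \<and>
     (\<forall>(c, x)\<in>chart_points A. \<exists>V e. open V \<and> x \<in> V \<and> V \<subseteq> chart_img c \<and>
        (\<forall>i. smooth_on V (\<lambda>y. e y i)) \<and> (\<forall>y\<in>V. g2_frame (g c y) (\<phi> c y) (e y)))"

text \<open>The four-form \<open>*\<phi>\<close>: for the orientation \<open>e\<^sub>0 \<and> \<dots> \<and> e\<^sub>6\<close>, the Hodge dual of
  \<open>e\<^sub>i \<and> e\<^sub>i\<^sub>+\<^sub>1 \<and> e\<^sub>i\<^sub>+\<^sub>3\<close> is \<open>- e\<^sub>i\<^sub>+\<^sub>2 \<and> e\<^sub>i\<^sub>+\<^sub>4 \<and> e\<^sub>i\<^sub>+\<^sub>5 \<and> e\<^sub>i\<^sub>+\<^sub>6\<close>. The result does not depend on the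
  adapted frame.\<close>
definition star_phi :: "7 tensor \<Rightarrow> 7 tensor \<Rightarrow> 7 tensor" where
  "star_phi g \<phi> vs = (let e = (SOME e. g2_frame g \<phi> e) in
     - (\<Sum>i\<in>UNIV. wedge g [e (i + 2), e (i + 4), e (i + 5), e (i + 6)] vs))"

definition cross_prod :: "7 tensor \<Rightarrow> 7 tensor \<Rightarrow> real ^ 7 \<Rightarrow> real ^ 7 \<Rightarrow> real ^ 7" where
  "cross_prod g \<phi> u v = (THE w. \<forall>z. g [w, z] = \<phi> [u, v, z])"

definition r_bar :: "('a, 7) tensor_field \<Rightarrow> ('a, 7) tensor_field \<Rightarrow> ('a, 7) chart \<Rightarrow>
    real ^ 7 \<Rightarrow> real ^ 7 \<Rightarrow> real ^ 7 \<Rightarrow> real" where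
  "r_bar g \<phi> c x u v = 1 / 4 * form_inner (g c x) 3
     (cov_deriv (levi_civita (g c) x) (\<phi> c) x u)
     (\<lambda>ws. star_phi (g c x) (\<phi> c x) (v # ws))"

definition type_X1 ::
  "('a, 7) chart set \<Rightarrow> ('a, 7) tensor_field \<Rightarrow> ('a, 7) tensor_field \<Rightarrow> bool" where
  "type_X1 A g \<phi> \<longleftrightarrow>
     (\<exists>k. \<forall>(c, x)\<in>chart_points A. \<forall>u v. r_bar g \<phi> c x u v = k / 4 * g c x [u, v])"

definition type_P ::
  "('a, 7) chart set \<Rightarrow> ('a, 7) tensor_field \<Rightarrow> ('a, 7) tensor_field \<Rightarrow> bool" where
  "type_P A g \<phi> \<longleftrightarrow> (\<forall>(c, x)\<in>chart_points A. \<forall>u v. r_bar g \<phi> c x u v = 0)"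

section \<open>Types of \<open>SU(3)\<close>-structures\<close>

datatype su3_class = W1p | W1m | W2p | W2m | W3 | W4 | W5

text \<open>In this section \<open>g\<close>, \<open>J\<close>, \<open>\<psi>\<close> are the metric, the almost complex structure and \<open>\<psi>\<^sub>+\<close> at a
  point.\<close>
definition gh_space :: "(real ^ 6 \<Rightarrow> real ^ 6) \<Rightarrow> 6 tensor set" where
  "gh_space J = {\<alpha>. multilinear 3 \<alpha> \<and> (\<forall>x y z. \<alpha> [x, y, z] = - \<alpha> [x, z, y] \<and>
     \<alpha> [x, y, z] = - \<alpha> [x, J y, J z])}"

definition r_form :: "6 tensor \<Rightarrow> 6 tensor \<Rightarrow> 6 tensor \<Rightarrow> real ^ 6 \<Rightarrow> real ^ 6 \<Rightarrow> real" where
  "r_form g \<psi> \<alpha> x y = 1 / 2 * form_inner g 2 (\<lambda>vs. \<alpha> (x # vs)) (\<lambda>vs. \<psi> (y # vs))"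

definition W1_space :: "(real ^ 6 \<Rightarrow> real ^ 6) \<Rightarrow> 6 tensor set" where
  "W1_space J = {\<alpha> \<in> gh_space J. alternating 3 \<alpha>}"

definition W2_space :: "(real ^ 6 \<Rightarrow> real ^ 6) \<Rightarrow> 6 tensor set" where
  "W2_space J = {\<alpha> \<in> gh_space J. \<forall>x y z. \<alpha> [x, y, z] + \<alpha> [y, z, x] + \<alpha> [z, x, y] = 0}"

definition W3_space :: "6 tensor \<Rightarrow> (real ^ 6 \<Rightarrow> real ^ 6) \<Rightarrow> 6 tensor set" where
  "W3_space g J = {\<alpha> \<in> gh_space J. (\<forall>x y z. \<alpha> [J x, J y, z] = \<alpha> [x, y, z]) \<and>
     (\<forall>z. trace_form g (\<lambda>x y. \<alpha> [x, y, z]) = 0)}"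

definition W4_space :: "6 tensor \<Rightarrow> (real ^ 6 \<Rightarrow> real ^ 6) \<Rightarrow> 6 tensor set" where
  "W4_space g J = {\<alpha> \<in> gh_space J. \<exists>\<tau>. linear \<tau> \<and> (\<forall>x y z. \<alpha> [x, y, z] =
     g [x, y] * \<tau> z - g [x, z] * \<tau> y - g [x, J y] * \<tau> (J z) + g [x, J z] * \<tau> (J y))}"

text \<open>\<open>W5\<close> does not concern the covariant derivative of \<open>\<omega>\<close>; its value here is irrelevant.\<close>
fun W_space :: "6 tensor \<Rightarrow> (real ^ 6 \<Rightarrow> real ^ 6) \<Rightarrow> 6 tensor \<Rightarrow> su3_class \<Rightarrow> 6 tensor set" where
  "W_space g J \<psi> W1p = {\<alpha> \<in> W1_space J. \<forall>x y. r_form g \<psi> \<alpha> x y = r_form g \<psi> \<alpha> y x}"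
| "W_space g J \<psi> W1m = {\<alpha> \<in> W1_space J. \<forall>x y. r_form g \<psi> \<alpha> x y = - r_form g \<psi> \<alpha> y x}"
| "W_space g J \<psi> W2p = {\<alpha> \<in> W2_space J. \<forall>x y. r_form g \<psi> \<alpha> x y = r_form g \<psi> \<alpha> y x}"
| "W_space g J \<psi> W2m = {\<alpha> \<in> W2_space J. \<forall>x y. r_form g \<psi> \<alpha> x y = - r_form g \<psi> \<alpha> y x}"
| "W_space g J \<psi> W3 = W3_space g J"
| "W_space g J \<psi> W4 = W4_space g J"
| "W_space g J \<psi> W5 = {}"

text \<open>\<open>f\<close> is the family of components of \<open>\<alpha>\<close>; the sum of the six spaces is direct.\<close>
definition gh_components :: "6 tensor \<Rightarrow> (real ^ 6 \<Rightarrow> real ^ 6) \<Rightarrow> 6 tensor \<Rightarrow> 6 tensor \<Rightarrow>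
    (su3_class \<Rightarrow> 6 tensor) \<Rightarrow> bool" where
  "gh_components g J \<psi> \<alpha> f \<longleftrightarrow>
     (\<forall>w\<in>{W1p, W1m, W2p, W2m, W3, W4}. f w \<in> W_space g J \<psi> w) \<and>
     (\<forall>x y z. \<alpha> [x, y, z] = (\<Sum>w\<in>{W1p, W1m, W2p, W2m, W3, W4}. f w [x, y, z]))"

type_synonym ('b, 'm) endo_field = "('b, 'm) chart \<Rightarrow> real ^ 'm \<Rightarrow> real ^ 'm \<Rightarrow> real ^ 'm"

definition kaehler_form ::
  "('b, 6) tensor_field \<Rightarrow> ('b, 6) endo_field \<Rightarrow> ('b, 6) tensor_field" where
  "kaehler_form g J d x vs = g d x [vs ! 0, J d x (vs ! 1)]"

definition nabla_omega ::
  "('b, 6) tensor_field \<Rightarrow> ('b, 6) endo_field \<Rightarrow> ('b, 6) tensor_field" where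
  "nabla_omega g J d x vs =
     cov_deriv (levi_civita (g d) x) (kaehler_form g J d) x (hd vs) (tl vs)"

text \<open>The connection \<open>\<nabla> + \<eta> + \<xi>\<close>, where \<open>(I\<eta>)(X) = - \<eta>(IX)\<close>.\<close>
definition su3_connection :: "('b, 6) tensor_field \<Rightarrow> ('b, 6) endo_field \<Rightarrow> (real ^ 6 \<Rightarrow> real) \<Rightarrow>
    ('b, 6) chart \<Rightarrow> real ^ 6 \<Rightarrow> real ^ 6 \<Rightarrow> real ^ 6 \<Rightarrow> real ^ 6" where
  "su3_connection g J \<eta> d x u v = levi_civita (g d) x u v
     + (- \<eta> (J d x u)) *\<^sub>R J d x v
     + (- 1 / 2) *\<^sub>R J d x (cov_deriv_endo (levi_civita (g d) x) (J d) x u v)"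

definition su3_eta :: "('b, 6) tensor_field \<Rightarrow> ('b, 6) endo_field \<Rightarrow> ('b, 6) tensor_field \<Rightarrow>
    ('b, 6) tensor_field \<Rightarrow> ('b, 6) chart \<Rightarrow> real ^ 6 \<Rightarrow> real ^ 6 \<Rightarrow> real" where
  "su3_eta g J \<psi>p \<psi>m d x = (THE \<eta>. linear \<eta> \<and>
     (\<forall>u v w. cov_deriv (su3_connection g J \<eta> d x) (kaehler_form g J d) x u [v, w] = 0) \<and>
     (\<forall>u v w z. cov_deriv (su3_connection g J \<eta> d x) (\<psi>p d) x u [v, w, z] = 0) \<and>
     (\<forall>u v w z. cov_deriv (su3_connection g J \<eta> d x) (\<psi>m d) x u [v, w, z] = 0))"

definition su3_type :: "('b, 6) chart set \<Rightarrow> ('b, 6) tensor_field \<Rightarrow> ('b, 6) endo_field \<Rightarrow>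
    ('b, 6) tensor_field \<Rightarrow> ('b, 6) tensor_field \<Rightarrow> su3_class set \<Rightarrow> bool" where
  "su3_type AM g J \<psi>p \<psi>m U \<longleftrightarrow> (\<forall>(d, x)\<in>chart_points AM.
     (\<exists>f. gh_components (g d x) (J d x) (\<psi>p d x) (nabla_omega g J d x) f \<and>
        (\<forall>w\<in>{W1p, W1m, W2p, W2m, W3, W4} - U. \<forall>x y z. f w [x, y, z] = 0)) \<and>
     (W5 \<notin> U \<longrightarrow> (\<forall>v. su3_eta g J \<psi>p \<psi>m d x v = 0)))"

section \<open>Hypersurfaces\<close>

definition smooth_fun :: "('b, 'm::finite) chart set \<Rightarrow> ('b \<Rightarrow> real) \<Rightarrow> bool" where
  "smooth_fun AM f \<longleftrightarrow> (\<forall>d\<in>AM. smooth_on (chart_img d) (\<lambda>x. f (chart_inv d x)))"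

definition differential ::
  "('b \<Rightarrow> real) \<Rightarrow> ('b, 'm::finite) chart \<Rightarrow> real ^ 'm \<Rightarrow> real ^ 'm \<Rightarrow> real" where
  "differential f d x v = frechet_derivative (\<lambda>y. f (chart_inv d y)) (at x) v"

definition immersion :: "('b::topological_space, 'm::finite) chart set \<Rightarrow>
    ('a::topological_space, 'n::finite) chart set \<Rightarrow> ('b \<Rightarrow> 'a) \<Rightarrow> bool" where
  "immersion AM A \<iota> \<longleftrightarrow> continuous_on UNIV \<iota> \<and>
     (\<forall>d\<in>AM. \<forall>c\<in>A. smooth_on (snd d ` (fst d \<inter> \<iota> -` fst c)) (coord_rep d c \<iota>) \<and>
        (\<forall>x\<in>snd d ` (fst d \<inter> \<iota> -` fst c). inj (frechet_derivative (coord_rep d c \<iota>) (at x))))"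

text \<open>A vector field along \<open>\<iota>\<close> has components \<open>n c p\<close> at \<open>p\<close> in every chart \<open>c\<close> around \<open>\<iota> p\<close>.\<close>
type_synonym ('b, 'a, 'n) field_along = "('a, 'n) chart \<Rightarrow> 'b \<Rightarrow> real ^ 'n"

definition is_field_along :: "('b, 'm::finite) chart set \<Rightarrow> ('a, 'n::finite) chart set \<Rightarrow>
    ('b \<Rightarrow> 'a) \<Rightarrow> ('b, 'a, 'n) field_along \<Rightarrow> bool" where
  "is_field_along AM A \<iota> n \<longleftrightarrow>
     (\<forall>d\<in>AM. \<forall>c\<in>A. smooth_on (snd d ` (fst d \<inter> \<iota> -` fst c)) (\<lambda>x. n c (chart_inv d x))) \<and>
     (\<forall>c\<in>A. \<forall>c'\<in>A. \<forall>p\<in>\<iota> -` (fst c \<inter> fst c').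
        n c' p = frechet_derivative (coord_rep c c' (\<lambda>q. q)) (at (snd c (\<iota> p))) (n c p))"

definition unit_normal_field :: "('b, 'm::finite) chart set \<Rightarrow> ('a, 'n::finite) chart set \<Rightarrow>
    ('a, 'n) tensor_field \<Rightarrow> ('b \<Rightarrow> 'a) \<Rightarrow> ('b, 'a, 'n) field_along \<Rightarrow> bool" where
  "unit_normal_field AM A g \<iota> n \<longleftrightarrow> is_field_along AM A \<iota> n \<and>
     (\<forall>d\<in>AM. \<forall>c\<in>A. \<forall>p\<in>fst d \<inter> \<iota> -` fst c.
        g c (snd c (\<iota> p)) [n c p, n c p] = 1 \<and>
        (\<forall>v. g c (snd c (\<iota> p))
           [frechet_derivative (coord_rep d c \<iota>) (at (snd d p)) v, n c p] = 0))"

text \<open>At \<open>p = chart_inv d x\<close> the objects below are computed in an arbitrarily chosen chart around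
  \<open>\<iota> p\<close>, on which they do not depend.\<close>
definition pullback :: "('a, 'n::finite) chart set \<Rightarrow> ('b \<Rightarrow> 'a) \<Rightarrow> ('a, 'n) tensor_field \<Rightarrow>
    ('b, 'm::finite) tensor_field" where
  "pullback A \<iota> T d x vs = (let c = chart_at A (\<iota> (chart_inv d x)); F = coord_rep d c \<iota> in
     T c (F x) (map (frechet_derivative F (at x)) vs))"

text \<open>The pullback of \<open>n \<lrcorner> T\<close>.\<close>
definition pullback_contr :: "('a, 'n::finite) chart set \<Rightarrow> ('b \<Rightarrow> 'a) \<Rightarrow>
    ('b, 'a, 'n) field_along \<Rightarrow> ('a, 'n) tensor_field \<Rightarrow> ('b, 'm::finite) tensor_field" where
  "pullback_contr A \<iota> n T d x vs =
     (let p = chart_inv d x; c = chart_at A (\<iota> p); F = coord_rep d c \<iota> in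
      T c (F x) (n c p # map (frechet_derivative F (at x)) vs))"

text \<open>The second fundamental form \<open>B(u, v) = \<langle>\<nabla>\<^sub>u v, n\<rangle>\<close>: the covariant derivative along \<open>\<iota>\<close>, in
  direction \<open>u\<close>, of the image under the differential of \<open>\<iota>\<close> of the coordinate field \<open>v\<close>.\<close>
definition second_fundamental_form :: "('a, 'n::finite) chart set \<Rightarrow> ('a, 'n) tensor_field \<Rightarrow>
    ('b \<Rightarrow> 'a) \<Rightarrow> ('b, 'a, 'n) field_along \<Rightarrow>
    ('b, 'm::finite) chart \<Rightarrow> real ^ 'm \<Rightarrow> real ^ 'm \<Rightarrow> real ^ 'm \<Rightarrow> real" where
  "second_fundamental_form A g \<iota> n d x u v =
     (let p = chart_inv d x; c = chart_at A (\<iota> p); F = coord_rep d c \<iota>;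
          dF = (\<lambda>y. frechet_derivative F (at y)) in
      g c (F x) [frechet_derivative (\<lambda>y. dF y v) (at x) u
                   + levi_civita (g c) (F x) (dF x u) (dF x v), n c p])"

definition mean_curvature :: "('a, 7) chart set \<Rightarrow> ('a, 7) tensor_field \<Rightarrow>
    ('b \<Rightarrow> 'a) \<Rightarrow> ('b, 'a, 7) field_along \<Rightarrow> ('b, 6) chart \<Rightarrow> real ^ 6 \<Rightarrow> real" where
  "mean_curvature A g \<iota> n d x =
     1 / 6 * trace_form (pullback A \<iota> g d x) (second_fundamental_form A g \<iota> n d x)"

text \<open>\<open>I v = P(n, v)\<close>, as an endomorphism of the tangent space of the hypersurface.\<close>
definition induced_I :: "('a, 7) chart set \<Rightarrow> ('a, 7) tensor_field \<Rightarrow> ('a, 7) tensor_field \<Rightarrow>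
    ('b \<Rightarrow> 'a) \<Rightarrow> ('b, 'a, 7) field_along \<Rightarrow> ('b, 6) endo_field" where
  "induced_I A g \<phi> \<iota> n d x v =
     (let p = chart_inv d x; c = chart_at A (\<iota> p); F = coord_rep d c \<iota>;
          dF = frechet_derivative F (at x) in
      (THE w. dF w = cross_prod (g c (F x)) (\<phi> c (F x)) (n c p) (dF v)))"

definition induced_psi_plus :: "('a, 7) chart set \<Rightarrow> ('a, 7) tensor_field \<Rightarrow>
    ('a, 7) tensor_field \<Rightarrow> ('b \<Rightarrow> 'a) \<Rightarrow> ('b, 'a, 7) field_along \<Rightarrow> ('b \<Rightarrow> real) \<Rightarrow>
    ('b, 6) tensor_field" where
  "induced_psi_plus A g \<phi> \<iota> n \<theta> d x vs =
     cos (\<theta> (chart_inv d x)) * pullback A \<iota> \<phi> d x vs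
     - sin (\<theta> (chart_inv d x)) *
         pullback_contr A \<iota> n (\<lambda>c y. star_phi (g c y) (\<phi> c y)) d x vs"

definition induced_psi_minus :: "('a, 7) chart set \<Rightarrow> ('a, 7) tensor_field \<Rightarrow>
    ('a, 7) tensor_field \<Rightarrow> ('b \<Rightarrow> 'a) \<Rightarrow> ('b, 'a, 7) field_along \<Rightarrow> ('b \<Rightarrow> real) \<Rightarrow>
    ('b, 6) tensor_field" where
  "induced_psi_minus A g \<phi> \<iota> n \<theta> d x vs =
     sin (\<theta> (chart_inv d x)) * pullback A \<iota> \<phi> d x vs
     + cos (\<theta> (chart_inv d x)) *
         pullback_contr A \<iota> n (\<lambda>c y. star_phi (g c y) (\<phi> c y)) d x vs"

definition induced_type :: "('a, 7) chart set \<Rightarrow> ('a, 7) tensor_field \<Rightarrow>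
    ('a, 7) tensor_field \<Rightarrow> ('b, 6) chart set \<Rightarrow> ('b \<Rightarrow> 'a) \<Rightarrow> ('b, 'a, 7) field_along \<Rightarrow>
    ('b \<Rightarrow> real) \<Rightarrow> su3_class set \<Rightarrow> bool" where
  "induced_type A g \<phi> AM \<iota> n \<theta> U \<longleftrightarrow>
     su3_type AM (pullback A \<iota> g) (induced_I A g \<phi> \<iota> n)
       (induced_psi_plus A g \<phi> \<iota> n \<theta>) (induced_psi_minus A g \<phi> \<iota> n \<theta>) U"

end

theory Submission
  imports Defs
begin

text \<open>Since \<open>\<langle>P(x, y), P(z, w)\<rangle> = \<langle>x, z\<rangle>\<langle>y, w\<rangle> - \<langle>x, w\<rangle>\<langle>y, z\<rangle> - *\<phi>(x, y, z, w)\<close> and the derivation action of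
  \<open>so(7)\<close> on \<open>\<phi>\<close> has image \<open>{Y \<lrcorner> *\<phi>}\<close>, type \<open>X\<^sub>1\<close> means \<open>\<nabla>\<^sub>x\<phi> = k/4 x \<lrcorner> *\<phi>\<close> on the ambient manifold.
  By the formulas of Gauss and Weingarten the hypersurface, with shape operator \<open>A\<close>, then satisfies
  \<open>\<nabla>\<omega>(u, v, w) = \<psi>\<^sub>+(Lu, v, w)\<close> for
  \<open>L = cos \<theta> A - k/4 sin \<theta> - I (sin \<theta> A + k/4 cos \<theta>)\<close>.
  For a form \<open>\<psi>\<^sub>+(L\<cdot>, \<cdot>, \<cdot>)\<close> the classes \<open>W\<^sub>1\<^sup>\<plusminus>\<close>, \<open>W\<^sub>2\<^sup>\<plusminus>\<close> and \<open>W\<^sub>3\<close> are read off \<open>L\<close>: they correspond to its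
  components in \<open>\<real>\<close> and \<open>\<real>I\<close>, its trace-free symmetric and skew parts commuting with \<open>I\<close>, and its symmetric
  part anticommuting with \<open>I\<close>; the skew anticommuting part, corresponding to \<open>W\<^sub>4\<close>, is absent because \<open>A\<close> is
  symmetric. Finally \<open>\<nabla> + \<xi>\<close> makes the restriction of \<open>\<phi>\<close> and its companion parallel, so that
  \<open>\<eta> = (d\<theta> \<circ> I)/3\<close> compensates for the rotation of \<open>\<Psi>\<close> by \<open>\<theta>\<close>.\<close>

section \<open>Inner products and cross products\<close>

text \<open>Two choices in the definitions shape the proof. The induced fields are computed, at each
  point, in the chart that \<open>chart_at\<close> picks there, and these picks need not vary
  continuously; before such a field can be differentiated it must be shown to agree near the point
  with an expression in one fixed chart. Similarly \<open>star_phi\<close> is written in a frame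
  picked by \<open>SOME\<close> and becomes manageable only after it is expressed through the cross
  product. Secondly, \<open>su3_type\<close> asks for some family of components, so each "only if"
  needs the uniqueness of the decomposition; it is obtained by applying \<open>r_form\<close> to an
  arbitrary family. The operator of the overview arises as follows: the derivative of \<omega> is
  given by the restriction of \<phi> with \<open>b = A - k/4 I\<close> in its first argument, while
  \<open>\<psi>\<^sub>+\<close> is that restriction precomposed with
  \<open>cos \<theta> + sin \<theta> I\<close>; hence
  \<open>L = (cos \<theta> - sin \<theta> I) b\<close>. The constants in \<open>type_X1\<close> and
  in the equation for the exterior derivative agree because antisymmetrising over four arguments
  multiplies by 4.\<close>

lemmas linear_rules = linear_add linear_diff linear_neg linear_scale linear_0

locale inner_form =
  fixes ip :: "real ^ 'n::finite \<Rightarrow> real ^ 'n \<Rightarrow> real"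
  assumes bilinear_ip: "bilinear ip"
    and ip_commute: "ip u v = ip v u"
    and ip_pos: "v \<noteq> 0 \<Longrightarrow> ip v v > 0"
begin

lemma linear_ip_left: "linear (\<lambda>u. ip u v)" and linear_ip_right: "linear (\<lambda>v. ip u v)"
  using bilinear_ip by (auto simp: bilinear_def)

lemmas ip_simps [simp] =
  linear_add[OF linear_ip_left] linear_add[OF linear_ip_right]
  linear_diff[OF linear_ip_left] linear_diff[OF linear_ip_right]
  linear_neg[OF linear_ip_left] linear_neg[OF linear_ip_right]
  linear_0[OF linear_ip_left] linear_0[OF linear_ip_right]
  linear_scale[OF linear_ip_left] linear_scale[OF linear_ip_right]

lemma ip_sum_left: "ip (sum f S) v = (\<Sum>i\<in>S. ip (f i) v)"
  and ip_sum_right: "ip v (sum f S) = (\<Sum>i\<in>S. ip v (f i))"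
  using linear_sum[OF linear_ip_left] linear_sum[OF linear_ip_right] by auto

lemma ip_nondegenerate: "(\<And>w. ip u w = ip v w) \<Longrightarrow> u = v"
  using ip_pos[of "u - v"] by fastforce

lemma ip_eq_0_iff: "ip v v = 0 \<longleftrightarrow> v = 0"
  using ip_pos[of v] by fastforce

definition frame :: "('n \<Rightarrow> real ^ 'n) \<Rightarrow> bool" where
  "frame e \<longleftrightarrow> (\<forall>i j. ip (e i) (e j) = (if i = j then 1 else 0))"

lemma frame_inj: "frame e \<Longrightarrow> inj e"
  unfolding frame_def inj_def by (metis zero_neq_one)

lemma orthonormal_independent:
  assumes "finite S" "\<And>i j. i \<in> S \<Longrightarrow> j \<in> S \<Longrightarrow> ip i j = (if i = j then 1 else 0)"
  shows "independent S"
proof -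
  have "u v = 0" if "(\<Sum>w\<in>S. u w *\<^sub>R w) = 0" "v \<in> S" for u v
  proof -
    have "0 = ip (\<Sum>w\<in>S. u w *\<^sub>R w) v" using that by simp
    also have "\<dots> = (\<Sum>w\<in>S. if w = v then u w else 0)"
      unfolding ip_sum_left using assms(2) that by (intro sum.cong) auto
    also have "\<dots> = u v" using assms(1) that by simp
    finally show ?thesis by simp
  qed
  then show ?thesis using assms(1) by (auto simp: dependent_finite)
qed

lemma frame_expand:
  assumes "frame e" shows "(\<Sum>i\<in>UNIV. ip v (e i) *\<^sub>R e i) = v"
proof -
  have ind: "independent (range e)"
    by (rule orthonormal_independent) (use assms in \<open>auto simp: frame_def\<close>)
  have "card (range e) = CARD('n)" using frame_inj[OF assms] by (simp add: card_image)
  then have "v \<in> span (range e)"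
    by (metis DIM_cart DIM_real UNIV_I card_ge_dim_independent dim_UNIV ind mult.right_neutral
        order_refl subsetD subset_UNIV)
  then obtain a where a: "v = (\<Sum>w\<in>range e. a w *\<^sub>R w)"
    by (subst (asm) span_finite) auto
  also have "\<dots> = (\<Sum>i\<in>UNIV. a (e i) *\<^sub>R e i)"
    using frame_inj[OF assms] by (simp add: sum.reindex)
  finally have v: "v = (\<Sum>i\<in>UNIV. a (e i) *\<^sub>R e i)" .
  have "ip v (e j) = a (e j)" for j
  proof -
    have "ip v (e j) = (\<Sum>i\<in>UNIV. if i = j then a (e i) else 0)"
      using assms unfolding v ip_sum_left frame_def by (intro sum.cong) auto
    then show ?thesis by simp
  qed
  then show ?thesis using v by simp
qed

lemma frame_linear:
  fixes f :: "real ^ 'n \<Rightarrow> real"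
  assumes "frame e" "linear f"
  shows "(\<Sum>i\<in>UNIV. ip x (e i) * f (e i)) = f x"
  by (subst (2) frame_expand[OF assms(1), symmetric])
     (simp add: linear_sum[OF assms(2)] linear_scale[OF assms(2)])

lemma parseval:
  assumes "frame e" shows "(\<Sum>i\<in>UNIV. ip x (e i) * ip y (e i)) = ip x y"
  using frame_linear[OF assms linear_ip_right[of y], of x] by (simp add: ip_commute)

text \<open>Expanding one argument in \<open>f\<close> and collapsing the other in \<open>e\<close>
  exchanges the two frames. Traces thereby become independent of the arbitrary
  \<open>some_frame\<close>.\<close>

lemma trace_indep:
  fixes b :: "real ^ 'n \<Rightarrow> real ^ 'n \<Rightarrow> real"
  assumes "frame e" "frame f" "bilinear b"
  shows "(\<Sum>i\<in>UNIV. b (e i) (e i)) = (\<Sum>i\<in>UNIV. b (f i) (f i))"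
proof -
  have lin: "linear (b x)" "linear (\<lambda>x. b x y)" for x y using assms(3) by (auto simp: bilinear_def)
  have "(\<Sum>i\<in>UNIV. b (e i) (e i)) = (\<Sum>i\<in>UNIV. \<Sum>j\<in>UNIV. ip (e i) (f j) * b (e i) (f j))"
    using frame_linear[OF assms(2) lin(1)] by simp
  also have "\<dots> = (\<Sum>j\<in>UNIV. \<Sum>i\<in>UNIV. ip (f j) (e i) * b (e i) (f j))"
    by (subst sum.swap) (simp add: ip_commute)
  also have "\<dots> = (\<Sum>j\<in>UNIV. b (f j) (f j))"
    using frame_linear[OF assms(1) lin(2)] by simp
  finally show ?thesis .
qed

lemma exists_orthogonal:
  assumes "finite S" "card S < CARD('n)"
  obtains v where "ip v v = 1" "\<And>w. w \<in> S \<Longrightarrow> ip w v = 0"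
proof -
  \<comment> \<open>\<open>s w\<close> represents the functional \<open>ip w\<close> by the standard
    inner product, so the problem becomes Euclidean orthogonality to fewer than
    \<open>CARD('n)\<close> vectors.\<close>
  define s where "s w = (\<chi> i. ip w (axis i 1))" for w
  have s: "ip w v = s w \<bullet> v" for w v
  proof -
    have "ip w v = ip w (\<Sum>i\<in>UNIV. (v $ i) *\<^sub>R axis i 1)"
      by (simp add: basis_expansion scalar_mult_eq_scaleR[symmetric])
    then show ?thesis unfolding ip_sum_right s_def inner_vec_def by (simp add: mult.commute)
  qed
  have "dim (s ` S) < DIM(real ^ 'n)"
    using assms card_image_le[of S s] dim_le_card'[of "s ` S"] by simp
  then obtain v where v: "v \<noteq> 0" "\<And>y. y \<in> span (s ` S) \<Longrightarrow> orthogonal v y"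
    using orthogonal_to_subspace_exists by blast
  have "ip w v = 0" if "w \<in> S" for w
    using v(2)[OF span_base[OF imageI[OF that]]] s[of w v] by (simp add: orthogonal_def inner_commute)
  moreover have "ip v v > 0" using v ip_pos by auto
  ultimately show ?thesis using that[of "(1 / sqrt (ip v v)) *\<^sub>R v"]
    by (simp add: field_simps flip: power2_eq_square)
qed

text \<open>Orthonormal sets are extended one vector at a time up to full cardinality and then
  indexed by the coordinate type.\<close>

lemma frame_exists: obtains e where "frame e"
proof -
  have "\<exists>S. finite S \<and> card S = m \<and> (\<forall>i\<in>S. \<forall>j\<in>S. ip i j = (if i = j then 1 else 0))"
    if "m \<le> CARD('n)" for m
    using that
  proof (induction m)
    case 0 show ?case by (intro exI[of _ "{}"]) auto
  next
    case (Suc m)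
    then obtain S where S: "finite S" "card S = m"
      "\<And>i j. i \<in> S \<Longrightarrow> j \<in> S \<Longrightarrow> ip i j = (if i = j then 1 else 0)" by auto
    obtain v where v: "ip v v = 1" "\<And>w. w \<in> S \<Longrightarrow> ip w v = 0"
      using exists_orthogonal[OF S(1)] S(2) Suc.prems by auto
    then have "v \<notin> S" by (metis zero_neq_one)
    then have "finite (insert v S)" "card (insert v S) = Suc m" using S by auto
    moreover have "\<forall>i\<in>insert v S. \<forall>j\<in>insert v S. ip i j = (if i = j then 1 else 0)"
    proof (intro ballI)
      fix i j assume "i \<in> insert v S" "j \<in> insert v S"
      then consider "i = v" "j = v" | "i = v" "j \<in> S" | "i \<in> S" "j = v" | "i \<in> S" "j \<in> S" by auto
      then show "ip i j = (if i = j then 1 else 0)"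
        using S(3)[of i j] v(1) v(2)[of i] v(2)[of j] \<open>v \<notin> S\<close> ip_commute[of v j] by cases auto
    qed
    ultimately show ?case by blast
  qed
  from this[OF order_refl] obtain S where S: "finite S" "card S = CARD('n)"
    "\<And>i j. i \<in> S \<Longrightarrow> j \<in> S \<Longrightarrow> ip i j = (if i = j then 1 else 0)" by blast
  obtain e where e: "bij_betw e (UNIV :: 'n set) S"
    using finite_same_card_bij[of "UNIV :: 'n set" S] S by auto
  have "ip (e i) (e j) = (if i = j then 1 else 0)" for i j
    using S(3)[of "e i" "e j"] bij_betw_apply[OF e] bij_betw_imp_inj_on[OF e]
    by (simp add: inj_eq)
  then have "frame e" by (simp add: frame_def)
  then show ?thesis by (rule that)
qed

definition riesz :: "(real ^ 'n \<Rightarrow> real) \<Rightarrow> real ^ 'n" where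
  "riesz f = (THE w. \<forall>v. ip w v = f v)"

lemma riesz_unique: "(\<And>v. ip w v = f v) \<Longrightarrow> riesz f = w"
  unfolding riesz_def using ip_nondegenerate by (intro the_equality) auto

lemma ip_riesz [simp]:
  assumes "linear f" shows "ip (riesz f) v = f v"
proof -
  obtain e where e: "frame e" by (rule frame_exists)
  have "ip (\<Sum>i\<in>UNIV. f (e i) *\<^sub>R e i) v = f v" for v
    using frame_linear[OF e assms, of v] by (simp add: ip_sum_left ip_commute[of "e _" v] mult.commute)
  then show ?thesis using riesz_unique by metis
qed

lemma linear_riesz:
  assumes "\<And>u. linear (f u)" "\<And>v. linear (\<lambda>u. f u v)"
  shows "linear (\<lambda>u. riesz (f u))"
  by (rule linearI; rule ip_nondegenerate)
     (simp_all add: assms linear_add[OF assms(2)] linear_scale[OF assms(2)])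

lemma frame_image:
  assumes "frame e" "\<And>x y. ip (J x) (J y) = ip x y" shows "frame (\<lambda>i. J (e i))"
  using assms by (simp add: frame_def)

text \<open>An isometry carries a frame to a frame. For the complex structure this says that
  \<open>B\<close> and \<open>I B\<close> have the same trace.\<close>

lemma frame_comp_sum:
  fixes b :: "real ^ 'n \<Rightarrow> real ^ 'n \<Rightarrow> real"
  assumes "frame e" "linear J" "\<And>x y. ip (J x) (J y) = ip x y" "bilinear b"
  shows "(\<Sum>i\<in>UNIV. b (J (e i)) (J (e i))) = (\<Sum>i\<in>UNIV. b (e i) (e i))"
  by (rule trace_indep[OF frame_image[OF assms(1,3)] assms(1,4)])

lemma card_frame:
  assumes "frame e" shows "(\<Sum>i\<in>UNIV. ip (e i) (e i)) = real CARD('n)"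
  using assms by (simp add: frame_def)

end

text \<open>The common part of the seven-dimensional product \<open>P\<close> and its
  six-dimensional counterpart \<open>Q\<close>: the axioms make \<open>ip (P x y) z\<close> an
  alternating trilinear form.\<close>

locale cross_product = inner_form ip for ip :: "real ^ 'n::finite \<Rightarrow> real ^ 'n \<Rightarrow> real" +
  fixes P :: "real ^ 'n \<Rightarrow> real ^ 'n \<Rightarrow> real ^ 'n"
  assumes bilinear_P: "bilinear P"
    and P_self [simp]: "P x x = 0"
    and ip_P_right [simp]: "ip (P x y) y = 0"
begin

lemma linear_P_left: "linear (\<lambda>u. P u v)" and linear_P_right: "linear (\<lambda>v. P u v)"
  using bilinear_P by (auto simp: bilinear_def)

lemmas P_simps [simp] =
  linear_add[OF linear_P_left] linear_add[OF linear_P_right]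
  linear_diff[OF linear_P_left] linear_diff[OF linear_P_right]
  linear_neg[OF linear_P_left] linear_neg[OF linear_P_right]
  linear_0[OF linear_P_left] linear_0[OF linear_P_right]
  linear_scale[OF linear_P_left] linear_scale[OF linear_P_right]

lemma P_skew: "P y x = - P x y"
proof -
  have "P (x + y) (x + y) = P x x + P x y + (P y x + P y y)" by (simp only: P_simps(1,2) add_ac)
  then have "P y x + P x y = 0" by (simp only: P_self add_0_left add_0_right add.commute)
  then show ?thesis by (rule eq_neg_iff_add_eq_0[THEN iffD2])
qed

lemma triple_skew: "ip (P x z) y = - ip (P x y) z"
proof -
  have "ip (P x (y + z)) (y + z) = 0" by (rule ip_P_right)
  then show ?thesis by simp
qed

lemma triple_cycle: "ip (P y z) x = ip (P x y) z"
  by (metis triple_skew P_skew ip_simps(5) minus_minus)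

lemma linear_triple:
  "linear (\<lambda>x. ip (P x y) z)" "linear (\<lambda>y. ip (P x y) z)" "linear (\<lambda>z. ip (P x y) z)"
  by (auto intro!: linearI simp: scaleR_add_right)

lemma ip_P_left [simp]: "ip (P x y) x = 0"
  by (metis ip_P_right triple_cycle P_self linear_0 linear_ip_left)

end

text \<open>\<open>P_polar\<close> is the norm identity |P(x, y)|^2 = |x|^2 |y|^2 - <x, y>^2
  polarised in x, the characteristic property of a vector cross product.\<close>

locale g2_alg = cross_product ip P
  for ip :: "real ^ 7 \<Rightarrow> real ^ 7 \<Rightarrow> real" and P +
  assumes P_polar: "ip (P x y) (P y w) = ip x y * ip y w - ip x w * ip y y"
begin

text \<open>For the cross product of a \<open>G\<^sub>2\<close>-structure this is \<open>- *\<phi>\<close>.\<close>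
definition assoc_form :: "real ^ 7 \<Rightarrow> real ^ 7 \<Rightarrow> real ^ 7 \<Rightarrow> real ^ 7 \<Rightarrow> real" where
  "assoc_form x y z w = ip (P x y) (P z w) - ip x z * ip y w + ip x w * ip y z"

lemma ip_P_P: "ip (P x y) (P z w) = ip x z * ip y w - ip x w * ip y z + assoc_form x y z w"
  by (simp add: assoc_form_def)

lemma assoc_form_skew:
  "assoc_form y x z w = - assoc_form x y z w"
  "assoc_form x y w z = - assoc_form x y z w"
  "assoc_form x z y w = - assoc_form x y z w"
proof -
  show "assoc_form y x z w = - assoc_form x y z w"
    by (simp add: assoc_form_def P_skew[of y x])
  show "assoc_form x y w z = - assoc_form x y z w"
    by (simp add: assoc_form_def P_skew[of w z])
  \<comment> \<open>This is \<open>P_polar\<close>. Skewness in the middle pair follows by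
    polarisation, while the first and the last pair only use the skewness of
    \<open>P\<close>.\<close>
  have alt: "assoc_form x y y w = 0" for x y w
    by (simp add: assoc_form_def P_polar)
  have "assoc_form x (y + z) (y + z) w = 0" "assoc_form x y y w = 0" "assoc_form x z z w = 0"
    by (rule alt)+
  moreover have "assoc_form x (y + z) (y + z) w =
      assoc_form x y y w + assoc_form x y z w + assoc_form x z y w + assoc_form x z z w"
    by (simp add: assoc_form_def algebra_simps)
  ultimately show "assoc_form x z y w = - assoc_form x y z w" by linarith
qed

lemma linear_assoc_form:
  "linear (\<lambda>x. assoc_form x y z w)" "linear (\<lambda>y. assoc_form x y z w)"
  "linear (\<lambda>z. assoc_form x y z w)" "linear (\<lambda>w. assoc_form x y z w)"
  by (auto intro!: linearI simp: assoc_form_def algebra_simps)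

lemma assoc_form_zero [simp]:
  "assoc_form x x z w = 0" "assoc_form x y x w = 0" "assoc_form x y z x = 0"
  "assoc_form x y y w = 0" "assoc_form x y z y = 0" "assoc_form x y z z = 0"
proof -
  show a: "assoc_form x x z w = 0" for x z w using assoc_form_skew(1)[of x x z w] by simp
  show b: "assoc_form x y y w = 0" for x y w using assoc_form_skew(3)[of x y y w] by simp
  show "assoc_form x y z z = 0" for x y z using assoc_form_skew(2)[of x y z z] by simp
  show c: "assoc_form x y x w = 0" for x y w
    using assoc_form_skew(1)[of y x x w] b by simp
  show "assoc_form x y z x = 0" using assoc_form_skew(2)[of x y x z] c by simp
  show "assoc_form x y z y = 0" using assoc_form_skew(2)[of x y y z] b by simp
qed

text \<open>The \<open>assoc_form\<close> term has the repeated argument \<open>e i\<close> and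
  vanishes; what remains is 7 - 1 times \<open>ip x y\<close>.\<close>

lemma ip_P_P_trace:
  assumes e: "frame e"
  shows "(\<Sum>i\<in>UNIV. ip (P x (e i)) (P y (e i))) = 6 * ip x y"
proof -
  have "(\<Sum>i\<in>UNIV. ip (P x (e i)) (P y (e i)))
      = (\<Sum>i\<in>UNIV. ip x y * ip (e i) (e i) - ip y (e i) * ip x (e i))"
    by (simp add: ip_P_P ip_commute mult.commute)
  also have "\<dots> = 6 * ip x y"
    by (simp add: sum_subtractf flip: sum_distrib_left)
       (simp add: card_frame[OF e] parseval[OF e] ip_commute)
  finally show ?thesis .
qed

text \<open>The difference of the two sides is skew in \<open>u, v\<close>, skew in \<open>x, y, z\<close>, and changes sign when
  \<open>(u, v, x, y, z)\<close> is replaced by \<open>(y, z, x, u, v)\<close>; hence it is totally skew, and it vanishes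
  because this replacement is an even permutation.\<close>
lemma assoc_form_P:
  "assoc_form (P u v) x y z =
     ip u x * ip (P v y) z + ip u y * ip (P x v) z + ip u z * ip (P x y) v
     - ip v x * ip (P u y) z - ip v y * ip (P x u) z - ip v z * ip (P x y) u"
proof -
  define D where "D u v x y z = assoc_form (P u v) x y z -
     (ip u x * ip (P v y) z + ip u y * ip (P x v) z + ip u z * ip (P x y) v
     - ip v x * ip (P u y) z - ip v y * ip (P x u) z - ip v z * ip (P x y) u)" for u v x y z
  have D_uv: "D v u x y z = - D u v x y z" for u v x y z
    unfolding D_def P_skew[of v u] by (simp add: assoc_form_def)
  have D_xy: "D u v y x z = - D u v x y z" for u v x y z
    unfolding D_def assoc_form_skew(3)[of _ x y]
    by (simp add: P_skew[of y x] P_skew[of y v] P_skew[of v x] P_skew[of y u] P_skew[of u x])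
  have D_yz: "D u v x z y = - D u v x y z" for u v x y z
    unfolding D_def assoc_form_skew(2)[of _ _ y z] triple_skew[of v z y] triple_skew[of u z y]
      triple_skew[of x z v] triple_skew[of x z u] triple_skew[of x y v] triple_skew[of x y u]
    by simp
  have D_swap: "D u v x y z = - D y z x u v" for u v x y z
  proof -
    have *: "ip (P (P u v) x) (P y z) = - ip (P (P y z) x) (P u v)"
      by (metis triple_cycle P_skew ip_simps(5))
    have c: "ip (P z u) v = ip (P u v) z" "ip (P y u) v = ip (P u v) y"
      "ip (P y z) u = ip (P u y) z" "ip (P y z) v = ip (P v y) z"
      "ip (P x z) v = - ip (P x v) z" "ip (P x u) y = - ip (P x y) u"
      by (metis triple_cycle triple_skew)+
    show ?thesis
      unfolding D_def assoc_form_def c * using c by (simp add: ip_commute algebra_simps)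
  qed
  have D_cyc: "D a b c p q = D b c a p q" for a b c p q
    using D_swap[of p q c a b] D_swap[of p q a b c] D_yz[of p q a c b] D_xy[of p q c a b] by simp
  have D_vx: "D a c b p q = - D a b c p q" for a b c p q
    using D_cyc[of a c b p q] D_cyc[of a b c p q] D_uv[of b c a p q] by simp
  have "D u v x y z = 0" for u v x y z
    using D_xy[of u v x y z] D_vx[of u v y x z] D_uv[of u y v x z] D_yz[of y u v x z]
      D_xy[of y u v z x] D_vx[of y u z v x] D_yz[of y z u v x] D_xy[of y z u x v]
      D_swap[of u v x y z]
    by linarith
  from this[of u v x y z] show ?thesis unfolding D_def by simp
qed

lemma P_P: "P x (P x y) = ip x y *\<^sub>R x - ip x x *\<^sub>R y"
proof (rule ip_nondegenerate)
  fix w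
  have "ip (P x (P x y)) w = ip (P w x) (P x y)" by (metis triple_cycle)
  then show "ip (P x (P x y)) w = ip (ip x y *\<^sub>R x - ip x x *\<^sub>R y) w"
    by (simp add: P_polar ip_commute)
qed

section \<open>The hyperplane orthogonal to a unit vector and its complex structure\<close>

context
  fixes n assumes n: "ip n n = 1"
begin

private abbreviation "N \<equiv> {x. ip n x = 0}"

lemma ip_P_n_skew: "ip (P n x) y = - ip x (P n y)"
  by (metis triple_skew ip_commute)

lemma P_n_P_n: "x \<in> N \<Longrightarrow> P n (P n x) = - x"
  using n by (simp add: P_P)

lemma ip_P_n_P_n: "x \<in> N \<Longrightarrow> y \<in> N \<Longrightarrow> ip (P n x) (P n y) = ip x y"
  by (simp add: ip_P_n_skew P_n_P_n)

lemma P_n_in: "P n x \<in> N"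
  using ip_P_left by (simp add: ip_commute[of n])

text \<open>Both sides are values of \<open>assoc_form\<close> with \<open>n\<close> in one slot,
  because the metric corrections vanish on the hyperplane; the slots differ by an even permutation.
  It makes the restricted three-form of type (3, 0) + (0, 3).\<close>

lemma triple_P_n:
  assumes "x \<in> N" "y \<in> N" "z \<in> N"
  shows "ip (P (P n x) y) z = ip (P x y) (P n z)"
proof -
  have "ip (P (P n x) y) z = ip (P y z) (P n x)" by (simp add: triple_cycle)
  also have "\<dots> = assoc_form y z n x" using assms by (simp add: assoc_form_def ip_commute)
  also have "\<dots> = assoc_form x y n z"
    using assoc_form_skew(2)[of y z x n] assoc_form_skew(3)[of y x z n]
      assoc_form_skew(1)[of x y z n] assoc_form_skew(2)[of x y n z] by simp
  also have "\<dots> = ip (P x y) (P n z)" using assms by (simp add: assoc_form_def ip_commute)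
  finally show ?thesis .
qed

text \<open>\<open>Q\<close> is the tangential part of \<open>P\<close>. Its antilinearity is
  \<open>triple_P_n\<close> tested on tangent vectors, and the last product in the third identity is
  that of the normal components which \<open>Q\<close> discards.\<close>

lemma tangential_triple:
  assumes "x \<in> N" "y \<in> N" "z \<in> N" "w \<in> N"
  defines "Q \<equiv> \<lambda>x y. P x y - ip (P x y) n *\<^sub>R n"
  shows "ip (Q x y) z = ip (P x y) z"
    "Q (P n x) y = - P n (Q x y)"
    "ip (Q x y) (Q z w) = ip x z * ip y w - ip x w * ip y z + assoc_form x y z w
       - ip x (P n y) * ip z (P n w)"
proof -
  have Q_in: "Q x y \<in> N" for x y
    using n by (simp add: Q_def ip_commute)
  show *: "ip (Q x y) z = ip (P x y) z" using assms by (simp add: Q_def)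
  show "Q (P n x) y = - P n (Q x y)"
  proof (rule ip_nondegenerate)
    fix w
    define w' where "w' = w - ip n w *\<^sub>R n"
    have w': "w' \<in> N" "w = w' + ip n w *\<^sub>R n" using n by (auto simp: w'_def)
    have "ip (Q (P n x) y) w' = ip (P (P n x) y) w'" using w' by (simp add: Q_def ip_commute)
    also have "\<dots> = ip (P x y) (P n w')" using triple_P_n assms w' by blast
    also have "\<dots> = ip (Q x y) (P n w')" using P_n_in[of w'] by (simp add: Q_def)
    also have "\<dots> = ip (- P n (Q x y)) w'" by (simp add: ip_P_n_skew)
    finally have "ip (Q (P n x) y) w' = ip (- P n (Q x y)) w'" .
    moreover have "ip (Q (P n x) y) n = 0" "ip (- P n (Q x y)) n = 0"
      using Q_in[of "P n x" y] P_n_in[of "Q x y"] by (simp_all add: ip_commute)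
    ultimately show "ip (Q (P n x) y) w = ip (- P n (Q x y)) w" by (subst (1 2) w'(2)) simp
  qed
  have "ip (P x y) n = - ip x (P n y)" "ip (P z w) n = - ip z (P n w)"
    by (simp_all add: triple_cycle ip_P_n_skew)
  then show "ip (Q x y) (Q z w) = ip x z * ip y w - ip x w * ip y z + assoc_form x y z w
       - ip x (P n y) * ip z (P n w)"
    using n by (simp add: Q_def ip_P_P ip_commute[of n "P z w"] algebra_simps)
qed

text \<open>The difference \<open>T\<close> of the two sides is totally skew and satisfies \<open>T(Ix, y, Iz, w) = T(x, y, z, w)\<close>
  for \<open>I = P n\<close>; applying this to two pairs of slots with a common member gives \<open>T = - T\<close>.\<close>
lemma assoc_form_tangential:
  assumes "x \<in> N" "y \<in> N" "z \<in> N" "w \<in> N"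
  shows "assoc_form x y z w = ip x (P n y) * ip z (P n w) + ip x (P n z) * ip w (P n y)
    + ip x (P n w) * ip y (P n z)"
proof -
  define Q where "Q x y = P x y - ip (P x y) n *\<^sub>R n" for x y
  define T where "T x y z w = assoc_form x y z w - (ip x (P n y) * ip z (P n w)
    + ip x (P n z) * ip w (P n y) + ip x (P n w) * ip y (P n z))" for x y z w
  have om: "ip y (P n x) = - ip x (P n y)" for x y by (metis ip_P_n_skew ip_commute)
  have T12: "T y x z w = - T x y z w" for x y z w
    unfolding T_def assoc_form_skew(1)[of y x] using om[of x y] om[of x w] om[of y z]
    by (simp add: om[of z x] om[of w y] algebra_simps)
  have T23: "T x z y w = - T x y z w" for x y z w
    unfolding T_def assoc_form_skew(3)[of x z y] by (simp add: om[of y z] om[of w y] om[of z w] algebra_simps)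
  have T13: "T (P n x) y (P n z) w = T x y z w" if "x \<in> N" "y \<in> N" "z \<in> N" "w \<in> N" for x y z w
  proof -
    have "ip (Q (P n x) y) (Q (P n z) w) = ip (P n (Q x y)) (P n (Q z w))"
      using tangential_triple(2) that by (simp add: Q_def)
    also have "\<dots> = ip (Q x y) (Q z w)"
      by (rule ip_P_n_P_n) (use n in \<open>simp_all add: Q_def ip_commute\<close>)
    finally have "ip (P n x) (P n z) * ip y w - ip (P n x) w * ip y (P n z) + assoc_form (P n x) y (P n z) w
         - ip (P n x) (P n y) * ip (P n z) (P n w)
       = ip x z * ip y w - ip x w * ip y z + assoc_form x y z w - ip x (P n y) * ip z (P n w)"
      using tangential_triple(3) that P_n_in unfolding Q_def by metis
    then show ?thesis
      using that P_n_in[of x] P_n_in[of z] P_n_in[of y] P_n_in[of w]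
      by (simp add: T_def ip_P_n_P_n ip_P_n_skew P_n_P_n om[of w y] algebra_simps)
  qed
  have T12': "T (P n x) (P n y) z w = T x y z w" if "x \<in> N" "y \<in> N" "z \<in> N" "w \<in> N" for x y z w
    using T13[of x z y w] T23[of "P n x" z "P n y" w] T23[of x z y w] that by simp
  have T23': "T x (P n y) (P n z) w = T x y z w" if "x \<in> N" "y \<in> N" "z \<in> N" "w \<in> N" for x y z w
    using T13[of y x z w] T12[of x "P n y" "P n z" w] T12[of x y z w] that by simp
  have neg: "T x (- y) z w = - T x y z w" for x y z w
    by (simp add: T_def linear_neg[OF linear_assoc_form(2)])
  have "T x y z w = T (P n x) (P n y) z w" using T12' assms by simp
  also have "\<dots> = T (P n x) (P n (P n y)) (P n z) w"
    by (rule T23'[symmetric]) (use assms P_n_in in auto)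
  also have "\<dots> = - T (P n x) y (P n z) w" using P_n_P_n[OF assms(2)] by (simp only: neg)
  also have "\<dots> = - T x y z w" using T13[OF assms] by simp
  finally have "T x y z w = 0" by simp
  then show ?thesis by (simp add: T_def)
qed

end

end

text \<open>The cross product encodes \<open>\<psi>\<^sub>+\<close> by \<open>\<psi>\<^sub>+(x, y, z) = \<langle>Q(x, y), z\<rangle>\<close>.\<close>
locale su3_alg = cross_product ip Q
  for ip :: "real ^ 6 \<Rightarrow> real ^ 6 \<Rightarrow> real" and Q +
  fixes J :: "real ^ 6 \<Rightarrow> real ^ 6"
  assumes linear_J: "linear J"
    and J_J [simp]: "J (J x) = - x"
    and ip_J_J [simp]: "ip (J x) (J y) = ip x y"
    and Q_J_left [simp]: "Q (J x) y = - J (Q x y)"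
    and ip_Q_Q: "ip (Q x y) (Q z w) = ip x z * ip y w - ip x w * ip y z
       - ip x (J z) * ip y (J w) + ip x (J w) * ip y (J z)"

text \<open>Identities between vectors are checked after applying the injective map
  \<open>D\<close>, which parametrises the hyperplane. In the inner product of two values of
  \<open>Q\<close>, the product of normal components cancels against one of the three terms of the
  restricted \<open>assoc_form\<close>, which leaves \<open>ip_Q_Q\<close>.\<close>

lemma (in g2_alg) su3_hypersurface:
  fixes D :: "real ^ 6 \<Rightarrow> real ^ 7"
  assumes n: "ip n n = 1" and D: "linear D" "inj D" "\<And>v. ip n (D v) = 0"
    and ip6: "\<And>u v. ip6 u v = ip (D u) (D v)"
    and J: "\<And>u. D (J u) = P n (D u)"
    and Q: "\<And>u v. D (Q u v) = P (D u) (D v) - ip (P (D u) (D v)) n *\<^sub>R n"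
  shows "su3_alg ip6 Q J"
proof -
  note D_simps = linear_rules[OF D(1)]
  have D_eq: "D x = D y \<longleftrightarrow> x = y" for x y using D(2) by (simp add: inj_eq)
  have D0: "D v = 0 \<longleftrightarrow> v = 0" for v using D_eq[of v 0] D_simps by simp
  have lin: "linear J" "linear (Q u)" "linear (\<lambda>u. Q u v)" for u v
    by (rule linearI; rule injD[OF D(2)]; simp add: D_simps J Q algebra_simps)+
  have "bilinear ip6"
    unfolding bilinear_def by (intro conjI allI linearI) (simp_all add: ip6 D_simps)
  then interpret ip6: inner_form ip6
    by unfold_locales (use D0 ip_pos ip_commute in \<open>simp_all add: ip6\<close>)
  have Dn: "ip (D v) n = 0" for v using D(3) ip_commute by metis
  have "bilinear Q" using lin by (auto simp: bilinear_def)
  moreover have "Q x x = 0" for x by (rule injD[OF D(2)]) (simp add: Q D_simps)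
  moreover have "ip6 (Q x y) y = 0" for x y using D(3) by (simp add: ip6 Q)
  moreover have JJ: "J (J x) = - x" for x
  proof (rule injD[OF D(2)])
    show "D (J (J x)) = D (- x)" using P_n_P_n[OF n, of "D x"] D(3)[of x] by (simp add: J D_simps)
  qed
  moreover have "ip6 (J x) (J y) = ip6 x y" for x y
    using ip_P_n_P_n[OF n, of "D x" "D y"] D(3)[of x] D(3)[of y] by (simp add: J ip6)
  moreover have QJ: "Q (J x) y = - J (Q x y)" for x y
  proof (rule injD[OF D(2)])
    show "D (Q (J x) y) = D (- J (Q x y))"
      using tangential_triple(2)[OF n, of "D x" "D y" 0 0] D(3)[of x] D(3)[of y]
      by (simp add: D_simps J Q)
  qed
  moreover have "ip6 (Q x y) (Q z w) = ip6 x z * ip6 y w - ip6 x w * ip6 y z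
       - ip6 x (J z) * ip6 y (J w) + ip6 x (J w) * ip6 y (J z)" for x y z w
  proof -
    have "ip6 (Q x y) (Q z w) = ip6 x z * ip6 y w - ip6 x w * ip6 y z
       + assoc_form (D x) (D y) (D z) (D w) - ip6 x (J y) * ip6 z (J w)"
      unfolding ip6 Q J
      by (rule tangential_triple(3)[OF n]) (use D(3) in auto)
    also have "assoc_form (D x) (D y) (D z) (D w) = ip6 x (J y) * ip6 z (J w)
        + ip6 x (J z) * ip6 w (J y) + ip6 x (J w) * ip6 y (J z)"
      unfolding ip6 J by (rule assoc_form_tangential[OF n]) (use D(3) in auto)
    also have "ip6 w (J y) = - ip6 y (J w)"
      unfolding ip6 J by (metis ip_P_n_skew[OF n] ip_commute)
    finally show ?thesis by simp
  qed
  ultimately show ?thesis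
    using lin(1) ip6.inner_form_axioms
    by (simp add: su3_alg_def su3_alg_axioms_def cross_product_def cross_product_axioms_def)
qed

section \<open>Sums over index lists and multilinearity in low rank\<close>

lemma sum_lists_Suc:
  fixes f :: "'i::finite list \<Rightarrow> 'b::comm_monoid_add"
  shows "(\<Sum>is | length is = Suc k. f is) = (\<Sum>i\<in>UNIV. \<Sum>is | length is = k. f (i # is))"
proof -
  have fin: "finite {is :: 'i list. length is = k}" for k
    using finite_lists_length_eq[of "UNIV :: 'i set" k] by simp
  have "{is :: 'i list. length is = Suc k} = case_prod Cons ` (UNIV \<times> {is. length is = k})"
    by (auto simp: length_Suc_conv image_iff)
  moreover have "inj_on (case_prod Cons) (UNIV \<times> {is :: 'i list. length is = k})"
    by (auto simp: inj_on_def)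
  ultimately show ?thesis
    by (simp add: sum.reindex sum.cartesian_product case_prod_unfold)
qed

lemma sum_lists_2: "(\<Sum>is | length is = 2. f is) = (\<Sum>i\<in>UNIV. \<Sum>j\<in>UNIV. f [i, j])"
  for f :: "'i::finite list \<Rightarrow> 'b::comm_monoid_add"
  by (simp add: numeral_2_eq_2 sum_lists_Suc)

lemma sum_lists_3:
  "(\<Sum>is | length is = 3. f is) = (\<Sum>i\<in>UNIV. \<Sum>j\<in>UNIV. \<Sum>k\<in>UNIV. f [i, j, k])"
  for f :: "'i::finite list \<Rightarrow> 'b::comm_monoid_add"
  by (simp add: numeral_3_eq_3 sum_lists_Suc)

lemma multilinear_2_iff: "multilinear 2 a \<longleftrightarrow>
    (\<forall>x y. linear (\<lambda>v. a [v, y]) \<and> linear (\<lambda>v. a [x, v]))"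
proof safe
  fix x y assume *: "multilinear 2 a"
  show "linear (\<lambda>v. a [v, y])" "linear (\<lambda>v. a [x, v])"
    using *[unfolded multilinear_def, rule_format, of "[x, y]" 0]
      *[unfolded multilinear_def, rule_format, of "[x, y]" 1] by auto
next
  assume "\<forall>x y. linear (\<lambda>v. a [v, y]) \<and> linear (\<lambda>v. a [x, v])"
  then show "multilinear 2 a"
    by (auto simp: multilinear_def length_Suc_conv numeral_2_eq_2 less_Suc_eq)
qed

lemma multilinear_3_iff: "multilinear 3 a \<longleftrightarrow>
    (\<forall>x y z. linear (\<lambda>v. a [v, y, z]) \<and> linear (\<lambda>v. a [x, v, z]) \<and> linear (\<lambda>v. a [x, y, v]))"
proof safe
  fix x y z assume *: "multilinear 3 a"
  show "linear (\<lambda>v. a [v, y, z])" "linear (\<lambda>v. a [x, v, z])" "linear (\<lambda>v. a [x, y, v])"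
    using *[unfolded multilinear_def, rule_format, of "[x, y, z]" 0]
      *[unfolded multilinear_def, rule_format, of "[x, y, z]" 1]
      *[unfolded multilinear_def, rule_format, of "[x, y, z]" 2] by auto
next
  assume "\<forall>x y z. linear (\<lambda>v. a [v, y, z]) \<and> linear (\<lambda>v. a [x, v, z]) \<and> linear (\<lambda>v. a [x, y, v])"
  then show "multilinear 3 a"
    by (auto simp: multilinear_def length_Suc_conv numeral_3_eq_3 less_Suc_eq)
qed

lemma alternating_3_iff: "alternating 3 a \<longleftrightarrow>
    (\<forall>x y. a [x, x, y] = 0 \<and> a [x, y, x] = 0 \<and> a [y, x, x] = 0)"
proof safe
  fix x y assume *: "alternating 3 a"
  show "a [x, x, y] = 0" "a [x, y, x] = 0" "a [y, x, x] = 0"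
    using *[unfolded alternating_def, rule_format, of "[x, x, y]" 0 1]
      *[unfolded alternating_def, rule_format, of "[x, y, x]" 0 2]
      *[unfolded alternating_def, rule_format, of "[y, x, x]" 1 2] by auto
next
  assume "\<forall>x y. a [x, x, y] = 0 \<and> a [x, y, x] = 0 \<and> a [y, x, x] = 0"
  then show "alternating 3 a"
    by (auto simp: alternating_def length_Suc_conv numeral_3_eq_3 less_Suc_eq)
qed

lemma (in inner_form) frame_bilinear:
  fixes b :: "real ^ 'n \<Rightarrow> real ^ 'n \<Rightarrow> real"
  assumes e: "frame e" and b: "bilinear b"
  shows "(\<Sum>i\<in>UNIV. \<Sum>j\<in>UNIV. ip x (e i) * ip y (e j) * b (e i) (e j)) = b x y"
proof -
  have l: "linear (b x)" "linear (\<lambda>x. b x y)" for x y using b by (auto simp: bilinear_def)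
  have "(\<Sum>i\<in>UNIV. \<Sum>j\<in>UNIV. ip x (e i) * ip y (e j) * b (e i) (e j))
      = (\<Sum>i\<in>UNIV. ip x (e i) * b (e i) y)"
    by (simp add: frame_linear[OF e l(1)] mult.assoc flip: sum_distrib_left)
  then show ?thesis using frame_linear[OF e l(2)] by simp
qed

section \<open>Contractions of the six-dimensional product\<close>

context su3_alg
begin

lemma J_simps [simp]: "J (x + y) = J x + J y" "J (x - y) = J x - J y" "J (- x) = - J x"
  "J (c *\<^sub>R x) = c *\<^sub>R J x" "J 0 = 0"
  using linear_J by (auto simp: linear_add linear_diff linear_neg linear_scale linear_0)

lemma ip_J_left [simp]: "ip (J x) y = - ip x (J y)"
  using ip_J_J[of x "J y"] by simp

lemma om_skew: "ip y (J x) = - ip x (J y)"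
  by (metis ip_J_left ip_commute)

lemma om_self [simp]: "ip x (J x) = 0"
  using om_skew[of x x] by simp

lemma Q_J_right [simp]: "Q x (J y) = - J (Q x y)"
proof -
  have "Q x (J y) = - Q (J y) x" by (rule P_skew)
  also have "\<dots> = - J (Q x y)" by (simp add: P_skew[of y x])
  finally show ?thesis .
qed

lemma Q_om_left [simp]: "ip (Q x y) (J x) = 0"
  using ip_P_left[of x "J y"] by simp

lemma Q_om_right [simp]: "ip (Q x y) (J y) = 0"
  using Q_om_left[of y x] by (simp add: P_skew[of y x])

lemma Q_om_cycle: "ip (Q y z) (J x) = ip (Q x y) (J z)"
proof -
  have "ip (Q y z) (J x) = ip (Q (J x) y) z" by (rule triple_cycle)
  then show ?thesis by simp
qed

text \<open>The coefficient is 6 - 1 - 1: besides the trace of the metric, \<open>ip_Q_Q\<close>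
  contributes one Parseval sum for \<open>x, y\<close> and one for \<open>J x, J y\<close>.\<close>

lemma ip_Q_Q_trace:
  assumes e: "frame e" shows "(\<Sum>i\<in>UNIV. ip (Q x (e i)) (Q y (e i))) = 4 * ip x y"
proof -
  have "ip (Q x (e i)) (Q y (e i)) = ip x y * ip (e i) (e i) - ip y (e i) * ip x (e i)
      - ip (J y) (e i) * ip (J x) (e i)" for i
    by (simp add: ip_Q_Q om_skew[of "e i" y] om_skew[of "e i" x] ip_commute[of "e i" y] mult.commute)
  then have "(\<Sum>i\<in>UNIV. ip (Q x (e i)) (Q y (e i)))
      = ip x y * (\<Sum>i\<in>UNIV. ip (e i) (e i)) - ip y x - ip (J y) (J x)"
    by (simp only: sum_subtractf parseval[OF e] flip: sum_distrib_left)
  then show ?thesis by (simp only: card_frame[OF e] ip_J_J ip_commute[of y x]) simp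
qed

lemma Q_inj:
  assumes "\<And>y z. ip (Q a y) z = ip (Q b y) z" shows "a = b"
proof -
  obtain e where e: "frame e" by (rule frame_exists)
  have "Q a y = Q b y" for y by (rule ip_nondegenerate) (rule assms)
  then have "Q (a - b) y = 0" for y by simp
  then have "ip (a - b) (a - b) = 0" using ip_Q_Q_trace[OF e, of "a - b" "a - b"] by simp
  then show ?thesis using ip_eq_0_iff[of "a - b"] by simp
qed

text \<open>The hypotheses on \<open>\<beta>\<close> say that it is of type \<open>(2, 0) + (0, 2)\<close>.\<close>
lemma form20_eq:
  fixes \<beta> :: "real ^ 6 \<Rightarrow> real ^ 6 \<Rightarrow> real"
  assumes e: "frame e" and \<beta>: "bilinear \<beta>" "\<And>v w. \<beta> w v = - \<beta> v w" "\<And>v w. \<beta> (J v) (J w) = - \<beta> v w"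
    and a: "\<And>y. ip a y = 1 / 4 * (\<Sum>i\<in>UNIV. \<Sum>j\<in>UNIV. \<beta> (e i) (e j) * ip (Q y (e i)) (e j))"
  shows "ip (Q a v) w = \<beta> v w"
proof -
  \<comment> \<open>Rewriting with \<open>ip_Q_Q\<close> turns the contraction into four evaluations
    of \<beta>, each with weight 1/4; their signs match the assumed symmetries, so the average is
    \<beta> itself.\<close>
  have *: "\<beta> (e i) (e j) * ip (Q (Q v w) (e i)) (e j) =
      ip v (e i) * ip w (e j) * \<beta> (e i) (e j) - ip w (e i) * ip v (e j) * \<beta> (e i) (e j)
      - ip (J v) (e i) * ip (J w) (e j) * \<beta> (e i) (e j)
      + ip (J w) (e i) * ip (J v) (e j) * \<beta> (e i) (e j)" for i j
  proof -
    have "ip (Q (Q v w) (e i)) (e j) = ip (Q v w) (Q (e i) (e j))" by (metis triple_cycle ip_commute)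
    also have "\<dots> = ip v (e i) * ip w (e j) - ip w (e i) * ip v (e j)
      - ip (J v) (e i) * ip (J w) (e j) + ip (J w) (e i) * ip (J v) (e j)"
      by (simp add: ip_Q_Q)
    finally have eq: "ip (Q (Q v w) (e i)) (e j) = \<dots>" .
    show ?thesis unfolding eq by (simp only: algebra_simps)
  qed
  have "ip (Q a v) w = ip a (Q v w)" by (metis triple_cycle ip_commute)
  also have "\<dots> = 1 / 4 * (\<beta> v w - \<beta> w v - \<beta> (J v) (J w) + \<beta> (J w) (J v))"
    unfolding a * by (simp only: sum_subtractf sum.distrib frame_bilinear[OF e \<beta>(1)])
  also have "\<dots> = \<beta> v w" using \<beta>(2)[of w v] \<beta>(3)[of v w] \<beta>(3)[of w v] by simp
  finally show ?thesis .
qed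

end

section \<open>Gray--Hervella components\<close>

locale su3_tensor = su3_alg ip Q J for ip Q J +
  fixes g \<psi> :: "6 tensor"
  assumes g_eq: "g [x, y] = ip x y" and psi_eq: "\<psi> [x, y, z] = ip (Q x y) z"
begin

text \<open>The frame over which \<open>form_inner\<close> and \<open>trace_form\<close> sum, named
  so that the frame lemmas apply to them.\<close>

definition "e = some_frame g"

lemma frame_e: "frame e"
proof -
  have eq: "orthonormal_frame g = frame"
    by (auto simp: fun_eq_iff orthonormal_frame_def frame_def g_eq)
  show ?thesis unfolding e_def some_frame_def eq by (metis frame_exists someI)
qed

lemma r_form_eq: "r_form g \<psi> \<alpha> x y =
    1 / 4 * (\<Sum>i\<in>UNIV. \<Sum>j\<in>UNIV. \<alpha> [x, e i, e j] * ip (Q y (e i)) (e j))"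
  by (simp add: r_form_def form_inner_def sum_lists_2 psi_eq e_def)

lemma trace_form_eq: "trace_form g b = (\<Sum>i\<in>UNIV. b (e i) (e i))"
  by (simp add: trace_form_def e_def)

text \<open>The factors 1/2 in \<open>r_form\<close>, 1/2! in \<open>form_inner\<close> and 4 in
  \<open>ip_Q_Q_trace\<close> cancel, so \<open>r_form\<close> recovers the endomorphism
  \<open>L\<close>.\<close>

lemma r_form_psi:
  assumes "\<And>x y z. \<alpha> [x, y, z] = ip (Q (L x) y) z"
  shows "r_form g \<psi> \<alpha> x y = ip (L x) y"
  by (simp add: r_form_eq assms parseval[OF frame_e] ip_Q_Q_trace[OF frame_e])

lemma linear_r_form_right: "linear (r_form g \<psi> \<alpha> x)"
  by (rule linearI) (simp_all add: r_form_eq algebra_simps sum.distrib sum_distrib_left)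

text \<open>For fixed \<open>x\<close> the two-form \<open>\<alpha> [x, _, _]\<close> is of type (2,
  0) + (0, 2), so \<open>form20_eq\<close> rebuilds it from its contraction with \<open>Q\<close>;
  the Riesz vector of that contraction serves as \<open>L x\<close>.\<close>

lemma gh_space_eq:
  assumes \<alpha>: "\<alpha> \<in> gh_space J"
  shows "\<exists>L. linear L \<and> (\<forall>x y z. \<alpha> [x, y, z] = ip (Q (L x) y) z)"
proof -
  have m: "multilinear 3 \<alpha>" and sk: "\<alpha> [x, y, z] = - \<alpha> [x, z, y]"
    and t: "\<alpha> [x, y, z] = - \<alpha> [x, J y, J z]" for x y z
    using \<alpha> unfolding gh_space_def by blast+
  note lin = m[unfolded multilinear_3_iff, rule_format]
  have "linear (\<lambda>x. r_form g \<psi> \<alpha> x y)" for y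
    using linear_rules[OF lin[THEN conjunct1]]
    by (intro linearI) (simp_all add: r_form_eq algebra_simps sum.distrib sum_distrib_left)
  then have L: "linear (\<lambda>x. riesz (r_form g \<psi> \<alpha> x))"
    by (rule linear_riesz[OF linear_r_form_right])
  have "ip (Q (riesz (r_form g \<psi> \<alpha> x)) y) z = \<alpha> [x, y, z]" for x y z
  proof (rule form20_eq[OF frame_e])
    show "bilinear (\<lambda>y z. \<alpha> [x, y, z])" using lin by (auto simp: bilinear_def)
    show "\<alpha> [x, z, y] = - \<alpha> [x, y, z]" for y z by (rule sk)
    show "\<alpha> [x, J y, J z] = - \<alpha> [x, y, z]" for y z using t[of x y z] by simp
    show "ip (riesz (r_form g \<psi> \<alpha> x)) y
        = 1 / 4 * (\<Sum>i\<in>UNIV. \<Sum>j\<in>UNIV. \<alpha> [x, e i, e j] * ip (Q y (e i)) (e j))" for y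
      by (simp only: ip_riesz[OF linear_r_form_right] r_form_eq)
  qed
  with L show ?thesis by metis
qed

definition tensor_of :: "(real ^ 6 \<Rightarrow> real ^ 6) \<Rightarrow> 6 tensor" where
  "tensor_of L vs = ip (Q (L (vs ! 0)) (vs ! 1)) (vs ! 2)"

lemma tensor_of_apply [simp]: "tensor_of L [x, y, z] = ip (Q (L x) y) z"
  by (simp add: tensor_of_def)

lemma tensor_of_gh:
  assumes L: "linear L" shows "tensor_of L \<in> gh_space J"
proof -
  have "multilinear 3 (tensor_of L)"
    unfolding multilinear_3_iff
    by (auto intro!: linearI simp: linear_rules[OF L] scaleR_add_right)
  moreover have "tensor_of L [x, y, z] = - tensor_of L [x, z, y]" for x y z
    by (simp add: triple_skew[of "L x" z y])
  moreover have "tensor_of L [x, y, z] = - tensor_of L [x, J y, J z]" for x y z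
    by simp
  ultimately show ?thesis unfolding gh_space_def by blast
qed

lemma tensor_of_W1:
  assumes "\<And>x. L x = a *\<^sub>R x + b *\<^sub>R J x"
  shows "tensor_of L \<in> W1_space J"
proof -
  have "linear L" by (intro linearI) (simp_all add: assms algebra_simps)
  moreover have "alternating 3 (tensor_of L)"
    unfolding alternating_3_iff by (simp add: assms)
  ultimately show ?thesis by (simp add: W1_space_def tensor_of_gh)
qed

lemma sum_om_left: "linear f \<Longrightarrow> (\<Sum>i\<in>UNIV. ip x (J (e i)) * f (e i)) = - f (J x)"
  for f :: "real ^ 6 \<Rightarrow> real"
  using frame_linear[OF frame_e, of f "J x"] by (simp add: sum_negf)

text \<open>The second copy of \<open>ip (L x) w\<close> arises as
  \<open>ip (L (J x)) (J w)\<close>, which is where \<open>L\<close> must commute with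
  \<open>J\<close>.\<close>

lemma ip_Q_Q_contract:
  assumes L: "linear L" and LJ: "\<And>x. L (J x) = J (L x)"
  shows "(\<Sum>i\<in>UNIV. ip (Q x (L (e i))) (Q w (e i))) =
    ip x w * (\<Sum>i\<in>UNIV. ip (L (e i)) (e i)) - ip x (J w) * (\<Sum>i\<in>UNIV. ip (L (e i)) (J (e i)))
    - 2 * ip (L x) w"
proof -
  have 1: "linear (\<lambda>z. ip (L z) w)" "linear (\<lambda>z. ip (L z) (J w))"
    by (auto intro!: linearI simp: linear_rules[OF L])
  have "ip (Q x (L (e i))) (Q w (e i)) = ip x w * ip (L (e i)) (e i) - ip x (e i) * ip (L (e i)) w
      - ip x (J w) * ip (L (e i)) (J (e i)) + ip x (J (e i)) * ip (L (e i)) (J w)" for i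
    by (rule ip_Q_Q)
  then have "(\<Sum>i\<in>UNIV. ip (Q x (L (e i))) (Q w (e i))) =
     ip x w * (\<Sum>i\<in>UNIV. ip (L (e i)) (e i)) - ip (L x) w
     - ip x (J w) * (\<Sum>i\<in>UNIV. ip (L (e i)) (J (e i))) - ip (L (J x)) (J w)"
    by (simp only: sum_subtractf sum.distrib frame_linear[OF frame_e 1(1)] sum_om_left[OF 1(2)]
        flip: sum_distrib_left)
  then show ?thesis by (simp add: LJ)
qed

text \<open>A complex linear \<open>L\<close> acts on a form of type (3, 0) as a derivation by
  multiplication with its complex trace, whose real and imaginary parts \<open>tr\<close> sets to
  zero; the cyclic sum is that derivation. In real terms the contraction of \<open>S\<close> with
  \<open>Q\<close> has coefficient 4 - 2 - 2 = 0, and \<open>form20_eq\<close> recovers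
  \<open>S\<close> from it.\<close>

lemma tensor_of_W2:
  assumes L: "linear L" and LJ: "\<And>x. L (J x) = J (L x)"
    and tr: "(\<Sum>i\<in>UNIV. ip (L (e i)) (e i)) = 0" "(\<Sum>i\<in>UNIV. ip (L (e i)) (J (e i))) = 0"
  shows "tensor_of L \<in> W2_space J"
proof -
  define S where "S x y z = ip (Q (L x) y) z + ip (Q x (L y)) z + ip (Q x y) (L z)" for x y z
  have "S x y z = 0" for x y z
  proof -
    have "ip 0 w = 1 / 4 * (\<Sum>i\<in>UNIV. \<Sum>j\<in>UNIV. S x (e i) (e j) * ip (Q w (e i)) (e j))" for w
    proof -
      have 1: "(\<Sum>i\<in>UNIV. \<Sum>j\<in>UNIV. ip (Q (L x) (e i)) (e j) * ip (Q w (e i)) (e j)) = 4 * ip (L x) w"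
        by (simp add: parseval[OF frame_e] ip_Q_Q_trace[OF frame_e])
      have 2: "(\<Sum>i\<in>UNIV. \<Sum>j\<in>UNIV. ip (Q x (L (e i))) (e j) * ip (Q w (e i)) (e j)) = - 2 * ip (L x) w"
        using ip_Q_Q_contract[OF L LJ] by (simp add: parseval[OF frame_e] tr)
      have "(\<Sum>i\<in>UNIV. \<Sum>j\<in>UNIV. ip (Q x (e i)) (L (e j)) * ip (Q w (e i)) (e j))
          = (\<Sum>j\<in>UNIV. \<Sum>i\<in>UNIV. ip (Q x (e i)) (L (e j)) * ip (Q w (e i)) (e j))"
        by (rule sum.swap)
      also have "\<dots> = (\<Sum>j\<in>UNIV. \<Sum>i\<in>UNIV. ip (Q x (L (e j))) (e i) * ip (Q w (e j)) (e i))"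
      proof (intro sum.cong refl)
        fix i j
        show "ip (Q x (e i)) (L (e j)) * ip (Q w (e i)) (e j)
            = ip (Q x (L (e j))) (e i) * ip (Q w (e j)) (e i)"
          using triple_skew[of x "e i" "L (e j)"] triple_skew[of w "e i" "e j"] by simp
      qed
      also have "\<dots> = - 2 * ip (L x) w" by (rule 2)
      finally have 3: "(\<Sum>i\<in>UNIV. \<Sum>j\<in>UNIV. ip (Q x (e i)) (L (e j)) * ip (Q w (e i)) (e j)) = - 2 * ip (L x) w" .
      show ?thesis by (simp only: S_def distrib_right sum.distrib 1 2 3) simp
    qed
    then have "ip (Q 0 y) z = S x y z"
    proof (rule form20_eq[OF frame_e, rotated 3])
      show "bilinear (S x)"
        by (auto simp: bilinear_def S_def linear_rules[OF L] algebra_simps intro!: linearI)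
      show "S x z y = - S x y z" for y z
        unfolding S_def triple_skew[of "L x" z y] triple_skew[of x z "L y"] triple_skew[of x "L z" y]
        by simp
      show "S x (J y) (J z) = - S x y z" for y z by (simp add: S_def LJ)
    qed
    then show ?thesis by simp
  qed
  moreover have "tensor_of L [x, y, z] + tensor_of L [y, z, x] + tensor_of L [z, x, y] = S x y z" for x y z
    using triple_cycle[of "L y" z x] triple_cycle[of x y "L z"] by (simp add: S_def)
  ultimately have "tensor_of L [x, y, z] + tensor_of L [y, z, x] + tensor_of L [z, x, y] = 0" for x y z
    by (simp only:)
  then show ?thesis using tensor_of_gh[OF L] by (simp add: W2_space_def)
qed

text \<open>The trace contracts the symmetric \<open>L\<close> with a product skew in the same two
  arguments, so it equals its own negative.\<close>

lemma tensor_of_W3: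
  assumes L: "linear L" and LJ: "\<And>x. L (J x) = - J (L x)" and sym: "\<And>x y. ip (L x) y = ip x (L y)"
  shows "tensor_of L \<in> W3_space g J"
proof -
  have "trace_form g (\<lambda>x y. tensor_of L [x, y, z]) = 0" for z
  proof -
    define t where "t = (\<Sum>i\<in>UNIV. ip (Q (L (e i)) (e i)) z)"
    have lin: "linear (\<lambda>v. ip (Q v y) z)" "linear (\<lambda>v. ip (Q y v) z)" for y by (rule linear_triple)+
    have "t = (\<Sum>i\<in>UNIV. \<Sum>j\<in>UNIV. ip (L (e i)) (e j) * ip (Q (e j) (e i)) z)"
      unfolding t_def by (simp only: frame_linear[OF frame_e lin(1)])
    also have "\<dots> = (\<Sum>j\<in>UNIV. \<Sum>i\<in>UNIV. ip (L (e j)) (e i) * ip (Q (e j) (e i)) z)"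
    proof (subst sum.swap, intro sum.cong refl)
      fix i j
      have "ip (L (e i)) (e j) = ip (L (e j)) (e i)" by (metis sym ip_commute)
      then show "ip (L (e i)) (e j) * ip (Q (e j) (e i)) z = ip (L (e j)) (e i) * ip (Q (e j) (e i)) z"
        by simp
    qed
    also have "\<dots> = (\<Sum>j\<in>UNIV. ip (Q (e j) (L (e j))) z)"
      by (simp only: frame_linear[OF frame_e lin(2)])
    also have "\<dots> = - t"
      unfolding t_def P_skew[of "e _" "L (e _)"] by (simp add: sum_negf)
    finally have "t = 0" by simp
    then show ?thesis by (simp add: trace_form_eq t_def)
  qed
  then show ?thesis using tensor_of_gh[OF L] by (simp add: W3_space_def LJ)
qed

lemma r_form_J_invariant:
  assumes \<alpha>: "\<alpha> \<in> gh_space J" and J: "\<And>x y z. \<alpha> [J x, y, z] = \<alpha> [x, J y, z]"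
  shows "r_form g \<psi> \<alpha> (J x) (J y) = r_form g \<psi> \<alpha> x y"
proof -
  obtain L where L: "\<And>x y z. \<alpha> [x, y, z] = ip (Q (L x) y) z" using gh_space_eq[OF \<alpha>] by auto
  have "L (J x) = J (L x)" for x by (rule Q_inj) (use J L in simp)
  then show ?thesis by (simp add: r_form_psi[OF L])
qed

text \<open>Membership in \<open>gh_space\<close> lets \<open>J\<close> move between the last two
  arguments, and total skewness brings any argument there.\<close>

lemma W1_J_invariant:
  assumes \<alpha>: "\<alpha> \<in> W1_space J" shows "\<alpha> [J x, y, z] = \<alpha> [x, J y, z]"
proof -
  have m: "multilinear 3 \<alpha>" and alt: "\<And>x y. \<alpha> [x, x, y] = 0"
    and sk: "\<And>x y z. \<alpha> [x, y, z] = - \<alpha> [x, z, y]" and t: "\<And>x y z. \<alpha> [x, y, z] = - \<alpha> [x, J y, J z]"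
    using \<alpha> unfolding W1_space_def gh_space_def alternating_3_iff by blast+
  note lin = m[unfolded multilinear_3_iff, rule_format]
  have sk': "\<alpha> [y, x, z] = - \<alpha> [x, y, z]" for x y z
    using alt[of "x + y" z] alt[of x z] alt[of y z]
    by (simp add: linear_rules[OF lin[THEN conjunct1]] linear_rules[OF lin[THEN conjunct2, THEN conjunct1]])
  have t': "\<alpha> [x, J y, z] = \<alpha> [x, y, J z]" for x y z
    using t[of x y "J z"] linear_neg[OF lin[THEN conjunct2, THEN conjunct2], of x "J y" z] by simp
  show ?thesis
    using t'[of z x y] sk'[of z "J x" y] sk'[of z x "J y"] sk[of "J x" z y] sk[of x z "J y"] by simp
qed

text \<open>The defect \<open>\<beta>(x; y, z) = \<alpha>(Ix, y, z) - \<alpha>(x, Iy, z)\<close> is totally skew because the cyclic sum of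
  \<open>\<alpha>\<close> vanishes, while moving \<open>I\<close> between any two of its arguments changes its sign.\<close>
lemma W2_J_invariant:
  assumes \<alpha>: "\<alpha> \<in> W2_space J" shows "\<alpha> [J x, y, z] = \<alpha> [x, J y, z]"
proof -
  have m: "multilinear 3 \<alpha>" and cyc: "\<And>x y z. \<alpha> [x, y, z] + \<alpha> [y, z, x] + \<alpha> [z, x, y] = 0"
    and sk: "\<And>x y z. \<alpha> [x, y, z] = - \<alpha> [x, z, y]" and t: "\<And>x y z. \<alpha> [x, y, z] = - \<alpha> [x, J y, J z]"
    using \<alpha> unfolding W2_space_def gh_space_def by blast+
  note lin = m[unfolded multilinear_3_iff, rule_format]
  have neg: "\<alpha> [- x, y, z] = - \<alpha> [x, y, z]" "\<alpha> [x, - y, z] = - \<alpha> [x, y, z]"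
    "\<alpha> [x, y, - z] = - \<alpha> [x, y, z]" for x y z
    using linear_rules[OF lin[THEN conjunct1]] linear_rules[OF lin[THEN conjunct2, THEN conjunct1]]
      linear_rules[OF lin[THEN conjunct2, THEN conjunct2]] by auto
  have t': "\<alpha> [x, J y, z] = \<alpha> [x, y, J z]" for x y z
    using t[of x y "J z"] neg(3)[of x "J y" z] by simp
  define \<beta> where "\<beta> x y z = \<alpha> [J x, y, z] - \<alpha> [x, J y, z]" for x y z
  have b_cyc: "\<beta> x y z = \<beta> y z x" for x y z
    using cyc[of "J x" y z] cyc[of x "J y" z] t'[of z x y] t'[of y z x] by (simp add: \<beta>_def)
  have b_sk: "\<beta> x y z = - \<beta> x z y" for x y z
    using sk[of "J x" y z] sk[of x "J y" z] t'[of x z y] by (simp add: \<beta>_def)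
  have b1: "\<beta> (J x) y z = - \<beta> x (J y) z" for x y z
    by (simp add: \<beta>_def neg)
  have b2: "\<beta> x (J y) z = \<beta> x y (J z)" for x y z
    using t'[of "J x" y z] t'[of x "J y" z] by (simp add: \<beta>_def)
  have b3: "\<beta> x (J y) z = - \<beta> x y (J z)" for x y z
    using b_cyc[of x "J y" z] b1[of y z x] b_cyc[of x y "J z"] by simp
  have "\<beta> x (J (J y)) z = 0" using b2[of x "J y" z] b3[of x "J y" z] by simp
  then have "\<beta> x (- y) z = 0" by simp
  then have "\<beta> x y z = 0" by (simp add: \<beta>_def neg)
  then show ?thesis by (simp add: \<beta>_def)
qed

text \<open>The condition on \<open>\<alpha> [J x, J y, z]\<close> forces \<open>L\<close> to
  anticommute with \<open>J\<close>. Against the invariance of the other two classes, evaluation at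
  \<open>J x, J y\<close> then isolates the \<open>W3\<close> part.\<close>

lemma r_form_W3:
  assumes \<alpha>: "\<alpha> \<in> W3_space g J"
  shows "r_form g \<psi> \<alpha> (J x) (J y) = - r_form g \<psi> \<alpha> x y"
proof -
  have gh: "\<alpha> \<in> gh_space J" and J: "\<And>x y z. \<alpha> [J x, J y, z] = \<alpha> [x, y, z]"
    using \<alpha> unfolding W3_space_def by blast+
  obtain L where L: "\<And>x y z. \<alpha> [x, y, z] = ip (Q (L x) y) z" using gh_space_eq[OF gh] by auto
  have "L (J x) = - J (L x)" for x
  proof -
    have "- J (L (J x)) = - L x" by (rule Q_inj) (use J[of x] L in simp)
    then have "J (J (L (J x))) = J (L x)" by simp
    then show ?thesis by (simp add: eq_neg_iff_add_eq_0 neg_eq_iff_add_eq_0 add.commute)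
  qed
  then show ?thesis by (simp add: r_form_psi[OF L])
qed

text \<open>The three cyclic relabellings of the sum are equal, and together they contract the
  cyclic sum of \<open>s\<close>, which is zero.\<close>

lemma cyclic_contraction:
  fixes s t :: "6 \<Rightarrow> 6 \<Rightarrow> 6 \<Rightarrow> real"
  assumes s: "\<And>i j k. s i j k + s j k i + s k i j = 0" and t: "\<And>i j k. t j k i = t i j k"
  shows "(\<Sum>i\<in>UNIV. \<Sum>j\<in>UNIV. \<Sum>k\<in>UNIV. s i j k * t i j k) = 0"
proof -
  define S where "S = (\<Sum>i\<in>UNIV. \<Sum>j\<in>UNIV. \<Sum>k\<in>UNIV. s i j k * t i j k)"
  have cyc: "(\<Sum>i\<in>UNIV. \<Sum>j\<in>UNIV. \<Sum>k\<in>UNIV. f j k i) = (\<Sum>i\<in>UNIV. \<Sum>j\<in>UNIV. \<Sum>k\<in>UNIV. f i j k)"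
    for f :: "6 \<Rightarrow> 6 \<Rightarrow> 6 \<Rightarrow> real"
    by (subst sum.swap, rule sum.cong[OF refl], subst sum.swap, rule refl)
  have 1: "S = (\<Sum>i\<in>UNIV. \<Sum>j\<in>UNIV. \<Sum>k\<in>UNIV. s j k i * t i j k)"
    using cyc[of "\<lambda>i j k. s i j k * t i j k"] by (simp add: S_def t)
  have 2: "S = (\<Sum>i\<in>UNIV. \<Sum>j\<in>UNIV. \<Sum>k\<in>UNIV. s k i j * t i j k)"
    using cyc[of "\<lambda>i j k. s j k i * t i j k"] by (simp add: 1 t)
  have "S + S + S = (\<Sum>i\<in>UNIV. \<Sum>j\<in>UNIV. \<Sum>k\<in>UNIV. (s i j k + s j k i + s k i j) * t i j k)"
    by (subst (3) 2, subst (2) 1, unfold S_def) (simp only: distrib_right sum.distrib)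
  then have "S + S + S = 0" by (simp add: s)
  then show ?thesis by (simp add: S_def)
qed

text \<open>Up to a factor the traces are the contractions of \<alpha> with
  \<open>ip (Q x y) z\<close> and with \<open>ip (Q x y) (J z)\<close>, both cyclically
  invariant.\<close>

lemma r_form_W2_trace:
  assumes \<alpha>: "\<alpha> \<in> W2_space J"
  shows "(\<Sum>i\<in>UNIV. r_form g \<psi> \<alpha> (e i) (e i)) = 0" "(\<Sum>i\<in>UNIV. r_form g \<psi> \<alpha> (e i) (J (e i))) = 0"
proof -
  have cyc: "\<alpha> [x, y, z] + \<alpha> [y, z, x] + \<alpha> [z, x, y] = 0" for x y z
    using \<alpha> unfolding W2_space_def by blast
  show "(\<Sum>i\<in>UNIV. r_form g \<psi> \<alpha> (e i) (e i)) = 0"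
    using cyclic_contraction[of "\<lambda>i j k. \<alpha> [e i, e j, e k]" "\<lambda>i j k. ip (Q (e i) (e j)) (e k)", OF cyc triple_cycle]
    unfolding r_form_eq sum_distrib_left[symmetric] by simp
  show "(\<Sum>i\<in>UNIV. r_form g \<psi> \<alpha> (e i) (J (e i))) = 0"
    using cyclic_contraction[of "\<lambda>i j k. \<alpha> [e i, e j, e k]" "\<lambda>i j k. ip (Q (e i) (e j)) (J (e k))", OF cyc Q_om_cycle]
    unfolding r_form_eq sum_distrib_left[symmetric] by (simp add: sum_negf)
qed

text \<open>Total skewness gives \<open>Q (L x) y = Q x (L y)\<close>, so one trace can be taken
  with \<open>L\<close> in either place. Comparing 4 \<open>L\<close> with 6 times the normalised
  trace part minus 2 \<open>L\<close> shows that \<open>L\<close> is a combination of the identity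
  and \<open>J\<close>.\<close>

lemma r_form_W1:
  assumes \<alpha>: "\<alpha> \<in> W1_space J"
  shows "\<exists>a b. \<forall>x w. r_form g \<psi> \<alpha> x w = a * ip x w + b * ip x (J w)"
proof -
  have gh: "\<alpha> \<in> gh_space J" and alt: "alternating 3 \<alpha>" using \<alpha> unfolding W1_space_def by blast+
  obtain L where lin: "linear L" and L: "\<And>x y z. \<alpha> [x, y, z] = ip (Q (L x) y) z"
    using gh_space_eq[OF gh] by auto
  have LJ: "L (J x) = J (L x)" for x
    by (rule Q_inj) (use W1_J_invariant[OF \<alpha>, of x] L in simp)
  have sk: "Q (L x) y = Q x (L y)" for x y
  proof (rule ip_nondegenerate)
    fix z
    have "ip (Q (L (x + y)) (x + y)) z = 0" "ip (Q (L x) x) z = 0" "ip (Q (L y) y) z = 0"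
      using alt unfolding alternating_3_iff L by blast+
    then have "ip (Q (L x) y) z = - ip (Q (L y) x) z" by (simp add: linear_add[OF lin])
    then show "ip (Q (L x) y) z = ip (Q x (L y)) z" by (simp add: P_skew[of "L y" x])
  qed
  define a b where "a = (\<Sum>i\<in>UNIV. ip (L (e i)) (e i)) / 6"
    and "b = - (\<Sum>i\<in>UNIV. ip (L (e i)) (J (e i))) / 6"
  have "ip (L x) w = a * ip x w + b * ip x (J w)" for x w
  proof -
    have "4 * ip (L x) w = (\<Sum>i\<in>UNIV. ip (Q (L x) (e i)) (Q w (e i)))"
      by (simp only: ip_Q_Q_trace[OF frame_e])
    also have "\<dots> = 6 * (a * ip x w + b * ip x (J w)) - 2 * ip (L x) w"
      using ip_Q_Q_contract[OF lin LJ, of x w] by (simp add: sk a_def b_def algebra_simps)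
    finally show ?thesis by simp
  qed
  then show ?thesis unfolding r_form_psi[OF L] by blast
qed

text \<open>An arbitrary family \<open>f\<close> has to be determined: \<open>W3\<close> is the part
  that changes sign under \<open>J\<close>, symmetry separates the plus from the minus classes, and
  the two traces separate \<open>W1\<close> from \<open>W2\<close>. Conversely,
  \<open>tensor_of\<close> applied to the summands of the given endomorphism is a suitable
  family.\<close>

lemma gh_components_iff:
  assumes lin: "linear Sp" "linear Sm" "linear T"
    and SpJ: "\<And>x. Sp (J x) = J (Sp x)" and SmJ: "\<And>x. Sm (J x) = J (Sm x)"
    and TJ: "\<And>x. T (J x) = - J (T x)"
    and Sp: "\<And>x y. ip (Sp x) y = ip x (Sp y)" and Sm: "\<And>x y. ip (Sm x) y = - ip x (Sm y)"
    and T: "\<And>x y. ip (T x) y = ip x (T y)"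
    and tr: "(\<Sum>i\<in>UNIV. ip (Sp (e i)) (e i)) = 0" "(\<Sum>i\<in>UNIV. ip (Sm (e i)) (J (e i))) = 0"
    and \<alpha>: "\<And>x y z. \<alpha> [x, y, z] = ip (Q (a *\<^sub>R x + b *\<^sub>R J x + Sp x + Sm x + T x) y) z"
    and U: "W4 \<notin> U"
  shows "(\<exists>f. gh_components g J \<psi> \<alpha> f \<and>
      (\<forall>w\<in>{W1p, W1m, W2p, W2m, W3, W4} - U. \<forall>x y z. f w [x, y, z] = 0)) \<longleftrightarrow>
    (W1p \<notin> U \<longrightarrow> a = 0) \<and> (W1m \<notin> U \<longrightarrow> b = 0) \<and> (W2p \<notin> U \<longrightarrow> (\<forall>x. Sp x = 0)) \<and>
    (W2m \<notin> U \<longrightarrow> (\<forall>x. Sm x = 0)) \<and> (W3 \<notin> U \<longrightarrow> (\<forall>x. T x = 0))" (is "?lhs \<longleftrightarrow> ?rhs")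
proof
  assume ?lhs
  then obtain f where f: "gh_components g J \<psi> \<alpha> f"
    and f0: "\<And>w x y z. w \<in> {W1p, W1m, W2p, W2m, W3, W4} \<Longrightarrow> w \<notin> U \<Longrightarrow> f w [x, y, z] = 0"
    by blast
  define r where "r w = r_form g \<psi> (f w)" for w
  have r0: "r w x y = 0" if "w \<in> {W1p, W1m, W2p, W2m, W3, W4}" "w \<notin> U" for w x y
    using f0[OF that] by (simp add: r_def r_form_eq)
  have mem: "f W1p \<in> W1_space J" "f W1m \<in> W1_space J" "f W2p \<in> W2_space J" "f W2m \<in> W2_space J"
      "f W3 \<in> W3_space g J"
    and sym: "r W1p x y = r W1p y x" "r W2p x y = r W2p y x"
    and skew: "r W1m x y = - r W1m y x" "r W2m x y = - r W2m y x" for x y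
  proof -
    have "f w \<in> W_space g J \<psi> w" if "w \<in> {W1p, W1m, W2p, W2m, W3, W4}" for w
      using f that unfolding gh_components_def by blast
    note W = this[of W1p] this[of W1m] this[of W2p] this[of W2m] this[of W3]
    show "f W1p \<in> W1_space J" "r W1p x y = r W1p y x"
      using W(1) unfolding r_def W_space.simps by blast+
    show "f W1m \<in> W1_space J" "r W1m x y = - r W1m y x"
      using W(2) unfolding r_def W_space.simps by blast+
    show "f W2p \<in> W2_space J" "r W2p x y = r W2p y x"
      using W(3) unfolding r_def W_space.simps by blast+
    show "f W2m \<in> W2_space J" "r W2m x y = - r W2m y x"
      using W(4) unfolding r_def W_space.simps by blast+
    show "f W3 \<in> W3_space g J"
      using W(5) unfolding W_space.simps by blast
  qed
  have gh: "f W2p \<in> gh_space J" "f W2m \<in> gh_space J"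
    using mem unfolding W2_space_def by blast+
  \<comment> \<open>As \<open>W4\<close> is not in \<open>U\<close>, its component is zero and five
    summands remain.\<close>
  have \<alpha>_sum: "\<alpha> [x, y, z] = f W1p [x, y, z] + f W1m [x, y, z] + f W2p [x, y, z] + f W2m [x, y, z]
      + f W3 [x, y, z]" for x y z
    using f f0[of W4 x y z] U by (simp add: gh_components_def)
  have E: "ip (a *\<^sub>R x + b *\<^sub>R J x + Sp x + Sm x + T x) y
      = r W1p x y + r W1m x y + r W2p x y + r W2m x y + r W3 x y" for x y
    unfolding r_form_psi[OF \<alpha>, symmetric] r_def
    by (simp only: r_form_eq \<alpha>_sum distrib_right sum.distrib distrib_left)
  obtain a' c' where "\<forall>x w. r W1p x w = a' * ip x w + c' * ip x (J w)"
    using r_form_W1[OF mem(1)] unfolding r_def by blast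
  then have r1p: "r W1p x w = a' * ip x w" for x w
    using sym(1)[of x w] om_skew[of w x] ip_commute[of w x] by simp
  obtain d' b' where "\<forall>x w. r W1m x w = d' * ip x w + b' * ip x (J w)"
    using r_form_W1[OF mem(2)] unfolding r_def by blast
  then have r1m: "r W1m x w = b' * ip x (J w)" for x w
    using skew(1)[of x w] om_skew[of w x] ip_commute[of w x] by simp
  have inv: "r W2p (J x) (J y) = r W2p x y" "r W2m (J x) (J y) = r W2m x y" for x y
    unfolding r_def using r_form_J_invariant[OF gh(1) W2_J_invariant[OF mem(3)]]
      r_form_J_invariant[OF gh(2) W2_J_invariant[OF mem(4)]] by auto
  have anti: "r W3 (J x) (J y) = - r W3 x y" for x y
    unfolding r_def by (rule r_form_W3[OF mem(5)])
  \<comment> \<open>Subtracting the values of \<open>E\<close> at \<open>x, y\<close> and at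
    \<open>J x, J y\<close> removes all terms invariant under \<open>J\<close>.\<close>
  have T_eq: "ip (T x) y = r W3 x y" for x y
    using E[of x y] E[of "J x" "J y"] by (simp add: inv anti r1p r1m SpJ SmJ TJ)
  have E': "a * ip x y - b * ip x (J y) + ip (Sp x) y + ip (Sm x) y
      = a' * ip x y + b' * ip x (J y) + r W2p x y + r W2m x y" for x y
    using E[of x y] T_eq[of x y] by (simp add: r1p r1m)
  have Sp_eq: "a * ip x y + ip (Sp x) y = a' * ip x y + r W2p x y" for x y
    using E'[of x y] E'[of y x] sym(2)[of y x] skew(2)[of y x] Sp[of y x] Sm[of y x]
      om_skew[of y x] ip_commute[of y x] ip_commute[of y "Sp x"] ip_commute[of y "Sm x"] by simp
  have Sm_eq: "- b * ip x (J y) + ip (Sm x) y = b' * ip x (J y) + r W2m x y" for x y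
    using E'[of x y] Sp_eq[of x y] by simp
  have "(\<Sum>i\<in>UNIV. a * ip (e i) (e i) + ip (Sp (e i)) (e i))
      = (\<Sum>i\<in>UNIV. a' * ip (e i) (e i) + r W2p (e i) (e i))"
    by (simp only: Sp_eq)
  then have aa: "a = a'"
    using r_form_W2_trace(1)[OF mem(3)]
    by (simp add: sum.distrib tr card_frame[OF frame_e] r_def flip: sum_distrib_left)
  have "(\<Sum>i\<in>UNIV. - b * ip (e i) (J (J (e i))) + ip (Sm (e i)) (J (e i)))
      = (\<Sum>i\<in>UNIV. b' * ip (e i) (J (J (e i))) + r W2m (e i) (J (e i)))"
    by (simp only: Sm_eq)
  \<comment> \<open>The sign comes from \<open>ip (J x) y = - ip x (J y)\<close>, as
    \<open>r W1m\<close> was normalised with \<open>J\<close> on the right.\<close>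
  then have bb: "b' = - b"
    using r_form_W2_trace(2)[OF mem(4)]
    by (simp add: sum.distrib sum_negf sum_subtractf tr card_frame[OF frame_e] r_def flip: sum_distrib_left)
  have one: "ip (e 0) (e 0) = 1" using frame_e by (simp add: frame_def)
  show ?rhs
  proof (intro conjI impI allI)
    show "a = 0" if "W1p \<notin> U" using r0[OF _ that, of "e 0" "e 0"] one by (simp add: r1p aa)
    show "b = 0" if "W1m \<notin> U" using r0[OF _ that, of "e 0" "J (e 0)"] one by (simp add: r1m bb)
    show "Sp x = 0" if "W2p \<notin> U" for x
      by (rule ip_nondegenerate) (use Sp_eq[of x] r0[OF _ that, of x] aa in simp)
    show "Sm x = 0" if "W2m \<notin> U" for x
      by (rule ip_nondegenerate) (use Sm_eq[of x] r0[OF _ that, of x] bb in simp)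
    show "T x = 0" if "W3 \<notin> U" for x
      by (rule ip_nondegenerate) (use T_eq[of x] r0[OF _ that, of x] in simp)
  qed
next
  assume R: ?rhs
  define F where "F w = (case w of W1p \<Rightarrow> \<lambda>x. a *\<^sub>R x | W1m \<Rightarrow> \<lambda>x. b *\<^sub>R J x | W2p \<Rightarrow> Sp | W2m \<Rightarrow> Sm
    | W3 \<Rightarrow> T | _ \<Rightarrow> \<lambda>x. 0)" for w
  have r: "r_form g \<psi> (tensor_of L) x y = ip (L x) y" for L x y
    by (rule r_form_psi) simp
  have Sp_tr: "(\<Sum>i\<in>UNIV. ip (Sp (e i)) (J (e i))) = 0"
  proof -
    have "ip (Sp x) (J x) = 0" for x
      using Sp[of x "J x"] ip_commute[of "Sp x" "J x"] SpJ[of x] by simp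
    then show ?thesis by simp
  qed
  have Sm_tr: "(\<Sum>i\<in>UNIV. ip (Sm (e i)) (e i)) = 0"
  proof -
    have "ip (Sm x) x = 0" for x using Sm[of x x] ip_commute[of "Sm x" x] by simp
    then show ?thesis by simp
  qed
  have "tensor_of (F w) \<in> W_space g J \<psi> w" if "w \<in> {W1p, W1m, W2p, W2m, W3, W4}" for w
  proof -
    have "tensor_of (F W1p) \<in> W_space g J \<psi> W1p"
      using tensor_of_W1[of "F W1p" a 0] by (simp add: r F_def) (metis ip_commute)
    moreover have "tensor_of (F W1m) \<in> W_space g J \<psi> W1m"
      using tensor_of_W1[of "F W1m" 0 b] by (simp add: r F_def) (metis om_skew mult_minus_right)
    moreover have "tensor_of (F W2p) \<in> W_space g J \<psi> W2p"
      using tensor_of_W2[OF lin(1) SpJ tr(1) Sp_tr] by (simp add: r F_def) (metis Sp ip_commute)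
    moreover have "tensor_of (F W2m) \<in> W_space g J \<psi> W2m"
      using tensor_of_W2[OF lin(2) SmJ Sm_tr tr(2)] by (simp add: r F_def) (metis Sm ip_commute)
    moreover have "tensor_of (F W3) \<in> W_space g J \<psi> W3"
      using tensor_of_W3[OF lin(3) TJ T] by (simp add: F_def)
    \<comment> \<open>The zero tensor, with \<tau> = 0.\<close>
    moreover have "tensor_of (F W4) \<in> W_space g J \<psi> W4"
      using tensor_of_gh[of "\<lambda>x. 0"]
      by (auto simp: F_def W4_space_def linear_iff intro!: exI[of _ "\<lambda>x. 0"])
    ultimately show ?thesis using that by (elim insertE emptyE) (simp_all only:)
  qed
  then have "gh_components g J \<psi> \<alpha> (\<lambda>w. tensor_of (F w))"
    unfolding gh_components_def by (intro conjI ballI) (simp_all add: \<alpha> F_def)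
  moreover have "tensor_of (F w) [x, y, z] = 0" if "w \<in> {W1p, W1m, W2p, W2m, W3, W4} - U" for w x y z
    using R that by (auto simp: F_def)
  ultimately show ?lhs by blast
qed

end

section \<open>The model three-form in an adapted frame\<close>

lemma numerals_mod_7: "(7 :: 7) = 0" "(8 :: 7) = 1" "(9 :: 7) = 2" "(10 :: 7) = 3" "(11 :: 7) = 4"
  "(12 :: 7) = 5"
  by simp_all

lemma sum_UNIV_7: "(\<Sum>i\<in>UNIV. f i) = f 0 + f 1 + f 2 + f 3 + f 4 + f 5 + f (6 :: 7)"
  for f :: "7 \<Rightarrow> 'b::comm_monoid_add"
proof -
  have distinct: "distinct [0, 1, 2, 3, 4, 5, 6 :: 7]" by simp
  then have "card (set [0, 1, 2, 3, 4, 5, 6 :: 7]) = CARD(7)"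
    by (subst distinct_card) auto
  then have UNIV: "UNIV = set [0, 1, 2, 3, 4, 5, 6 :: 7]"
    by (intro card_subset_eq[symmetric]) auto
  show ?thesis unfolding UNIV sum.distinct_set_conv_list[OF distinct] by (simp add: add_ac)
qed

text \<open>Expanding the permutation sum once reduces the later frame identities for \<phi> and
  \<open>star_phi\<close> to polynomial arithmetic.\<close>

lemma wedge_3:
  "wedge g [a, b, c] [u, v, w] =
     g [a, u] * (g [b, v] * g [c, w] - g [b, w] * g [c, v])
   - g [a, v] * (g [b, u] * g [c, w] - g [b, w] * g [c, u])
   + g [a, w] * (g [b, u] * g [c, v] - g [b, v] * g [c, u])"
proof -
  have s: "{..<length [a, b, c]} = insert 0 (insert 1 {2::nat})" by auto
  have f: "finite {1, 2::nat}" "0 \<notin> {1, 2::nat}" "finite {2::nat}" "1 \<notin> {2::nat}" by auto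
  show ?thesis
    unfolding wedge_def s sum_over_permutations_insert[OF f(1,2)]
      sum_over_permutations_insert[OF f(3,4)] permutes_sing
    by (simp add: sign_swap_id permutation_swap_id sign_compose permutation_compose
        transpose_def algebra_simps)
qed

lemma wedge_4:
  "wedge g [a, b, c, d] [u, v, w, z] =
     g [a, u] * wedge g [b, c, d] [v, w, z] - g [a, v] * wedge g [b, c, d] [u, w, z]
   + g [a, w] * wedge g [b, c, d] [u, v, z] - g [a, z] * wedge g [b, c, d] [u, v, w]"
proof -
  have s: "{..<length [a, b, c, d]} = insert 0 (insert 1 (insert 2 {3::nat}))" by auto
  have f: "finite {1, 2, 3::nat}" "0 \<notin> {1, 2, 3::nat}" "finite {2, 3::nat}" "1 \<notin> {2, 3::nat}"
    "finite {3::nat}" "2 \<notin> {3::nat}" by auto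
  show ?thesis
    unfolding wedge_3
    unfolding wedge_def s sum_over_permutations_insert[OF f(1,2)]
      sum_over_permutations_insert[OF f(3,4)] sum_over_permutations_insert[OF f(5,6)] permutes_sing
    by (simp add: sign_swap_id permutation_swap_id sign_compose permutation_compose
        transpose_def algebra_simps)
qed

text \<open>The coordinates of the cross product in an adapted frame: the terms of \<open>\<phi>\<close> containing \<open>e\<^sub>k\<close>.\<close>
definition cross7 :: "(7 \<Rightarrow> real) \<Rightarrow> (7 \<Rightarrow> real) \<Rightarrow> 7 \<Rightarrow> real" where
  "cross7 a b k = a (k + 4) * b (k + 5) - a (k + 5) * b (k + 4)
     + a (k + 1) * b (k + 3) - a (k + 3) * b (k + 1) + a (k + 2) * b (k + 6) - a (k + 6) * b (k + 2)"

lemma g2_form_coords: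
  "(\<Sum>i\<in>UNIV. wedge g [e i, e (i + 1), e (i + 3)] [u, v, w])
    = (\<Sum>k\<in>UNIV. cross7 (\<lambda>i. g [e i, u]) (\<lambda>i. g [e i, v]) k * g [e k, w])"
  unfolding sum_UNIV_7 wedge_3 cross7_def
  by (simp add: numerals_mod_7 algebra_simps)

text \<open>A polynomial identity in the 28 coordinates: the Lagrange identity with a correction
  term. The correction is minus the expression that defines \<open>star_phi\<close>, which explains
  the index quadruples there.\<close>

lemma cross7_cross7:
  "(\<Sum>k\<in>UNIV. cross7 (\<lambda>i. g [e i, x]) (\<lambda>i. g [e i, y]) k * cross7 (\<lambda>i. g [e i, z]) (\<lambda>i. g [e i, w]) k)
    = (\<Sum>i\<in>UNIV. g [e i, x] * g [e i, z]) * (\<Sum>i\<in>UNIV. g [e i, y] * g [e i, w])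
      - (\<Sum>i\<in>UNIV. g [e i, x] * g [e i, w]) * (\<Sum>i\<in>UNIV. g [e i, y] * g [e i, z])
      + (\<Sum>i\<in>UNIV. wedge g [e (i + 2), e (i + 4), e (i + 5), e (i + 6)] [x, y, z, w])"
  unfolding sum_UNIV_7 wedge_4 wedge_3 cross7_def
  by (simp add: numerals_mod_7 algebra_simps)

lemma inner_form_frame_eq: "orthonormal_frame g = inner_form.frame (\<lambda>x y. g [x, y])"
  if "inner_form (\<lambda>x y. g [x, y])"
  by (simp add: fun_eq_iff orthonormal_frame_def inner_form.frame_def[OF that])

locale g2_tensor =
  fixes g \<phi> :: "7 tensor" and e
  assumes inner: "inner_form (\<lambda>x y. g [x, y])" and g2_frame: "g2_frame g \<phi> e"
begin

sublocale inner_form "\<lambda>x y. g [x, y]" by (rule inner)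

definition prod where
  "prod x y = (\<Sum>k\<in>UNIV. cross7 (\<lambda>i. g [e i, x]) (\<lambda>i. g [e i, y]) k *\<^sub>R e k)"

lemma frame_e: "frame e" and phi_eq:
  "\<phi> [x, y, z] = (\<Sum>k\<in>UNIV. cross7 (\<lambda>i. g [e i, x]) (\<lambda>i. g [e i, y]) k * g [e k, z])"
  using g2_frame by (auto simp: g2_frame_def inner_form_frame_eq[OF inner] g2_form_coords)

lemma ip_prod: "g [prod x y, z] = \<phi> [x, y, z]"
  unfolding prod_def phi_eq ip_sum_left by simp

text \<open>The product represents \<phi> by the metric, so it cannot depend on the adapted frame in
  which \<open>prod\<close> is written.\<close>

lemma cross_prod_eq: "cross_prod g \<phi> = prod"
  unfolding cross_prod_def fun_eq_iff using ip_prod ip_nondegenerate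
  by (auto intro!: the_equality)

lemma ip_prod_prod: "g [prod x y, prod z w] =
    g [x, z] * g [y, w] - g [x, w] * g [y, z]
    + (\<Sum>i\<in>UNIV. wedge g [e (i + 2), e (i + 4), e (i + 5), e (i + 6)] [x, y, z, w])"
proof -
  have coord: "g [e k, prod z w] = cross7 (\<lambda>i. g [e i, z]) (\<lambda>i. g [e i, w]) k" for k
  proof -
    have "g [e k, prod z w] = (\<Sum>j\<in>UNIV. cross7 (\<lambda>i. g [e i, z]) (\<lambda>i. g [e i, w]) j * (if k = j then 1 else 0))"
      using frame_e unfolding prod_def ip_sum_right frame_def by simp
    also have "\<dots> = (\<Sum>j\<in>UNIV. if k = j then cross7 (\<lambda>i. g [e i, z]) (\<lambda>i. g [e i, w]) j else 0)"
      by (intro sum.cong) auto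
    finally show ?thesis by simp
  qed
  have par: "(\<Sum>i\<in>UNIV. g [e i, u] * g [e i, v]) = g [u, v]" for u v
    using parseval[OF frame_e, of u v] ip_commute[of "e _" u] ip_commute[of "e _" v] by simp
  show ?thesis
    unfolding ip_prod phi_eq coord cross7_cross7 par ..
qed

lemma bilinear_prod: "bilinear prod"
  unfolding bilinear_def
  by (intro conjI allI linearI)
     (simp_all add: prod_def cross7_def algebra_simps sum.distrib sum_subtractf scaleR_sum_right)

sublocale g2_alg "\<lambda>x y. g [x, y]" prod
proof unfold_locales
  show "bilinear prod" by (rule bilinear_prod)
  show "prod x x = 0" for x
    by (simp add: prod_def cross7_def)
  show "g [prod x y, y] = 0" for x y
    unfolding ip_prod phi_eq sum_UNIV_7 cross7_def by (simp add: numerals_mod_7 algebra_simps)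
  show "g [prod x y, prod y w] = g [x, y] * g [y, w] - g [x, w] * g [y, y]" for x y w
  proof -
    \<comment> \<open>With a repeated argument the wedge terms of \<open>ip_prod_prod\<close>
      vanish, and what is left is \<open>P_polar\<close>.\<close>
    have "wedge g [a, b, c, d] [x, y, y, w] = 0" for a b c d
      unfolding wedge_4 wedge_3 by (simp add: algebra_simps)
    then show ?thesis by (simp add: ip_prod_prod)
  qed
qed

text \<open>The frame chosen by \<open>SOME\<close> need not be \<open>e\<close>. Both frames
  represent the same \<phi>, hence the same product by \<open>cross_prod_eq\<close> and the same
  \<open>assoc_form\<close>.\<close>

lemma star_phi_eq: "star_phi g \<phi> [x, y, z, w] = - assoc_form x y z w"
proof -
  define f where "f = (SOME e. g2_frame g \<phi> e)"
  have f: "g2_frame g \<phi> f" unfolding f_def by (rule someI[of "g2_frame g \<phi>"]) (rule g2_frame)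
  interpret f: g2_tensor g \<phi> f using inner f by unfold_locales
  have "f.prod = prod" using f.cross_prod_eq cross_prod_eq by simp
  then have "assoc_form x y z w
      = (\<Sum>i\<in>UNIV. wedge g [f (i + 2), f (i + 4), f (i + 5), f (i + 6)] [x, y, z, w])"
    using f.ip_prod_prod[of x y z w] by (simp add: assoc_form_def)
  then show ?thesis by (simp add: star_phi_def f_def Let_def)
qed

end

section \<open>Skew derivations of the three-form and the norm of the four-form\<close>

context g2_alg
begin

text \<open>A skew endomorphism is \<open>\<Sum>\<^sub>i e\<^sub>i \<and> a e\<^sub>i / 2\<close>, so this is a sum of instances of the identity for
  \<open>assoc_form (P u v)\<close>.\<close>
lemma skew_derivation:
  assumes a: "linear a" and skew: "\<And>x y. ip (a x) y = - ip x (a y)"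
  shows "\<exists>Y. \<forall>x y z. ip (P (a x) y) z + ip (P x (a y)) z + ip (P x y) (a z) = assoc_form Y x y z"
proof -
  obtain e where e: "frame e" by (rule frame_exists)
  define Y where "Y = (\<Sum>i\<in>UNIV. P (e i) (a (e i)))"
  have "assoc_form Y x y z = 2 * (ip (P (a x) y) z + ip (P x (a y)) z + ip (P x y) (a z))" for x y z
  proof -
    have l: "linear (\<lambda>u. ip (P (a u) y) z)" "linear (\<lambda>u. ip (P x (a u)) z)"
      "linear (\<lambda>u. ip (P x y) (a u))"
      "linear (\<lambda>u. ip (P u y) z)" "linear (\<lambda>u. ip (P x u) z)" "linear (\<lambda>u. ip (P x y) u)"
      by (auto intro!: linearI simp: linear_rules[OF a])
    have s: "ip (e i) w = ip w (e i)" "ip (a (e i)) w = - ip (a w) (e i)" for i w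
      using ip_commute skew by (metis, metis)
    have "assoc_form Y x y z = (\<Sum>i\<in>UNIV. assoc_form (P (e i) (a (e i))) x y z)"
      unfolding Y_def by (rule linear_sum[OF linear_assoc_form(1)])
    also have "\<dots> = 2 * (ip (P (a x) y) z + ip (P x (a y)) z + ip (P x y) (a z))"
      unfolding assoc_form_P s
      by (simp add: sum.distrib sum_subtractf sum_negf frame_linear[OF e l(1)] frame_linear[OF e l(2)]
          frame_linear[OF e l(3)] frame_linear[OF e l(4)] frame_linear[OF e l(5)] frame_linear[OF e l(6)])
    finally show ?thesis .
  qed
  then have "ip (P (a x) y) z + ip (P x (a y)) z + ip (P x y) (a z) = assoc_form ((1 / 2) *\<^sub>R Y) x y z"
    for x y z
    by (simp add: linear_scale[OF linear_assoc_form(1)])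
  then show ?thesis by blast
qed

text \<open>The factor is 4 times 6: the inner two sums give 6 - 1 - 1 times a triple product (fact
  \<open>B\<close>), the outer one is \<open>ip_P_P_trace\<close>. Divided by the 3! of
  \<open>form_inner\<close> it is the 4 that the normalisation of \<open>r_bar\<close>
  removes.\<close>

lemma assoc_form_contract:
  assumes e: "frame e"
  shows "(\<Sum>i\<in>UNIV. \<Sum>j\<in>UNIV. \<Sum>k\<in>UNIV. assoc_form x (e i) (e j) (e k) * assoc_form y (e i) (e j) (e k))
    = 24 * ip x y"
proof -
  have rot: "ip w (P u v) = ip (P w u) v" for u v w by (metis triple_cycle ip_commute)
  have A: "(\<Sum>j\<in>UNIV. \<Sum>k\<in>UNIV. ip (P v (e j)) (e k) * ip (P w (e j)) (e k)) = 6 * ip v w" for v w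
    by (simp add: parseval[OF e] ip_P_P_trace[OF e])
  have B: "(\<Sum>j\<in>UNIV. \<Sum>k\<in>UNIV. ip (P v (e j)) (e k) * assoc_form y z (e j) (e k)) = 4 * ip (P v y) z" for v y z
  proof -
    have b: "bilinear (\<lambda>p q. ip (P v p) q)"
      by (simp add: bilinear_def linear_triple linear_ip_right)
    have "ip (P v (e j)) (e k) * assoc_form y z (e j) (e k)
        = ip (P v (e j)) (e k) * ip (P (P y z) (e j)) (e k)
          - ip y (e j) * ip z (e k) * ip (P v (e j)) (e k)
          + ip z (e j) * ip y (e k) * ip (P v (e j)) (e k)" for j k
      unfolding assoc_form_def rot by (simp only: algebra_simps)
    then have "(\<Sum>j\<in>UNIV. \<Sum>k\<in>UNIV. ip (P v (e j)) (e k) * assoc_form y z (e j) (e k))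
        = 6 * ip v (P y z) - ip (P v y) z + ip (P v z) y"
      by (simp only: sum.distrib sum_subtractf A frame_bilinear[OF e b])
    then show ?thesis by (simp add: rot triple_skew[of v z y])
  qed
  \<comment> \<open>The metric corrections in the first factor live on \<open>i = j\<close> or
    \<open>i = k\<close>, where the second factor vanishes.\<close>
  have C: "assoc_form x (e i) (e j) (e k) * assoc_form y (e i) (e j) (e k)
      = ip (P (P x (e i)) (e j)) (e k) * assoc_form y (e i) (e j) (e k)" for i j k
    using e unfolding frame_def assoc_form_def[of x] rot by (cases "i = j"; cases "i = k") auto
  have "(\<Sum>i\<in>UNIV. \<Sum>j\<in>UNIV. \<Sum>k\<in>UNIV. assoc_form x (e i) (e j) (e k) * assoc_form y (e i) (e j) (e k))
      = (\<Sum>i\<in>UNIV. 4 * ip (P (P x (e i)) y) (e i))"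
    unfolding C B ..
  also have "\<dots> = 4 * (\<Sum>i\<in>UNIV. ip (P x (e i)) (P y (e i)))"
    unfolding rot sum_distrib_left ..
  finally show ?thesis by (simp add: ip_P_P_trace[OF e])
qed

end

section \<open>Derivatives of tensor fields and Levi-Civita connections\<close>

abbreviation "fd f x \<equiv> frechet_derivative f (at x)"

text \<open>The mean value theorem is applied first along \<open>u\<close> to a difference in
  \<open>v\<close>, then along \<open>v\<close> to the resulting directional derivative.\<close>

lemma second_difference_mvt:
  fixes f :: "'a::real_normed_vector \<Rightarrow> real"
  assumes t: "0 < t"
    and S: "\<And>r s. 0 \<le> r \<Longrightarrow> r \<le> t \<Longrightarrow> 0 \<le> s \<Longrightarrow> s \<le> t \<Longrightarrow> x + r *\<^sub>R u + s *\<^sub>R v \<in> S"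
    and f: "\<And>y. y \<in> S \<Longrightarrow> (f has_derivative f' y) (at y)"
    and f': "\<And>y. y \<in> S \<Longrightarrow> ((\<lambda>y. f' y u) has_derivative f'' y) (at y)"
  shows "\<exists>r s. 0 < r \<and> r < t \<and> 0 < s \<and> s < t \<and>
    f (x + t *\<^sub>R u + t *\<^sub>R v) - f (x + t *\<^sub>R u) - f (x + t *\<^sub>R v) + f x
      = t * t * f'' (x + r *\<^sub>R u + s *\<^sub>R v) v"
proof -
  define g where "g r = f (x + r *\<^sub>R u + t *\<^sub>R v) - f (x + r *\<^sub>R u)" for r
  have dg: "DERIV g r :> f' (x + r *\<^sub>R u + t *\<^sub>R v) u - f' (x + r *\<^sub>R u) u" if "0 \<le> r" "r \<le> t" for r
  proof -
    have in_S: "x + r *\<^sub>R u + t *\<^sub>R v \<in> S" "x + r *\<^sub>R u \<in> S"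
      using S[of r t] S[of r 0] that t by auto
    have lines: "((\<lambda>r. x + r *\<^sub>R u + t *\<^sub>R v) has_derivative (\<lambda>h. h *\<^sub>R u)) (at r)"
      "((\<lambda>r. x + r *\<^sub>R u) has_derivative (\<lambda>h. h *\<^sub>R u)) (at r)"
      by (auto intro!: derivative_eq_intros)
    have "((\<lambda>r. f (x + r *\<^sub>R u + t *\<^sub>R v)) has_derivative (\<lambda>h. f' (x + r *\<^sub>R u + t *\<^sub>R v) (h *\<^sub>R u))) (at r)"
      using has_derivative_compose[OF lines(1), of f] f[OF in_S(1)] by blast
    moreover have "((\<lambda>r. f (x + r *\<^sub>R u)) has_derivative (\<lambda>h. f' (x + r *\<^sub>R u) (h *\<^sub>R u))) (at r)"
      using has_derivative_compose[OF lines(2), of f] f[OF in_S(2)] by blast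
    ultimately have "(g has_derivative
        (\<lambda>h. f' (x + r *\<^sub>R u + t *\<^sub>R v) (h *\<^sub>R u) - f' (x + r *\<^sub>R u) (h *\<^sub>R u))) (at r)"
      unfolding g_def by (rule has_derivative_diff)
    then show ?thesis
      by (rule has_derivative_imp_has_field_derivative)
        (simp only: linear_rules[OF has_derivative_linear[OF f[OF in_S(1)]]]
          linear_rules[OF has_derivative_linear[OF f[OF in_S(2)]]] real_scaleR_def right_diff_distrib)
  qed
  obtain r where r: "0 < r" "r < t"
      "g t - g 0 = t * (f' (x + r *\<^sub>R u + t *\<^sub>R v) u - f' (x + r *\<^sub>R u) u)"
    using MVT2[OF t dg] by auto
  have dh: "DERIV (\<lambda>s. f' (x + r *\<^sub>R u + s *\<^sub>R v) u) s :> f'' (x + r *\<^sub>R u + s *\<^sub>R v) v"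
    if "0 \<le> s" "s \<le> t" for s
  proof -
    have in_S: "x + r *\<^sub>R u + s *\<^sub>R v \<in> S" using S that r by auto
    have line: "((\<lambda>s. x + r *\<^sub>R u + s *\<^sub>R v) has_derivative (\<lambda>h. h *\<^sub>R v)) (at s)"
      by (auto intro!: derivative_eq_intros)
    have "((\<lambda>s. f' (x + r *\<^sub>R u + s *\<^sub>R v) u) has_derivative (\<lambda>h. f'' (x + r *\<^sub>R u + s *\<^sub>R v) (h *\<^sub>R v))) (at s)"
      using has_derivative_compose[OF line, of "\<lambda>y. f' y u"] f'[OF in_S] by blast
    then show ?thesis
      by (rule has_derivative_imp_has_field_derivative)
        (simp only: linear_scale[OF has_derivative_linear[OF f'[OF in_S]]] real_scaleR_def)
  qed
  obtain s where s: "0 < s" "s < t"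
      "f' (x + r *\<^sub>R u + t *\<^sub>R v) u - f' (x + r *\<^sub>R u) u = t * f'' (x + r *\<^sub>R u + s *\<^sub>R v) v"
    using MVT2[OF t dh] by auto
  show ?thesis
    using r s by (intro exI[of _ r] exI[of _ s]) (simp add: g_def)
qed

text \<open>The second difference is symmetric in \<open>u\<close> and \<open>v\<close>, so the two
  mixed derivatives agree at some pair of points close to \<open>x\<close>; continuity carries this
  to \<open>x\<close>.\<close>

lemma second_derivative_symmetric_real:
  fixes f :: "'a::real_normed_vector \<Rightarrow> real"
  assumes S: "open S" "x \<in> S"
    and f: "\<And>y. y \<in> S \<Longrightarrow> (f has_derivative f' y) (at y)"
    and f': "\<And>v y. y \<in> S \<Longrightarrow> ((\<lambda>y. f' y v) has_derivative f'' v y) (at y)"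
    and cont: "\<And>u v. continuous_on S (\<lambda>y. f'' v y u)"
  shows "f'' u x v = f'' v x u"
proof (rule ccontr)
  assume "f'' u x v \<noteq> f'' v x u"
  define \<epsilon> where "\<epsilon> = \<bar>f'' u x v - f'' v x u\<bar> / 2"
  have "\<epsilon> > 0" using \<open>f'' u x v \<noteq> f'' v x u\<close> by (simp add: \<epsilon>_def)
  have "isCont (\<lambda>y. f'' u y v) x" "isCont (\<lambda>y. f'' v y u) x"
    using cont S by (auto simp: continuous_on_eq_continuous_at)
  then obtain d1 d2 where d: "d1 > 0" "\<And>y. dist y x < d1 \<Longrightarrow> dist (f'' u y v) (f'' u x v) < \<epsilon>"
     "d2 > 0" "\<And>y. dist y x < d2 \<Longrightarrow> dist (f'' v y u) (f'' v x u) < \<epsilon>"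
    unfolding continuous_at_eps_delta using \<open>\<epsilon> > 0\<close> by metis
  obtain d3 where d3: "d3 > 0" "\<And>y. dist y x < d3 \<Longrightarrow> y \<in> S"
    using S by (metis open_dist)
  define \<delta> where "\<delta> = min d1 (min d2 d3)"
  \<comment> \<open>With this \<open>t\<close> the whole parallelogram stays within \<delta> of
    \<open>x\<close>; the summand 1 covers \<open>u = v = 0\<close>.\<close>
  define t where "t = \<delta> / (norm u + norm v + 1)"
  have pos: "\<delta> > 0" "norm u + norm v + 1 > 0" using d d3 norm_ge_zero[of u] norm_ge_zero[of v]
    by (simp_all add: \<delta>_def add_nonneg_pos)
  then have t: "t > 0" by (simp add: t_def)
  have near: "dist (x + r *\<^sub>R u + s *\<^sub>R v) x < \<delta>" if "0 \<le> r" "r \<le> t" "0 \<le> s" "s \<le> t" for r s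
  proof -
    have "dist (x + r *\<^sub>R u + s *\<^sub>R v) x \<le> r * norm u + s * norm v"
      using norm_triangle_ineq[of "r *\<^sub>R u" "s *\<^sub>R v"] that by (simp add: dist_norm add.assoc)
    also have "\<dots> \<le> t * norm u + t * norm v"
      using that by (intro add_mono mult_right_mono) auto
    also have "\<dots> < t * (norm u + norm v + 1)" using t by (simp add: algebra_simps)
    also have "\<dots> = \<delta>" using pos by (simp add: t_def)
    finally show ?thesis .
  qed
  have near': "dist (x + r *\<^sub>R v + s *\<^sub>R u) x < \<delta>" if "0 \<le> r" "r \<le> t" "0 \<le> s" "s \<le> t" for r s
    using near[of s r] that by (simp add: add_ac)
  have inS: "x + r *\<^sub>R u + s *\<^sub>R v \<in> S" "x + r *\<^sub>R v + s *\<^sub>R u \<in> S"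
    if "0 \<le> r" "r \<le> t" "0 \<le> s" "s \<le> t" for r s
    using near near' that d3(2) by (auto simp: \<delta>_def)
  obtain r s where rs: "0 < r" "r < t" "0 < s" "s < t"
    "f (x + t *\<^sub>R u + t *\<^sub>R v) - f (x + t *\<^sub>R u) - f (x + t *\<^sub>R v) + f x
      = t * t * f'' u (x + r *\<^sub>R u + s *\<^sub>R v) v"
    using second_difference_mvt[where x = x and u = u and v = v and S = S and f'' = "f'' u", OF t inS(1) f f']
    by blast
  obtain r' s' where rs': "0 < r'" "r' < t" "0 < s'" "s' < t"
    "f (x + t *\<^sub>R v + t *\<^sub>R u) - f (x + t *\<^sub>R v) - f (x + t *\<^sub>R u) + f x
      = t * t * f'' v (x + r' *\<^sub>R v + s' *\<^sub>R u) u"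
    using second_difference_mvt[where x = x and u = v and v = u and S = S and f'' = "f'' v", OF t inS(2) f f']
    by blast
  have "t * t * f'' u (x + r *\<^sub>R u + s *\<^sub>R v) v = t * t * f'' v (x + r' *\<^sub>R v + s' *\<^sub>R u) u"
    using rs(5) rs'(5) by (simp add: algebra_simps)
  then have eq: "f'' u (x + r *\<^sub>R u + s *\<^sub>R v) v = f'' v (x + r' *\<^sub>R v + s' *\<^sub>R u) u" using t by simp
  have "\<bar>f'' u (x + r *\<^sub>R u + s *\<^sub>R v) v - f'' u x v\<bar> < \<epsilon>"
    using d(2)[of "x + r *\<^sub>R u + s *\<^sub>R v"] near[of r s] rs by (simp add: \<delta>_def dist_real_def)
  moreover have "\<bar>f'' v (x + r' *\<^sub>R v + s' *\<^sub>R u) u - f'' v x u\<bar> < \<epsilon>"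
    using d(4)[of "x + r' *\<^sub>R v + s' *\<^sub>R u"] near'[of r' s'] rs' by (simp add: \<delta>_def dist_real_def)
  ultimately show False using eq by (simp add: \<epsilon>_def abs_if split: if_splits)
qed

lemma frechet_works: "f differentiable (at x) \<Longrightarrow> (f has_derivative (\<lambda>u. fd f x u)) (at x)"
  using frechet_derivative_works by auto

lemma second_derivative_symmetric:
  fixes f :: "real ^ 'm \<Rightarrow> real ^ 'n"
  assumes S: "open S" "x \<in> S" and f: "Ck_on 2 S f"
  shows "fd (\<lambda>y. fd f y v) x u
    = fd (\<lambda>y. fd f y u) x v"
proof -
  have d1: "f differentiable (at y)" if "y \<in> S" for y
    using f that by (simp add: numeral_2_eq_2)
  have d2: "(\<lambda>y. fd f y v) differentiable (at y)" if "y \<in> S" for y v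
    using f that by (simp add: numeral_2_eq_2)
  have c: "continuous_on S (\<lambda>y. fd (\<lambda>y. fd f y v) y u)" for u v
    using f by (simp add: numeral_2_eq_2)
  have "fd (\<lambda>y. fd f y v) x u $ i
    = fd (\<lambda>y. fd f y u) x v $ i" for i
  proof (rule second_derivative_symmetric_real[OF S, where f = "\<lambda>y. f y $ i"
      and f' = "\<lambda>y v. fd f y v $ i"
      and f'' = "\<lambda>v y u. fd (\<lambda>y. fd f y v) y u $ i"])
    show "((\<lambda>y. f y $ i) has_derivative (\<lambda>v. fd f y v $ i)) (at y)" if "y \<in> S" for y
      by (rule bounded_linear.has_derivative[OF bounded_linear_vec_nth frechet_works[OF d1[OF that]]])
    show "((\<lambda>y. fd f y v $ i) has_derivative
        (\<lambda>u. fd (\<lambda>y. fd f y v) y u $ i)) (at y)" if "y \<in> S" for v y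
      by (rule bounded_linear.has_derivative[OF bounded_linear_vec_nth frechet_works[OF d2[OF that]]])
    show "continuous_on S (\<lambda>y. fd (\<lambda>y. fd f y v) y u $ i)" for u v
      by (intro continuous_intros c)
  qed
  then show ?thesis by (simp add: vec_eq_iff)
qed

lemma has_derivative_on_open_cong:
  assumes "(f has_derivative f') (at x)" "open S" "x \<in> S" "\<And>y. y \<in> S \<Longrightarrow> f y = h y"
  shows "(h has_derivative f') (at x)"
  by (rule has_derivative_transform_within_open[OF assms(1,2,3)]) (simp add: assms(4))

lemma frechet_derivative_open_cong:
  assumes "open S" "x \<in> S" "\<And>y. y \<in> S \<Longrightarrow> f y = h y"
  shows "fd f x = fd h x"
proof -
  have "(f has_derivative D) (at x) \<longleftrightarrow> (h has_derivative D) (at x)" for D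
    using has_derivative_on_open_cong[of f D x S h] has_derivative_on_open_cong[of h D x S f] assms
    by auto
  then show ?thesis by (simp add: frechet_derivative_def)
qed

lemma linear_axis_expand:
  fixes f :: "real ^ 'n \<Rightarrow> real"
  assumes "linear f" shows "f v = (\<Sum>j\<in>UNIV. v $ j * f (axis j 1))"
proof -
  have "f v = f (\<Sum>j\<in>UNIV. v $ j *\<^sub>R axis j 1)"
    by (simp add: basis_expansion scalar_mult_eq_scaleR[symmetric])
  then show ?thesis by (simp add: linear_sum[OF assms] linear_scale[OF assms])
qed

text \<open>A product rule that asks \<open>T\<close> to be differentiable only for each fixed
  argument: linearity lets \<open>V\<close> be expanded in the coordinate axes. The same expansion
  shows that the derivative stays linear in the argument.\<close>

lemma has_derivative_linear_family:
  fixes T :: "'a::real_normed_vector \<Rightarrow> real ^ 'n \<Rightarrow> real"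
  assumes S: "open S" "x \<in> S" and lin: "\<And>y. y \<in> S \<Longrightarrow> linear (T y)"
    and T: "\<And>w. ((\<lambda>y. T y w) has_derivative (\<lambda>u. T' u w)) (at x)"
    and V: "(V has_derivative V') (at x)"
  shows "((\<lambda>y. T y (V y)) has_derivative (\<lambda>u. T' u (V x) + T x (V' u))) (at x)"
    and "linear (T' u)"
proof -
  have T'_sum: "T' u w = (\<Sum>j\<in>UNIV. w $ j * T' u (axis j 1))" for u w
  proof -
    have "((\<lambda>y. \<Sum>j\<in>UNIV. w $ j * T y (axis j 1)) has_derivative
        (\<lambda>u. \<Sum>j\<in>UNIV. w $ j * T' u (axis j 1))) (at x)"
      by (intro has_derivative_sum has_derivative_mult_right T)
    then have "((\<lambda>y. T y w) has_derivative (\<lambda>u. \<Sum>j\<in>UNIV. w $ j * T' u (axis j 1))) (at x)"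
      by (rule has_derivative_on_open_cong[OF _ S]) (metis lin linear_axis_expand)
    from has_derivative_unique[OF T this] show ?thesis by (rule fun_cong)
  qed
  show "linear (T' u)"
  proof (rule linearI)
    show "T' u (a + b) = T' u a + T' u b" for a b
      unfolding T'_sum[of u "a + b"] T'_sum[of u a] T'_sum[of u b]
      by (simp add: algebra_simps sum.distrib)
    show "T' u (r *\<^sub>R a) = r *\<^sub>R T' u a" for r a
      unfolding T'_sum[of u "r *\<^sub>R a"] T'_sum[of u a] by (simp add: sum_distrib_left mult.assoc)
  qed
  have Vj: "((\<lambda>y. V y $ j) has_derivative (\<lambda>u. V' u $ j)) (at x)" for j
    by (rule bounded_linear.has_derivative[OF bounded_linear_vec_nth V])
  have "((\<lambda>y. \<Sum>j\<in>UNIV. V y $ j * T y (axis j 1)) has_derivative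
      (\<lambda>u. \<Sum>j\<in>UNIV. V x $ j * T' u (axis j 1) + V' u $ j * T x (axis j 1))) (at x)"
    by (intro has_derivative_sum has_derivative_mult T Vj)
  moreover have "(\<Sum>j\<in>UNIV. V x $ j * T' u (axis j 1) + V' u $ j * T x (axis j 1))
      = T' u (V x) + T x (V' u)" for u
    by (simp add: sum.distrib flip: T'_sum linear_axis_expand[OF lin[OF S(2)]])
  ultimately have "((\<lambda>y. \<Sum>j\<in>UNIV. V y $ j * T y (axis j 1)) has_derivative
      (\<lambda>u. T' u (V x) + T x (V' u))) (at x)" by simp
  then show "((\<lambda>y. T y (V y)) has_derivative (\<lambda>u. T' u (V x) + T x (V' u))) (at x)"
    by (rule has_derivative_on_open_cong[OF _ S]) (metis lin linear_axis_expand)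
qed

lemma has_derivative_multilinear_2:
  fixes T :: "'a::real_normed_vector \<Rightarrow> 'n::finite tensor"
  assumes S: "open S" "x \<in> S" and lin: "\<And>y. y \<in> S \<Longrightarrow> multilinear 2 (T y)"
    and T: "\<And>a b. ((\<lambda>y. T y [a, b]) has_derivative (\<lambda>u. T' u [a, b])) (at x)"
    and V: "(V has_derivative V') (at x)" and W: "(W has_derivative W') (at x)"
  shows "((\<lambda>y. T y [V y, W y]) has_derivative
    (\<lambda>u. T' u [V x, W x] + T x [V' u, W x] + T x [V x, W' u])) (at x)"
    and "multilinear 2 (T' u)"
proof -
  note l = lin[unfolded multilinear_2_iff, rule_format]
  have 1: "((\<lambda>y. T y [V y, b]) has_derivative (\<lambda>u. T' u [V x, b] + T x [V' u, b])) (at x)" for b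
    by (rule has_derivative_linear_family(1)[where T = "\<lambda>y a. T y [a, b]", OF S _ T V]) (use l in auto)
  have "((\<lambda>y. T y [V y, W y]) has_derivative
      (\<lambda>u. (T' u [V x, W x] + T x [V' u, W x]) + T x [V x, W' u])) (at x)"
    by (rule has_derivative_linear_family(1)[where T = "\<lambda>y b. T y [V y, b]", OF S _ 1 W]) (use l in auto)
  then show "((\<lambda>y. T y [V y, W y]) has_derivative
    (\<lambda>u. T' u [V x, W x] + T x [V' u, W x] + T x [V x, W' u])) (at x)" .
  have "linear (\<lambda>a. T' u [a, b])" "linear (\<lambda>b. T' u [a, b])" for a b
    by (rule has_derivative_linear_family(2)[where T = "\<lambda>y a. T y [a, b]", OF S _ T V], use l in simp)
       (rule has_derivative_linear_family(2)[where T = "\<lambda>y b. T y [a, b]", OF S _ T V], use l in simp)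
  then show "multilinear 2 (T' u)" unfolding multilinear_2_iff by blast
qed

lemma has_derivative_multilinear_3:
  fixes T :: "'a::real_normed_vector \<Rightarrow> 'n::finite tensor"
  assumes S: "open S" "x \<in> S" and lin: "\<And>y. y \<in> S \<Longrightarrow> multilinear 3 (T y)"
    and T: "\<And>a b c. ((\<lambda>y. T y [a, b, c]) has_derivative (\<lambda>u. T' u [a, b, c])) (at x)"
    and V: "(V has_derivative V') (at x)" and W: "(W has_derivative W') (at x)"
    and Z: "(Z has_derivative Z') (at x)"
  shows "((\<lambda>y. T y [V y, W y, Z y]) has_derivative
    (\<lambda>u. T' u [V x, W x, Z x] + T x [V' u, W x, Z x] + T x [V x, W' u, Z x] + T x [V x, W x, Z' u])) (at x)"
    and "multilinear 3 (T' u)"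
proof -
  note l = lin[unfolded multilinear_3_iff, rule_format]
  have 1: "((\<lambda>y. T y [V y, b, c]) has_derivative (\<lambda>u. T' u [V x, b, c] + T x [V' u, b, c])) (at x)" for b c
    by (rule has_derivative_linear_family(1)[where T = "\<lambda>y a. T y [a, b, c]", OF S _ T V]) (use l in auto)
  have 2: "((\<lambda>y. T y [V y, W y, c]) has_derivative
      (\<lambda>u. (T' u [V x, W x, c] + T x [V' u, W x, c]) + T x [V x, W' u, c])) (at x)" for c
    by (rule has_derivative_linear_family(1)[where T = "\<lambda>y b. T y [V y, b, c]", OF S _ 1 W]) (use l in auto)
  have "((\<lambda>y. T y [V y, W y, Z y]) has_derivative
      (\<lambda>u. (T' u [V x, W x, Z x] + T x [V' u, W x, Z x] + T x [V x, W' u, Z x]) + T x [V x, W x, Z' u])) (at x)"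
    by (rule has_derivative_linear_family(1)[where T = "\<lambda>y c. T y [V y, W y, c]", OF S _ 2 Z]) (use l in auto)
  then show "((\<lambda>y. T y [V y, W y, Z y]) has_derivative
    (\<lambda>u. T' u [V x, W x, Z x] + T x [V' u, W x, Z x] + T x [V x, W' u, Z x] + T x [V x, W x, Z' u])) (at x)" .
  have "linear (\<lambda>a. T' u [a, b, c])" "linear (\<lambda>b. T' u [a, b, c])" "linear (\<lambda>c. T' u [a, b, c])" for a b c
    by (rule has_derivative_linear_family(2)[where T = "\<lambda>y a. T y [a, b, c]", OF S _ T V], use l in simp)
       (rule has_derivative_linear_family(2)[where T = "\<lambda>y b. T y [a, b, c]", OF S _ T V], use l in simp,
        rule has_derivative_linear_family(2)[where T = "\<lambda>y c. T y [a, b, c]", OF S _ T V], use l in simp)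
  then show "multilinear 3 (T' u)" unfolding multilinear_3_iff by blast
qed

definition lc_connection ::
  "(real ^ 'n::finite \<Rightarrow> 'n tensor) \<Rightarrow> real ^ 'n \<Rightarrow> (real ^ 'n \<Rightarrow> real ^ 'n \<Rightarrow> real ^ 'n) \<Rightarrow> bool" where
  "lc_connection g x G \<longleftrightarrow> bilinear G \<and> (\<forall>u v. G u v = G v u) \<and>
     (\<forall>u v w. fd (\<lambda>y. g y [v, w]) x u = g x [G u v, w] + g x [v, G u w])"

locale metric_at =
  fixes S :: "(real ^ 'n::finite) set" and g :: "real ^ 'n \<Rightarrow> 'n tensor" and x :: "real ^ 'n"
  assumes S: "open S" "x \<in> S" and inner: "\<And>y. y \<in> S \<Longrightarrow> inner_form (\<lambda>u v. g y [u, v])"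
    and diff: "\<And>u v. (\<lambda>y. g y [u, v]) differentiable (at x)"
begin

sublocale inner_form "\<lambda>u v. g x [u, v]" by (rule inner[OF S(2)])

abbreviation "dg u v w \<equiv> fd (\<lambda>y. g y [v, w]) x u"

lemma multilinear_g: "y \<in> S \<Longrightarrow> multilinear 2 (g y)"
  using inner_form.linear_ip_left[OF inner] inner_form.linear_ip_right[OF inner]
  unfolding multilinear_2_iff by blast

lemma linear_dg: "linear (\<lambda>u. dg u v w)" "linear (\<lambda>v. dg u v w)" "linear (\<lambda>w. dg u v w)"
proof -
  show "linear (\<lambda>u. dg u v w)"
    using has_derivative_linear[OF frechet_works[OF diff]] .
  have "((\<lambda>y. g y [a, b]) has_derivative
      (\<lambda>u. (\<lambda>u vs. fd (\<lambda>y. g y vs) x u) u [a, b])) (at x)" for a b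
    using frechet_works[OF diff] by simp
  from has_derivative_multilinear_2(2)[OF S multilinear_g this has_derivative_const has_derivative_const]
  show "linear (\<lambda>v. dg u v w)" "linear (\<lambda>w. dg u v w)" unfolding multilinear_2_iff by blast+
qed

lemma dg_sym: "dg u v w = dg u w v"
proof -
  have "fd (\<lambda>y. g y [v, w]) x = fd (\<lambda>y. g y [w, v]) x"
    by (rule frechet_derivative_open_cong[OF S]) (rule inner_form.ip_commute[OF inner])
  then show ?thesis by simp
qed

text \<open>The difference of two such connections, paired with the metric, is symmetric in its
  first two and skew in its last two arguments; using the two rules alternately gives
  \<open>t = - t\<close>.\<close>

lemma lc_connection_unique:
  assumes "lc_connection g x G" "lc_connection g x H" shows "G = H"
proof -
  define t where "t u v w = g x [G u v - H u v, w]" for u v w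
  have sym: "t u v w = t v u w" for u v w
    using assms unfolding lc_connection_def t_def by metis
  have skew: "t u v w = - t u w v" for u v w
  proof -
    have "g x [G u v, w] + g x [v, G u w] = g x [H u v, w] + g x [v, H u w]"
      using assms unfolding lc_connection_def by metis
    then show ?thesis unfolding t_def by (simp add: ip_commute[of v])
  qed
  have "t u v w = 0" for u v w
    using sym[of u v w] skew[of v u w] sym[of v w u] skew[of w v u] sym[of w u v] skew[of u w v]
    by linarith
  then have "G u v - H u v = 0" for u v
    using ip_nondegenerate[of "G u v - H u v" 0] by (simp add: t_def)
  then show ?thesis by (simp add: fun_eq_iff)
qed

text \<open>\<open>K\<close> is the Koszul formula, whose bracket terms are absent because
  coordinate fields commute.\<close>

lemma lc_connection_exists: "\<exists>G. lc_connection g x G"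
proof -
  define K where "K u v w = 1 / 2 * (dg u v w + dg v u w - dg w u v)" for u v w
  define G where "G u v = riesz (K u v)" for u v
  have lin: "linear (K u v)" "linear (\<lambda>u. K u v w)" "linear (\<lambda>v. K u v w)" for u v w
    unfolding K_def
    by (auto intro!: linearI simp: linear_rules[OF linear_dg(1)] linear_rules[OF linear_dg(2)]
      linear_rules[OF linear_dg(3)] algebra_simps add_divide_distrib)
  have G: "g x [G u v, w] = K u v w" for u v w
    unfolding G_def by (rule ip_riesz[OF lin(1)])
  have "bilinear G"
    unfolding bilinear_def G_def using linear_riesz[OF lin(1,2)] linear_riesz[OF lin(1,3)] by auto
  moreover have "G u v = G v u" for u v
    by (rule ip_nondegenerate) (simp add: G K_def dg_sym[of u v])
  moreover have "dg u v w = g x [G u v, w] + g x [v, G u w]" for u v w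
    using G[of u v w] G[of u w v] ip_commute[of v "G u w"] dg_sym[of u v w] dg_sym[of v w u]
      dg_sym[of w u v]
    by (simp add: K_def)
  ultimately show ?thesis unfolding lc_connection_def by blast
qed

text \<open>Any map that passes the defining test is the Levi-Civita connection;
  \<open>gauss\<close> uses this to find the connection of the hypersurface.\<close>

lemma lc_connection_iff: "lc_connection g x G \<longleftrightarrow> levi_civita g x = G"
proof -
  have "levi_civita g x = (THE G. lc_connection g x G)"
    by (simp add: levi_civita_def lc_connection_def)
  moreover obtain H where H: "lc_connection g x H" using lc_connection_exists by blast
  ultimately show ?thesis using lc_connection_unique the_equality by metis
qed

lemma lc_levi_civita: "lc_connection g x (levi_civita g x)"
  by (simp add: lc_connection_iff)

lemma levi_civita_sym: "levi_civita g x u v = levi_civita g x v u"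
  and levi_civita_metric: "dg u v w = g x [levi_civita g x u v, w] + g x [v, levi_civita g x u w]"
  and linear_levi_civita: "linear (\<lambda>u. levi_civita g x u v)" "linear (levi_civita g x u)"
  using lc_levi_civita unfolding lc_connection_def bilinear_def by auto

end

lemma (in inner_form) frame_trilinear_eq:
  assumes e: "frame e" and S: "multilinear 3 S" and T: "multilinear 3 T"
    and eq: "\<And>i j k. S [e i, e j, e k] = T [e i, e j, e k]"
  shows "S [x, y, z] = T [x, y, z]"
proof -
  note l = S[unfolded multilinear_3_iff, rule_format] T[unfolded multilinear_3_iff, rule_format]
  have 1: "S [x, e j, e k] = T [x, e j, e k]" for x j k
    using frame_linear[OF e, of "\<lambda>v. S [v, e j, e k]" x] frame_linear[OF e, of "\<lambda>v. T [v, e j, e k]" x]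
      l eq by simp
  have 2: "S [x, y, e k] = T [x, y, e k]" for x y k
    using frame_linear[OF e, of "\<lambda>v. S [x, v, e k]" y] frame_linear[OF e, of "\<lambda>v. T [x, v, e k]" y]
      l 1 by simp
  show ?thesis
    using frame_linear[OF e, of "\<lambda>v. S [x, y, v]" z] frame_linear[OF e, of "\<lambda>v. T [x, y, v]" z]
      l 2 by simp
qed

locale g2_at = metric_at S g x
  for S :: "(real ^ 7) set" and g :: "real ^ 7 \<Rightarrow> 7 tensor" and x +
  fixes \<phi> :: "real ^ 7 \<Rightarrow> 7 tensor" and e :: "real ^ 7 \<Rightarrow> 7 \<Rightarrow> real ^ 7"
  assumes phi: "\<And>y. y \<in> S \<Longrightarrow> multilinear 3 (\<phi> y)"
    and phi_diff: "\<And>u v w. (\<lambda>y. \<phi> y [u, v, w]) differentiable (at x)"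
    and e: "\<And>y. y \<in> S \<Longrightarrow> g2_frame (g y) (\<phi> y) (e y)"
    and e_diff: "\<And>i. (\<lambda>y. e y i) differentiable (at x)"
begin

sublocale g2: g2_tensor "g x" "\<phi> x" "e x"
  by unfold_locales (rule e[OF S(2)])

abbreviation "LC \<equiv> levi_civita g x"

abbreviation "nabla u \<equiv> cov_deriv LC \<phi> x u"

lemma nabla_apply: "nabla u [a, b, c] = fd (\<lambda>y. \<phi> y [a, b, c]) x u
    - \<phi> x [LC u a, b, c] - \<phi> x [a, LC u b, c] - \<phi> x [a, b, LC u c]"
  by (simp add: cov_deriv_def numeral_3_eq_3 lessThan_Suc algebra_simps)

lemma dphi: "((\<lambda>y. \<phi> y [a, b, c]) has_derivative
      (\<lambda>u. (\<lambda>u vs. fd (\<lambda>y. \<phi> y vs) x u) u [a, b, c])) (at x)"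
  using frechet_works[OF phi_diff] by simp

lemmas phi_linear = phi[OF S(2), unfolded multilinear_3_iff, rule_format]

lemma multilinear_nabla: "multilinear 3 (nabla u)"
proof -
  have "multilinear 3 (\<lambda>vs. fd (\<lambda>y. \<phi> y vs) x u)"
    by (rule has_derivative_multilinear_3(2)[OF S phi dphi has_derivative_const has_derivative_const
          has_derivative_const])
  then have d: "linear (\<lambda>a. fd (\<lambda>y. \<phi> y [a, b, c]) x u)"
    "linear (\<lambda>b. fd (\<lambda>y. \<phi> y [a, b, c]) x u)"
    "linear (\<lambda>c. fd (\<lambda>y. \<phi> y [a, b, c]) x u)" for a b c
    unfolding multilinear_3_iff by blast+
  have p: "linear (\<lambda>a. \<phi> x [a, b, c])" "linear (\<lambda>b. \<phi> x [a, b, c])" "linear (\<lambda>c. \<phi> x [a, b, c])" for a b c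
    using phi_linear by blast+
  note L = linear_levi_civita(2)
  show ?thesis
    unfolding multilinear_3_iff
    by (intro allI conjI linearI; simp add: nabla_apply linear_rules[OF d(1)] linear_rules[OF d(2)]
      linear_rules[OF d(3)] linear_rules[OF p(1)] linear_rules[OF p(2)] linear_rules[OF p(3)]
      linear_rules[OF L] algebra_simps)
qed

text \<open>The covariant derivative of \<open>\<phi>\<close> is the image of \<open>\<phi>\<close> under the connection form of an adapted
  frame, which is a skew endomorphism.\<close>
lemma nabla_phi: "\<exists>Y. \<forall>a b c. nabla u [a, b, c] = g2.assoc_form Y a b c"
proof -
  define e' where "e' i u = fd (\<lambda>y. e y i) x u" for i u
  \<comment> \<open>The covariant derivative of the frame field \<open>e i\<close> in direction
    \<open>u\<close>.\<close>
  define s where "s i = e' i u + LC u (e x i)" for i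
  have de: "((\<lambda>y. e y i) has_derivative e' i) (at x)" for i
    unfolding e'_def by (rule frechet_works[OF e_diff])
  have orth: "g y [e y i, e y j] = (if i = j then 1 else 0)" if "y \<in> S" for y i j
    using e[OF that] by (simp add: g2_frame_def orthonormal_frame_def)
  have dgd: "((\<lambda>y. g y [a, b]) has_derivative
      (\<lambda>u. (\<lambda>u vs. fd (\<lambda>y. g y vs) x u) u [a, b])) (at x)" for a b
    using frechet_works[OF diff] by simp
  have s_skew: "g x [s i, e x j] + g x [e x i, s j] = 0" for i j
  proof -
    have "((\<lambda>y. g y [e y i, e y j]) has_derivative (\<lambda>u. dg u (e x i) (e x j)
        + g x [e' i u, e x j] + g x [e x i, e' j u])) (at x)"
      by (rule has_derivative_multilinear_2(1)[OF S multilinear_g dgd de de])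
    moreover have "((\<lambda>y. g y [e y i, e y j]) has_derivative (\<lambda>u. 0)) (at x)"
      by (rule has_derivative_on_open_cong[OF has_derivative_const S]) (rule orth[symmetric])
    ultimately have "(\<lambda>u. dg u (e x i) (e x j) + g x [e' i u, e x j] + g x [e x i, e' j u]) = (\<lambda>u. 0)"
      by (rule has_derivative_unique)
    then have "dg u (e x i) (e x j) + g x [e' i u, e x j] + g x [e x i, e' j u] = 0" by meson
    then show ?thesis by (simp add: s_def levi_civita_metric)
  qed
  have s_phi: "nabla u [e x i, e x j, e x k]
      = - (\<phi> x [s i, e x j, e x k] + \<phi> x [e x i, s j, e x k] + \<phi> x [e x i, e x j, s k])" for i j k
  proof -
    have "((\<lambda>y. \<phi> y [e y i, e y j, e y k]) has_derivative (\<lambda>u.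
        fd (\<lambda>y. \<phi> y [e x i, e x j, e x k]) x u
        + \<phi> x [e' i u, e x j, e x k] + \<phi> x [e x i, e' j u, e x k] + \<phi> x [e x i, e x j, e' k u])) (at x)"
      by (rule has_derivative_multilinear_3(1)[OF S phi dphi de de de])
    \<comment> \<open>In an adapted frame \<phi> has constant coefficients, fixed by orthonormality
      alone.\<close>
    moreover have "((\<lambda>y. \<phi> y [e y i, e y j, e y k]) has_derivative (\<lambda>u. 0)) (at x)"
    proof (rule has_derivative_on_open_cong[OF has_derivative_const S])
      fix y assume y: "y \<in> S"
      show "\<phi> x [e x i, e x j, e x k] = \<phi> y [e y i, e y j, e y k]"
        using e[OF y] e[OF S(2)] unfolding g2_frame_def by (simp add: wedge_3 orth y S(2))
    qed
    ultimately have "(\<lambda>u. fd (\<lambda>y. \<phi> y [e x i, e x j, e x k]) x u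
        + \<phi> x [e' i u, e x j, e x k] + \<phi> x [e x i, e' j u, e x k] + \<phi> x [e x i, e x j, e' k u]) = (\<lambda>u. 0)"
      by (rule has_derivative_unique)
    then have "fd (\<lambda>y. \<phi> y [e x i, e x j, e x k]) x u
        + \<phi> x [e' i u, e x j, e x k] + \<phi> x [e x i, e' j u, e x k] + \<phi> x [e x i, e x j, e' k u] = 0"
      by meson
    moreover have "\<phi> x [a + b, c, d] = \<phi> x [a, c, d] + \<phi> x [b, c, d]"
      "\<phi> x [c, a + b, d] = \<phi> x [c, a, d] + \<phi> x [c, b, d]"
      "\<phi> x [c, d, a + b] = \<phi> x [c, d, a] + \<phi> x [c, d, b]" for a b c d
      using phi_linear linear_add by blast+
    ultimately show ?thesis by (simp add: s_def nabla_apply)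
  qed
  \<comment> \<open>The sign is chosen so that the derivation action of \<open>a\<close> on \<phi>
    is \<open>nabla u\<close>.\<close>
  define a where "a v = - (\<Sum>i\<in>UNIV. g x [v, e x i] *\<^sub>R s i)" for v
  have a: "linear a"
    by (intro linearI) (simp_all add: a_def algebra_simps sum.distrib scaleR_sum_right)
  have a_e: "a (e x i) = - s i" for i
  proof -
    have "(\<Sum>j\<in>UNIV. g x [e x i, e x j] *\<^sub>R s j) = (\<Sum>j\<in>UNIV. if i = j then s j else 0)"
      by (rule sum.cong) (auto simp: orth S(2))
    then show ?thesis by (simp add: a_def)
  qed
  have skew: "g x [a v, w] = - g x [v, a w]" for v w
  proof -
    have l: "linear (\<lambda>v. g x [a v, w] + g x [v, a w])" "linear (\<lambda>w. g x [a v, w] + g x [v, a w])" for v w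
      by (intro linearI; simp add: linear_rules[OF a] algebra_simps)+
    have "g x [a (e x i), e x j] + g x [e x i, a (e x j)] = 0" for i j
      using s_skew[of i j] by (simp add: a_e)
    then have "g x [a (e x i), w] + g x [e x i, a w] = 0" for i w
      using frame_linear[OF g2.frame_e l(2), of w "e x i"] by simp
    then have "g x [a v, w] + g x [v, a w] = 0"
      using frame_linear[OF g2.frame_e l(1), of v w] by simp
    then show ?thesis by simp
  qed
  obtain Y where Y: "\<And>p q r. g x [g2.prod (a p) q, r] + g x [g2.prod p (a q), r] + g x [g2.prod p q, a r]
      = g2.assoc_form Y p q r"
    using g2.skew_derivation[OF a skew] by blast
  have "nabla u [p, q, r] = (\<lambda>vs. g2.assoc_form Y (vs ! 0) (vs ! 1) (vs ! 2)) [p, q, r]" for p q r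
  proof (rule frame_trilinear_eq[OF g2.frame_e multilinear_nabla])
    show "multilinear 3 (\<lambda>vs. g2.assoc_form Y (vs ! 0) (vs ! 1) (vs ! 2))"
      unfolding multilinear_3_iff by (simp add: g2.linear_assoc_form)
    show "nabla u [e x i, e x j, e x k] = g2.assoc_form Y ([e x i, e x j, e x k] ! 0)
        ([e x i, e x j, e x k] ! 1) ([e x i, e x j, e x k] ! 2)" for i j k
      using Y[of "e x i" "e x j" "e x k"] linear_rules[OF phi_linear[THEN conjunct1]]
        linear_rules[OF phi_linear[THEN conjunct2, THEN conjunct1]]
        linear_rules[OF phi_linear[THEN conjunct2, THEN conjunct2]]
      unfolding s_phi g2.ip_prod a_e by simp
  qed
  then show ?thesis by auto
qed

text \<open>With \<open>nabla u\<close> given by \<open>assoc_form Y\<close>, the inner product is -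
  24 / 3! times that of \<open>Y\<close> and \<open>v\<close>, so the hypothesis forces
  \<open>Y\<close> to be \<open>- k / 4\<close> times \<open>u\<close>. Thus \<open>r_bar\<close>
  determines the whole covariant derivative.\<close>

lemma nabla_phi_r_bar:
  assumes "\<And>v. 1 / 4 * form_inner (g x) 3 (nabla u) (\<lambda>ws. star_phi (g x) (\<phi> x) (v # ws))
    = k / 4 * g x [u, v]"
  shows "nabla u [a, b, c] = k / 4 * star_phi (g x) (\<phi> x) [u, a, b, c]"
proof -
  obtain Y where Y: "\<And>a b c. nabla u [a, b, c] = g2.assoc_form Y a b c" using nabla_phi by blast
  define f where "f = some_frame (g x)"
  have f: "frame f"
    unfolding f_def some_frame_def inner_form_frame_eq[OF inner[OF S(2)]]
    by (rule someI[of frame]) (rule g2.frame_e)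
  have "form_inner (g x) 3 (nabla u) (\<lambda>ws. star_phi (g x) (\<phi> x) (v # ws)) = - 4 * g x [Y, v]" for v
    using g2.assoc_form_contract[OF f, of Y v]
    by (simp add: form_inner_def sum_lists_3 Y g2.star_phi_eq sum_negf fact_numeral f_def[symmetric])
  then have "g x [Y, v] = g x [(- k / 4) *\<^sub>R u, v]" for v using assms[of v] by simp
  then have "Y = (- k / 4) *\<^sub>R u" by (rule ip_nondegenerate)
  then have "nabla u [a, b, c] = (- k / 4) *\<^sub>R g2.assoc_form u a b c"
    unfolding Y by (simp only: linear_scale[OF g2.linear_assoc_form(1)])
  then show ?thesis by (simp add: g2.star_phi_eq)
qed

end

section \<open>Types in terms of the second fundamental form\<close>

context su3_alg
begin

text \<open>Rotating \<open>\<psi>\<^sub>+ + i\<psi>\<^sub>-\<close> by a phase amounts to precomposing the cross product with \<open>c + s J\<close>.\<close>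
lemma rotate:
  assumes "c\<^sup>2 + s\<^sup>2 = 1"
  shows "su3_alg ip (\<lambda>x y. Q (c *\<^sub>R x + s *\<^sub>R J x) y) J"
proof -
  have "bilinear (\<lambda>x y. Q (c *\<^sub>R x + s *\<^sub>R J x) y)"
    unfolding bilinear_def by (intro conjI allI linearI) (simp_all add: algebra_simps)
  moreover have "ip (Q (c *\<^sub>R x + s *\<^sub>R J x) y) (Q (c *\<^sub>R z + s *\<^sub>R J z) w)
      = ip x z * ip y w - ip x w * ip y z - ip x (J z) * ip y (J w) + ip x (J w) * ip y (J z)"
    for x y z w
  proof -
    have "ip (Q (c *\<^sub>R x + s *\<^sub>R J x) y) (Q (c *\<^sub>R z + s *\<^sub>R J z) w)
        = (c\<^sup>2 + s\<^sup>2) * ip (Q x y) (Q z w)"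
      by (simp add: algebra_simps power2_eq_square)
    then show ?thesis unfolding assms by (simp add: ip_Q_Q)
  qed
  ultimately show ?thesis
    using linear_J inner_form_axioms
    by (simp add: su3_alg_def su3_alg_axioms_def cross_product_def cross_product_axioms_def)
qed

text \<open>For the rotated product \<open>Qr\<close> the tensor \<alpha> has the endomorphism
  \<open>(c - s J) b\<close>. Write \<open>A = X + h + Am\<close>. As \<open>X\<close> is symmetric,
  trace-free and commutes with \<open>J\<close>, the part \<open>c X\<close> belongs to
  \<open>W2p\<close> and the skew part \<open>- s J X\<close> to \<open>W2m\<close>, while
  \<open>(c - s J) Am\<close> stays symmetric and anticommuting. Hence one condition on
  \<open>B\<close> appears twice, weighted by \<open>c\<close> and by \<open>s\<close>.\<close>

lemma type_iff:
  fixes B :: "real ^ 6 \<Rightarrow> real ^ 6 \<Rightarrow> real"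
  assumes B: "bilinear B" "\<And>u v. B u v = B v u"
    and cs: "c\<^sup>2 + s\<^sup>2 = 1"
    and g: "\<And>x y. g [x, y] = ip x y"
    and \<psi>: "\<And>x y z. \<psi> [x, y, z] = c * ip (Q x y) z + s * ip (Q (J x) y) z"
    and b: "\<And>u v. ip (b u) v = B u v - k / 4 * ip (J u) v"
    and \<alpha>: "\<And>u v w. \<alpha> [u, v, w] = ip (Q (b u) v) w"
    and h: "h = 1 / 6 * trace_form g B"
    and U: "W4 \<notin> U"
  shows "(\<exists>f. gh_components g J \<psi> \<alpha> f \<and>
      (\<forall>w\<in>{W1p, W1m, W2p, W2m, W3, W4} - U. \<forall>x y z. f w [x, y, z] = 0)) \<longleftrightarrow>
    (W1p \<notin> U \<longrightarrow> 4 * h * c = k * s) \<and> (W1m \<notin> U \<longrightarrow> - 4 * h * s = k * c) \<and>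
    (W2p \<notin> U \<longrightarrow> (\<forall>u v. c * (B u v + B (J u) (J v)) = 2 * h * c * ip u v)) \<and>
    (W2m \<notin> U \<longrightarrow> (\<forall>u v. s * (B u v + B (J u) (J v)) = 2 * h * s * ip u v)) \<and>
    (W3 \<notin> U \<longrightarrow> (\<forall>u v. B (J u) (J v) = B u v))"
proof -
  define Qr where "Qr x y = Q (c *\<^sub>R x + s *\<^sub>R J x) y" for x y
  interpret r: su3_tensor ip Qr J g \<psi>
  proof -
    interpret r0: su3_alg ip Qr J unfolding Qr_def by (rule rotate[OF cs])
    show "su3_tensor ip Qr J g \<psi>"
      by unfold_locales (simp_all add: g \<psi> Qr_def)
  qed
  define A where "A u = riesz (B u)" for u
  have linB: "linear (B u)" "linear (\<lambda>u. B u v)" for u v using B(1) by (auto simp: bilinear_def)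
  have A: "ip (A u) v = B u v" for u v unfolding A_def by (rule ip_riesz[OF linB(1)])
  have linA: "linear A" unfolding A_def by (rule linear_riesz[OF linB])
  note A_simps = linear_rules[OF linA]
  have A_sym: "ip (A u) v = ip u (A v)" for u v using A B(2) ip_commute by metis
  have b_eq: "b u = A u - (k / 4) *\<^sub>R J u" for u
    by (rule ip_nondegenerate) (simp add: b A)
  define Ap where "Ap u = (1 / 2) *\<^sub>R (A u - J (A (J u)))" for u
  define Am where "Am u = (1 / 2) *\<^sub>R (A u + J (A (J u)))" for u
  define X where "X u = Ap u - h *\<^sub>R u" for u
  have AA: "A u = X u + h *\<^sub>R u + Am u" for u
    by (simp add: X_def Ap_def Am_def algebra_simps flip: scaleR_add_left)
  have linX: "linear X" and linAm: "linear Am"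
    by (intro linearI; simp add: X_def Ap_def Am_def A_simps algebra_simps)+
  note X_simps = linear_rules[OF linX] linear_rules[OF linAm]
  have XJ: "X (J u) = J (X u)" for u
    by (simp add: X_def Ap_def A_simps algebra_simps)
  have AmJ: "Am (J u) = - J (Am u)" for u
    by (simp add: Am_def A_simps algebra_simps)
  have X_ip: "ip (X u) v = 1 / 2 * (B u v + B (J u) (J v)) - h * ip u v" for u v
    by (simp add: X_def Ap_def A algebra_simps)
  have Am_ip: "ip (Am u) v = 1 / 2 * (B u v - B (J u) (J v))" for u v
    by (simp add: Am_def A algebra_simps)
  have X_sym: "ip (X u) v = ip u (X v)" for u v
    using X_ip[of u v] X_ip[of v u] B(2)[of u v] B(2)[of "J u" "J v"] ip_commute[of u v]
      ip_commute[of u "X v"] by simp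
  have Am_sym: "ip (Am u) v = ip u (Am v)" for u v
    using Am_ip[of u v] Am_ip[of v u] B(2)[of u v] B(2)[of "J u" "J v"] ip_commute[of u "Am v"] by simp
  \<comment> \<open>The \<open>J\<close>-average of \<open>B\<close> has the trace of
    \<open>B\<close>, so the definition of \<open>h\<close> is what makes \<open>X\<close>
    trace-free.\<close>
  have tr: "(\<Sum>i\<in>UNIV. ip (X (r.e i)) (r.e i)) = 0"
  proof -
    have "(\<Sum>i\<in>UNIV. B (J (r.e i)) (J (r.e i))) = (\<Sum>i\<in>UNIV. B (r.e i) (r.e i))"
      by (rule frame_comp_sum[OF r.frame_e linear_J ip_J_J B(1)])
    then have "(\<Sum>i\<in>UNIV. ip (X (r.e i)) (r.e i)) = trace_form g B - 6 * h"
      by (simp add: X_ip sum_subtractf sum.distrib card_frame[OF r.frame_e] r.trace_form_eq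
          flip: sum_distrib_left sum_divide_distrib)
    then show ?thesis by (simp add: h)
  qed
  have tensor: "\<alpha> [x, y, z] = ip (Qr ((c * h - k / 4 * s) *\<^sub>R x + (- s * h - k / 4 * c) *\<^sub>R J x
      + c *\<^sub>R X x + (- s) *\<^sub>R J (X x) + (c *\<^sub>R Am x - s *\<^sub>R J (Am x))) y) z" for x y z
  proof -
    have L: "(c * h - k / 4 * s) *\<^sub>R x + (- s * h - k / 4 * c) *\<^sub>R J x
      + c *\<^sub>R X x + (- s) *\<^sub>R J (X x) + (c *\<^sub>R Am x - s *\<^sub>R J (Am x)) = c *\<^sub>R b x - s *\<^sub>R J (b x)"
      unfolding b_eq AA by (simp add: algebra_simps)
    have "c *\<^sub>R (c *\<^sub>R b x - s *\<^sub>R J (b x)) + s *\<^sub>R J (c *\<^sub>R b x - s *\<^sub>R J (b x)) = (c\<^sup>2 + s\<^sup>2) *\<^sub>R b x"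
      by (simp add: algebra_simps power2_eq_square)
    then show ?thesis unfolding L Qr_def cs by (simp add: \<alpha>)
  qed
  have comp: "(\<exists>f. gh_components g J \<psi> \<alpha> f \<and>
      (\<forall>w\<in>{W1p, W1m, W2p, W2m, W3, W4} - U. \<forall>x y z. f w [x, y, z] = 0)) \<longleftrightarrow>
    (W1p \<notin> U \<longrightarrow> c * h - k / 4 * s = 0) \<and> (W1m \<notin> U \<longrightarrow> - s * h - k / 4 * c = 0) \<and>
    (W2p \<notin> U \<longrightarrow> (\<forall>x. c *\<^sub>R X x = 0)) \<and> (W2m \<notin> U \<longrightarrow> (\<forall>x. (- s) *\<^sub>R J (X x) = 0)) \<and>
    (W3 \<notin> U \<longrightarrow> (\<forall>x. c *\<^sub>R Am x - s *\<^sub>R J (Am x) = 0))"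
  proof (rule r.gh_components_iff[OF _ _ _ _ _ _ _ _ _ _ _ tensor U])
    show "linear (\<lambda>x. c *\<^sub>R X x)" "linear (\<lambda>x. - s *\<^sub>R J (X x))" "linear (\<lambda>x. c *\<^sub>R Am x - s *\<^sub>R J (Am x))"
      by (intro linearI; simp add: X_simps algebra_simps)+
    show "c *\<^sub>R X (J x) = J (c *\<^sub>R X x)" "- s *\<^sub>R J (X (J x)) = J (- s *\<^sub>R J (X x))"
      "c *\<^sub>R Am (J x) - s *\<^sub>R J (Am (J x)) = - J (c *\<^sub>R Am x - s *\<^sub>R J (Am x))" for x
      by (simp_all add: XJ AmJ)
    show "ip (c *\<^sub>R X x) y = ip x (c *\<^sub>R X y)" for x y by (simp add: X_sym)
    show "ip (- s *\<^sub>R J (X x)) y = - ip x (- s *\<^sub>R J (X y))" for x y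
      using X_sym[of x "J y"] by (simp add: XJ)
    show "ip (c *\<^sub>R Am x - s *\<^sub>R J (Am x)) y = ip x (c *\<^sub>R Am y - s *\<^sub>R J (Am y))" for x y
      using Am_sym[of x "J y"] Am_sym[of x y] by (simp add: AmJ)
    show "(\<Sum>i\<in>UNIV. ip (c *\<^sub>R X (r.e i)) (r.e i)) = 0"
      using tr by (simp flip: sum_distrib_left)
    have "ip (- s *\<^sub>R J (X (r.e i))) (J (r.e i)) = - s * ip (X (r.e i)) (r.e i)" for i by simp
    then show "(\<Sum>i\<in>UNIV. ip (- s *\<^sub>R J (X (r.e i))) (J (r.e i))) = 0"
      using tr by (simp only: sum_distrib_left[symmetric] mult_zero_right)
  qed
  have X0: "(t *\<^sub>R X u = 0) \<longleftrightarrow> (\<forall>v. t * (B u v + B (J u) (J v)) = 2 * h * t * ip u v)" for t u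
  proof -
    have "(t *\<^sub>R X u = 0) \<longleftrightarrow> (\<forall>v. ip (t *\<^sub>R X u) v = 0)"
      using ip_nondegenerate[of "t *\<^sub>R X u" 0] by auto
    also have "\<dots> \<longleftrightarrow> (\<forall>v. t * (B u v + B (J u) (J v)) = 2 * h * t * ip u v)"
    proof -
      have "t * (1 / 2 * p - h * q) = 0 \<longleftrightarrow> t * p = 2 * h * t * q" for p q :: real
        by (auto simp: field_simps)
      then show ?thesis by (simp only: ip_simps X_ip real_scaleR_def)
    qed
    finally show ?thesis .
  qed
  have JX0: "((- s) *\<^sub>R J (X u) = 0) \<longleftrightarrow> (s *\<^sub>R X u = 0)" for u
  proof -
    have "J (X u) = 0 \<longleftrightarrow> X u = 0" by (metis J_J J_simps(5) neg_equal_0_iff_equal)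
    then show ?thesis by auto
  qed
  have Am0: "(\<forall>x. c *\<^sub>R Am x - s *\<^sub>R J (Am x) = 0) \<longleftrightarrow> (\<forall>u v. B (J u) (J v) = B u v)"
  proof -
    \<comment> \<open>\<open>c - s J\<close> has the inverse \<open>c + s J\<close>, so the phase
      drops out of the condition for \<open>W3\<close>.\<close>
    have "c *\<^sub>R Am x - s *\<^sub>R J (Am x) = 0 \<longleftrightarrow> Am x = 0" for x
    proof
      assume *: "c *\<^sub>R Am x - s *\<^sub>R J (Am x) = 0"
      have "Am x = (c\<^sup>2 + s\<^sup>2) *\<^sub>R Am x" by (simp add: cs)
      also have "\<dots> = c *\<^sub>R (c *\<^sub>R Am x - s *\<^sub>R J (Am x)) + s *\<^sub>R J (c *\<^sub>R Am x - s *\<^sub>R J (Am x))"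
        by (simp add: algebra_simps power2_eq_square)
      finally show "Am x = 0" unfolding * by simp
    qed simp
    moreover have "Am x = 0 \<longleftrightarrow> (\<forall>v. B (J x) (J v) = B x v)" for x
      using ip_nondegenerate[of "Am x" 0] Am_ip[of x] by auto
    ultimately show ?thesis by simp
  qed
  have "c * h - k / 4 * s = 0 \<longleftrightarrow> 4 * h * c = k * s" "- s * h - k / 4 * c = 0 \<longleftrightarrow> - 4 * h * s = k * c"
    by (auto simp: algebra_simps)
  then show ?thesis unfolding comp X0 JX0 Am0 by simp
qed

end

section \<open>Differentiability of fields defined by metric duality\<close>

lemma differentiable_det:
  fixes M :: "'a::real_normed_vector \<Rightarrow> real ^ 'n ^ 'n"
  assumes "\<And>i j. (\<lambda>y. M y $ i $ j) differentiable (at x)"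
  shows "(\<lambda>y. det (M y)) differentiable (at x)"
proof -
  have prod: "(\<lambda>y. \<Prod>i\<in>I. f i y) differentiable (at x)"
    if "finite I" "\<And>i. f i differentiable (at x)" for I and f :: "'n \<Rightarrow> 'a \<Rightarrow> real"
    using that by (induction I rule: finite_induct) (auto intro: differentiable_mult)
  show ?thesis
    unfolding det_def
    by (intro differentiable_sum differentiable_mult differentiable_const prod ballI)
       (auto simp: assms finite_permutations)
qed

text \<open>The solution of a linear system is differentiable by Cramer's rule.\<close>
lemma (in metric_at) differentiable_raise:
  assumes f: "\<And>y w. y \<in> S \<Longrightarrow> g y [V y, w] = f w y" and diff_f: "\<And>w. f w differentiable (at x)"
  shows "V differentiable (at x)"
proof -
  define M where "M y = (\<chi> i j. g y [axis j 1, axis i 1])" for y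
  define b where "b y = (\<chi> i. f (axis i 1) y)" for y
  have eq: "M y *v v = b y \<longleftrightarrow> v = V y" if "y \<in> S" for y v
  proof -
    interpret y: inner_form "\<lambda>u v. g y [u, v]" by (rule inner[OF that])
    have comp: "(M y *v v) $ i = g y [v, axis i 1]" for v i
      using linear_axis_expand[OF y.linear_ip_left, of v "axis i 1"]
      by (simp add: M_def matrix_vector_mult_def mult.commute)
    have "M y *v v = b y \<longleftrightarrow> (\<forall>i. g y [v, axis i 1] = g y [V y, axis i 1])"
      by (simp add: vec_eq_iff comp b_def f[OF that])
    also have "\<dots> \<longleftrightarrow> v = V y"
    proof
      assume *: "\<forall>i. g y [v, axis i 1] = g y [V y, axis i 1]"
      have "g y [v, w] = g y [V y, w]" for w
        using linear_axis_expand[OF y.linear_ip_right, of v w]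
          linear_axis_expand[OF y.linear_ip_right, of "V y" w] * by simp
      then show "v = V y" by (rule y.ip_nondegenerate)
    qed simp
    finally show ?thesis .
  qed
  have det: "det (M y) \<noteq> 0" if "y \<in> S" for y
  proof -
    interpret y: inner_form "\<lambda>u v. g y [u, v]" by (rule inner[OF that])
    have "v = 0" if "M y *v v = 0" for v
    proof -
      have "M y *v (v + V y) = b y" using that eq[OF \<open>y \<in> S\<close>, of "V y"]
        by (simp add: matrix_vector_right_distrib)
      then show "v = 0" using eq[OF \<open>y \<in> S\<close>, of "v + V y"] by simp
    qed
    then show ?thesis
      by (metis invertible_det_nz invertible_left_inverse matrix_left_invertible_ker)
  qed
  have comp: "V y $ k = det (\<chi> i j. if j = k then b y $ i else M y $ i $ j) / det (M y)" if "y \<in> S" for y k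
    using eq[OF that, of "V y"] cramer[OF det[OF that], of "V y" "b y"] by (simp add: vec_eq_iff)
  have dM: "(\<lambda>y. M y $ i $ j) differentiable (at x)" and db: "(\<lambda>y. b y $ i) differentiable (at x)" for i j
    by (simp_all add: M_def b_def diff diff_f)
  have dc: "(\<lambda>y. det (\<chi> i j. if j = k then b y $ i else M y $ i $ j)) differentiable (at x)" for k
  proof (rule differentiable_det)
    show "(\<lambda>y. (\<chi> i j. if j = k then b y $ i else M y $ i $ j) $ i $ j) differentiable (at x)" for i j
      by (cases "j = k") (simp_all add: dM db)
  qed
  have dq: "(\<lambda>y. det (\<chi> i j. if j = k then b y $ i else M y $ i $ j) / det (M y)) differentiable (at x)" for k
    by (rule differentiable_divide[OF dc differentiable_det[OF dM] det[OF S(2)]])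
  have dV: "(\<lambda>y. V y $ k) differentiable (at x)" for k
  proof (rule differentiableI)
    show "((\<lambda>y. V y $ k) has_derivative frechet_derivative
        (\<lambda>y. det (\<chi> i j. if j = k then b y $ i else M y $ i $ j) / det (M y)) (at x)) (at x)"
      by (rule has_derivative_on_open_cong[OF frechet_works[OF dq] S]) (rule comp[symmetric])
  qed
  show ?thesis
    unfolding differentiable_componentwise_within[of V x UNIV]
    using dV by (auto simp: Basis_vec_def inner_axis)
qed

text \<open>Up to a cyclic shift each term is \<open>- ip (Q (J b) v) (Q w z)\<close>. In the cyclic
  sum of \<open>ip_Q_Q\<close> the purely metric terms cancel and those with \<open>J\<close> occur
  twice, which the factor 1/2 undoes. The identity says how the torsion \<xi> compensates a
  derivative equal to minus the wedge of \<open>b\<close> with the Kaehler form.\<close>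

lemma (in su3_alg) torsion_identity:
  "1 / 2 * (ip (Q (J (Q b v)) w) z + ip (Q v (J (Q b w))) z + ip (Q v w) (J (Q b z)))
    = - (ip b v * ip w (J z) + ip b w * ip z (J v) + ip b z * ip v (J w))"
proof -
  have rot: "ip (Q (J (Q b v)) w) z = - ip (Q (J b) v) (Q w z)" for v w z
  proof -
    have "ip (Q (J (Q b v)) w) z = ip (Q w z) (J (Q b v))" by (rule triple_cycle[symmetric])
    then show ?thesis by (simp add: om_skew[of "Q b v"])
  qed
  have "ip (Q v (J (Q b w))) z = ip (Q (J (Q b w)) z) v" "ip (Q v w) (J (Q b z)) = ip (Q (J (Q b z)) v) w"
    by (metis triple_cycle)+
  then show ?thesis
    unfolding rot ip_Q_Q
    using om_skew[of w v] om_skew[of z w] om_skew[of z v] ip_commute[of w v] ip_commute[of z w]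
      ip_commute[of z v]
    by (simp add: algebra_simps)
qed

lemma cov_deriv_cong:
  assumes "open U" "x \<in> U" "\<And>y vs. y \<in> U \<Longrightarrow> length vs = length ws \<Longrightarrow> T y vs = T' y vs"
  shows "cov_deriv G T x u ws = cov_deriv G T' x u ws"
proof -
  have 1: "fd (\<lambda>y. T y ws) x = fd (\<lambda>y. T' y ws) x"
    by (rule frechet_derivative_open_cong[OF assms(1,2)]) (rule assms(3), auto)
  have 2: "(\<Sum>i<length ws. T x (ws[i := G u (ws ! i)])) = (\<Sum>i<length ws. T' x (ws[i := G u (ws ! i)]))"
    by (rule sum.cong[OF refl]) (rule assms(3)[OF assms(2)], simp)
  show ?thesis unfolding cov_deriv_def 1 2 ..
qed

lemma cov_deriv_2: "cov_deriv G T x u [a, b] = fd (\<lambda>y. T y [a, b]) x u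
    - T x [G u a, b] - T x [a, G u b]"
  by (simp add: cov_deriv_def numeral_2_eq_2 lessThan_Suc algebra_simps)

lemma cov_deriv_3: "cov_deriv G T x u [a, b, c] = fd (\<lambda>y. T y [a, b, c]) x u
    - T x [G u a, b, c] - T x [a, G u b, c] - T x [a, b, G u c]"
  by (simp add: cov_deriv_def numeral_3_eq_3 lessThan_Suc algebra_simps)

text \<open>The range of \<open>D\<close> lies in the orthogonal complement of \<open>n\<close>, and
  both have dimension \<open>CARD('m)\<close>.\<close>

lemma (in inner_form) hyperplane_image:
  fixes D :: "real ^ 'm::finite \<Rightarrow> real ^ 'n"
  assumes D: "linear D" "inj D" and card: "CARD('n) = Suc CARD('m)"
    and n: "ip n n = 1" "\<And>v. ip (D v) n = 0" and X: "ip X n = 0"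
  shows "\<exists>v. D v = X"
proof -
  let ?T = "{X. ip X n = 0}"
  have sub: "subspace ?T" by (auto simp: subspace_def)
  have "n \<notin> ?T" using n by simp
  then have "dim ?T < DIM(real ^ 'n)"
    using dim_psubset[of ?T UNIV] sub by (auto simp: span_eq_iff[THEN iffD2])
  then have le: "dim ?T \<le> CARD('m)" using card by simp
  have "range D \<subseteq> ?T" using n by auto
  moreover have "dim (range D) = CARD('m)"
    using dim_image_eq[OF D(1), of UNIV] D(2) by simp
  ultimately have "range D = ?T"
    using subspace_dim_equal[OF linear_subspace_image[OF D(1) subspace_UNIV] sub] le by simp
  then have "X \<in> range D" using X by simp
  then show ?thesis by auto
qed

section \<open>Hypersurfaces in coordinates\<close>

text \<open>Everything is read in one chart on each side. \<open>gM\<close> and \<open>J\<close> are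
  arbitrary fields known only by their values on \<open>U\<close>, so the induced fields, whose
  definition changes charts from point to point, can be substituted once these values are
  established.\<close>

locale hypersurface_at = amb: g2_at S g "F x" \<phi> e
  for S g \<phi> e and F :: "real ^ 6 \<Rightarrow> real ^ 7" and x +
  fixes U :: "(real ^ 6) set" and N :: "real ^ 6 \<Rightarrow> real ^ 7" and gM :: "real ^ 6 \<Rightarrow> 6 tensor"
    and J :: "real ^ 6 \<Rightarrow> real ^ 6 \<Rightarrow> real ^ 6" and k :: real
  assumes U: "open U" "x \<in> U" and F_in: "\<And>y. y \<in> U \<Longrightarrow> F y \<in> S" and F: "Ck_on 2 U F"
    and inj: "\<And>y. y \<in> U \<Longrightarrow> inj (fd F y)"
    and N_diff: "N differentiable (at x)"
    and N_unit: "\<And>y. y \<in> U \<Longrightarrow> g (F y) [N y, N y] = 1"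
    and N_orth: "\<And>y v. y \<in> U \<Longrightarrow> g (F y) [fd F y v, N y] = 0"
    and gM: "\<And>y u v. y \<in> U \<Longrightarrow>
      gM y [u, v] = g (F y) [fd F y u, fd F y v]"
    and J: "\<And>y u v. y \<in> U \<Longrightarrow>
      gM y [J y u, v] = \<phi> (F y) [N y, fd F y u, fd F y v]"
    and nabla_phi_eq: "\<And>u a b c. amb.nabla u [a, b, c] = k / 4 * star_phi (g (F x)) (\<phi> (F x)) [u, a, b, c]"
begin

abbreviation "dF y \<equiv> fd F y"
abbreviation "ddF u v \<equiv> fd (\<lambda>y. dF y v) x u"
abbreviation "dN u \<equiv> fd N x u"

lemma F_deriv: "y \<in> U \<Longrightarrow> (F has_derivative dF y) (at y)"
  by (rule frechet_works) (use F in \<open>simp add: numeral_2_eq_2\<close>)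

lemma dF_deriv: "((\<lambda>y. dF y v) has_derivative (\<lambda>u. ddF u v)) (at x)"
  by (rule frechet_works) (use F U in \<open>simp add: numeral_2_eq_2\<close>)

lemma N_deriv: "(N has_derivative dN) (at x)"
  by (rule frechet_works[OF N_diff])

lemma linear_dF: "y \<in> U \<Longrightarrow> linear (dF y)"
  by (rule has_derivative_linear[OF F_deriv])

lemmas dF_simps = linear_rules[OF linear_dF[OF U(2)]]

lemma ddF_sym: "ddF u v = ddF v u"
  by (rule second_derivative_symmetric[OF U F])

text \<open>The Leibniz rule for the connection pulled back along \<open>F\<close>; the Christoffel
  terms come from the derivative of the metric in direction \<open>dF x u\<close>.\<close>

lemma g_along:
  assumes V: "(V has_derivative V') (at x)" and W: "(W has_derivative W') (at x)"
  shows "((\<lambda>y. g (F y) [V y, W y]) has_derivative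
    (\<lambda>u. g (F x) [V' u + amb.LC (dF x u) (V x), W x] + g (F x) [V x, W' u + amb.LC (dF x u) (W x)])) (at x)"
proof -
  have "((\<lambda>y. g (F y) [a, b]) has_derivative
      (\<lambda>u. (\<lambda>u vs. fd (\<lambda>z. g z vs) (F x) (dF x u)) u [a, b])) (at x)" for a b
    using has_derivative_compose[OF F_deriv[OF U(2)] frechet_works[OF amb.diff]] by simp
  from has_derivative_multilinear_2(1)[where T = "\<lambda>y. g (F y)"
      and T' = "\<lambda>u vs. fd (\<lambda>z. g z vs) (F x) (dF x u)",
      OF U amb.multilinear_g[OF F_in] this V W]
  have "((\<lambda>y. g (F y) [V y, W y]) has_derivative (\<lambda>u. amb.dg (dF x u) (V x) (W x)
      + g (F x) [V' u, W x] + g (F x) [V x, W' u])) (at x)" .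
  then show ?thesis by (simp add: amb.levi_civita_metric algebra_simps)
qed

lemma phi_along:
  assumes V: "(V has_derivative V') (at x)" and W: "(W has_derivative W') (at x)"
    and Z: "(Z has_derivative Z') (at x)"
  shows "((\<lambda>y. \<phi> (F y) [V y, W y, Z y]) has_derivative (\<lambda>u. amb.nabla (dF x u) [V x, W x, Z x]
    + \<phi> (F x) [V' u + amb.LC (dF x u) (V x), W x, Z x]
    + \<phi> (F x) [V x, W' u + amb.LC (dF x u) (W x), Z x]
    + \<phi> (F x) [V x, W x, Z' u + amb.LC (dF x u) (Z x)])) (at x)"
proof -
  have "((\<lambda>y. \<phi> (F y) [a, b, c]) has_derivative
      (\<lambda>u. (\<lambda>u vs. fd (\<lambda>z. \<phi> z vs) (F x) (dF x u)) u [a, b, c])) (at x)" for a b c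
    using has_derivative_compose[OF F_deriv[OF U(2)] frechet_works[OF amb.phi_diff]] by simp
  from has_derivative_multilinear_3(1)[where T = "\<lambda>y. \<phi> (F y)"
      and T' = "\<lambda>u vs. fd (\<lambda>z. \<phi> z vs) (F x) (dF x u)",
      OF U amb.phi[OF F_in] this V W Z]
  have "((\<lambda>y. \<phi> (F y) [V y, W y, Z y]) has_derivative (\<lambda>u.
      fd (\<lambda>z. \<phi> z [V x, W x, Z x]) (F x) (dF x u)
      + \<phi> (F x) [V' u, W x, Z x] + \<phi> (F x) [V x, W' u, Z x] + \<phi> (F x) [V x, W x, Z' u])) (at x)" .
  moreover have "\<phi> (F x) [a + b, c, d] = \<phi> (F x) [a, c, d] + \<phi> (F x) [b, c, d]"
      "\<phi> (F x) [c, a + b, d] = \<phi> (F x) [c, a, d] + \<phi> (F x) [c, b, d]"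
      "\<phi> (F x) [c, d, a + b] = \<phi> (F x) [c, d, a] + \<phi> (F x) [c, d, b]" for a b c d
    using amb.phi_linear linear_add by blast+
  ultimately show ?thesis by (simp add: amb.nabla_apply algebra_simps)
qed

text \<open>\<open>nabF u v\<close> and \<open>nabN u\<close> are the covariant derivatives along
  \<open>F\<close>, in direction \<open>u\<close>, of the image of the coordinate field
  \<open>v\<close> and of the unit normal.\<close>

definition "nabF u v = ddF u v + amb.LC (dF x u) (dF x v)"
definition "nabN u = dN u + amb.LC (dF x u) (N x)"
definition "B u v = g (F x) [nabF u v, N x]"

lemma nabF_sym: "nabF u v = nabF v u"
  unfolding nabF_def by (metis ddF_sym amb.levi_civita_sym)

lemma bilinear_nabF: "bilinear nabF"
proof -
  have 1: "linear (\<lambda>u. ddF u v)" for v by (rule has_derivative_linear[OF dF_deriv])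
  have "linear (\<lambda>u. nabF u v)" for v
    unfolding nabF_def
    by (intro linearI) (simp_all add: linear_rules[OF 1] dF_simps
        linear_rules[OF amb.linear_levi_civita(1)] algebra_simps)
  moreover have "nabF u = (\<lambda>v. nabF v u)" for u
    by (rule ext) (rule nabF_sym)
  ultimately show ?thesis unfolding bilinear_def by metis
qed

lemma bilinear_B: "bilinear B" and B_sym: "B u v = B v u"
proof -
  show "B u v = B v u" by (simp add: B_def nabF_sym)
  have l: "linear (nabF u)" "linear (\<lambda>u. nabF u v)" for u v using bilinear_nabF by (auto simp: bilinear_def)
  show "bilinear B"
    unfolding bilinear_def B_def
    by (intro conjI allI linearI) (simp_all add: linear_rules[OF l(1)] linear_rules[OF l(2)])
qed

lemma N_nabN: "g (F x) [nabN u, N x] = 0"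
proof -
  have "((\<lambda>y. g (F y) [N y, N y]) has_derivative
      (\<lambda>u. g (F x) [nabN u, N x] + g (F x) [N x, nabN u])) (at x)"
    unfolding nabN_def by (rule g_along[OF N_deriv N_deriv])
  moreover have "((\<lambda>y. g (F y) [N y, N y]) has_derivative (\<lambda>u. 0)) (at x)"
    by (rule has_derivative_on_open_cong[OF has_derivative_const U]) (rule N_unit[symmetric])
  ultimately have "(\<lambda>u. g (F x) [nabN u, N x] + g (F x) [N x, nabN u]) = (\<lambda>u. 0)"
    by (rule has_derivative_unique)
  then have "g (F x) [nabN u, N x] + g (F x) [N x, nabN u] = 0" by meson
  then show ?thesis by (simp add: amb.ip_commute[of "N x" "nabN u"])
qed

text \<open>Weingarten's formula, by differentiating the orthogonality of \<open>dF y v\<close> and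
  \<open>N y\<close>.\<close>

lemma dF_nabN: "g (F x) [nabN u, dF x v] = - B u v"
proof -
  have "((\<lambda>y. g (F y) [dF y v, N y]) has_derivative
      (\<lambda>u. g (F x) [nabF u v, N x] + g (F x) [dF x v, nabN u])) (at x)"
    unfolding nabN_def nabF_def by (rule g_along[OF dF_deriv N_deriv])
  moreover have "((\<lambda>y. g (F y) [dF y v, N y]) has_derivative (\<lambda>u. 0)) (at x)"
    by (rule has_derivative_on_open_cong[OF has_derivative_const U]) (rule N_orth[symmetric])
  ultimately have "(\<lambda>u. g (F x) [nabF u v, N x] + g (F x) [dF x v, nabN u]) = (\<lambda>u. 0)"
    by (rule has_derivative_unique)
  then have "g (F x) [nabF u v, N x] + g (F x) [dF x v, nabN u] = 0" by meson
  then show ?thesis by (simp add: B_def amb.ip_commute[of "nabN u"])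
qed

lemma N_orth': "g (F x) [N x, dF x v] = 0"
  using N_orth[OF U(2)] by (simp add: amb.ip_commute[of "N x"])

lemma tangent: "g (F x) [X, N x] = 0 \<Longrightarrow> \<exists>v. dF x v = X"
  by (rule amb.hyperplane_image[OF linear_dF[OF U(2)] inj[OF U(2)] _ N_unit[OF U(2)] N_orth[OF U(2)]])
    simp_all

sublocale M: metric_at U gM x
proof (rule metric_at.intro)
  show "open U" "x \<in> U" by (rule U)+
  show "inner_form (\<lambda>u v. gM y [u, v])" if y: "y \<in> U" for y
  proof -
    interpret y: inner_form "\<lambda>u v. g (F y) [u, v]" by (rule amb.inner[OF F_in[OF y]])
    note l = linear_dF[OF y]
    have "dF y v \<noteq> 0" if "v \<noteq> 0" for v
      using that injD[OF inj[OF y], of v 0] linear_0[OF l] by auto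
    then show ?thesis
      by unfold_locales
        (auto simp: gM[OF y] bilinear_def linear_rules[OF l] y.ip_pos
          intro!: linearI y.ip_commute)
  qed
  show "(\<lambda>y. gM y [u, v]) differentiable (at x)" for u v
    using has_derivative_on_open_cong[OF g_along[OF dF_deriv dF_deriv] U gM[symmetric]]
    unfolding differentiable_def by blast
qed

abbreviation "LC_M \<equiv> levi_civita gM x"
abbreviation "ip u v \<equiv> gM x [u, v]"

lemma ip_eq: "ip u v = g (F x) [dF x u, dF x v]"
  by (rule gM[OF U(2)])

text \<open>The tangential part of \<open>nabF\<close> inherits symmetry and compatibility with the
  metric, so by uniqueness it is the Levi-Civita connection.\<close>

lemma gauss: "dF x (LC_M u v) = nabF u v - B u v *\<^sub>R N x"
proof -
  have "g (F x) [nabF u v - B u v *\<^sub>R N x, N x] = 0" for u v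
    using N_unit[OF U(2)] by (simp add: B_def)
  then have "\<exists>w. dF x w = nabF u v - B u v *\<^sub>R N x" for u v by (rule tangent)
  then obtain G where G: "\<And>u v. dF x (G u v) = nabF u v - B u v *\<^sub>R N x" by metis
  note inj' = injD[OF inj[OF U(2)]]
  have l: "linear (nabF u)" "linear (\<lambda>u. nabF u v)" "linear (B u)" "linear (\<lambda>u. B u v)" for u v
    using bilinear_nabF bilinear_B by (auto simp: bilinear_def)
  have "lc_connection gM x G"
    unfolding lc_connection_def
  proof (intro conjI allI)
    show "bilinear G"
      unfolding bilinear_def
      by (intro conjI allI linearI; rule inj'; simp add: G dF_simps linear_rules[OF l(1)]
        linear_rules[OF l(2)] linear_rules[OF l(3)] linear_rules[OF l(4)] algebra_simps)
    show "G u v = G v u" for u v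
      by (rule inj') (simp add: G nabF_sym[of u v] B_sym[of u v])
    show "M.dg u v w = gM x [G u v, w] + gM x [v, G u w]" for u v w
    proof -
      have "((\<lambda>y. gM y [v, w]) has_derivative
          (\<lambda>u. g (F x) [nabF u v, dF x w] + g (F x) [dF x v, nabF u w])) (at x)"
        unfolding nabF_def
        by (rule has_derivative_on_open_cong[OF g_along[OF dF_deriv dF_deriv] U gM[symmetric]])
      from fun_cong[OF frechet_derivative_at[OF this, symmetric]]
      have "M.dg u v w = g (F x) [nabF u v, dF x w] + g (F x) [dF x v, nabF u w]" .
      moreover have "g (F x) [dF x v, N x] = 0" "g (F x) [N x, dF x w] = 0"
        by (rule N_orth[OF U(2)] N_orth')+
      ultimately show ?thesis by (simp add: ip_eq G)
    qed
  qed
  then show ?thesis using M.lc_connection_iff G by simp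
qed

lemma nabF_eq: "nabF u v = dF x (LC_M u v) + B u v *\<^sub>R N x"
  unfolding gauss by simp

definition "Q u v = (SOME w. dF x w = amb.g2.prod (dF x u) (dF x v)
   - g (F x) [amb.g2.prod (dF x u) (dF x v), N x] *\<^sub>R N x)"

lemma dF_Q: "dF x (Q u v) = amb.g2.prod (dF x u) (dF x v)
   - g (F x) [amb.g2.prod (dF x u) (dF x v), N x] *\<^sub>R N x"
proof -
  have "\<exists>w. dF x w = amb.g2.prod (dF x u) (dF x v) - g (F x) [amb.g2.prod (dF x u) (dF x v), N x] *\<^sub>R N x"
    by (rule tangent) (simp only: amb.ip_simps N_unit[OF U(2)] real_scaleR_def mult_1_right diff_self)
  then show ?thesis unfolding Q_def by (rule someI_ex)
qed

lemma dF_J: "dF x (J x u) = amb.g2.prod (N x) (dF x u)"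
proof -
  have "g (F x) [amb.g2.prod (N x) (dF x u), N x] = 0" by simp
  then obtain w where w: "dF x w = amb.g2.prod (N x) (dF x u)" using tangent by blast
  have "J x u = w"
    by (rule M.ip_nondegenerate) (simp add: J[OF U(2)], simp add: ip_eq w amb.g2.ip_prod)
  then show ?thesis using w by simp
qed

lemma su3_alg: "su3_alg (\<lambda>u v. gM x [u, v]) Q (J x)"
  by (rule amb.g2.su3_hypersurface[where D = "dF x" and n = "N x"])
    (simp_all only: N_unit[OF U(2)] linear_dF[OF U(2)] inj[OF U(2)] N_orth' gM[OF U(2)] dF_J dF_Q)

sublocale alg: su3_alg "\<lambda>u v. gM x [u, v]" Q "J x"
  by (rule su3_alg)

lemma phi_tangent: "\<phi> (F x) [dF x a, dF x b, dF x c] = ip (Q a b) c"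
proof -
  have "ip (Q a b) c = g (F x) [amb.g2.prod (dF x a) (dF x b), dF x c]
      - g (F x) [amb.g2.prod (dF x a) (dF x b), N x] * g (F x) [N x, dF x c]"
    unfolding ip_eq dF_Q by (simp only: amb.ip_simps real_scaleR_def)
  then show ?thesis unfolding N_orth' amb.g2.ip_prod by simp
qed

lemma phi_N: "\<phi> (F x) [N x, dF x a, dF x b] = ip (J x a) b"
  by (rule J[OF U(2), symmetric])

lemma phi_cycle: "\<phi> (F x) [a, b, c] = \<phi> (F x) [b, c, a]"
  using amb.g2.triple_cycle[of b c a] by (simp only: amb.g2.ip_prod)

text \<open>The right-hand side is half the square of the Kaehler form:
  \<open>assoc_form_tangential\<close> transported by \<open>dF\<close>.\<close>

lemma assoc_form_dF: "amb.g2.assoc_form (dF x u) (dF x v) (dF x w) (dF x z) =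
    ip u (J x v) * ip w (J x z) + ip u (J x w) * ip z (J x v) + ip u (J x z) * ip v (J x w)"
proof -
  show ?thesis
    unfolding ip_eq dF_J
    by (rule amb.g2.assoc_form_tangential[OF N_unit[OF U(2)]]; unfold mem_Collect_eq; rule N_orth')
qed

lemma assoc_form_N: "amb.g2.assoc_form (N x) (dF x u) (dF x v) (dF x w) = ip (Q (J x u) v) w"
proof -
  have "amb.g2.assoc_form (N x) (dF x u) (dF x v) (dF x w)
      = g (F x) [amb.g2.prod (dF x v) (dF x w), dF x (J x u)]"
    unfolding amb.g2.assoc_form_def dF_J N_orth'
    using amb.ip_commute[of "amb.g2.prod (N x) (dF x u)" "amb.g2.prod (dF x v) (dF x w)"] by simp
  also have "\<dots> = ip (Q v w) (J x u)" by (simp only: amb.g2.ip_prod phi_tangent)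
  finally show ?thesis using alg.triple_cycle[of v w "J x u"] by simp
qed

text \<open>\<open>A\<close> is the shape operator; the second term of \<open>b\<close> is the
  contribution of \<open>nabla_phi_eq\<close> with the normal in one slot.\<close>

definition "A u = M.riesz (B u)"
definition "b u = A u - (k / 4) *\<^sub>R J x u"

lemma ip_A: "ip (A u) v = B u v"
  unfolding A_def by (rule M.ip_riesz) (use bilinear_B in \<open>auto simp: bilinear_def\<close>)

lemma ip_b: "ip (b u) v = B u v - k / 4 * ip (J x u) v"
  unfolding b_def by (simp add: ip_A)

abbreviation "omega \<equiv> \<lambda>y vs. gM y [vs ! 0, J y (vs ! 1)]"

text \<open>The function is \<phi> on \<open>N y\<close>, \<open>dF y w\<close>,
  \<open>dF y v\<close>, and \<open>phi_along\<close> yields four terms: the derivative of \<phi>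
  gives the part of \<open>b\<close> with \<open>k\<close>, that of \<open>N\<close> the shape
  operator, and the other two the Christoffel terms, since \<phi> vanishes on two normals.\<close>

lemma omega_deriv: "((\<lambda>y. gM y [v, J y w]) has_derivative
    (\<lambda>u. ip (Q (b u) v) w + gM x [LC_M u v, J x w] + gM x [v, J x (LC_M u w)])) (at x)"
proof -
  have "((\<lambda>y. \<phi> (F y) [N y, dF y w, dF y v]) has_derivative
      (\<lambda>u. amb.nabla (dF x u) [N x, dF x w, dF x v] + \<phi> (F x) [nabN u, dF x w, dF x v]
        + \<phi> (F x) [N x, nabF u w, dF x v] + \<phi> (F x) [N x, dF x w, nabF u v])) (at x)"
    unfolding nabN_def nabF_def by (rule phi_along[OF N_deriv dF_deriv dF_deriv])
  moreover have "amb.nabla (dF x u) [N x, dF x w, dF x v] + \<phi> (F x) [nabN u, dF x w, dF x v]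
        + \<phi> (F x) [N x, nabF u w, dF x v] + \<phi> (F x) [N x, dF x w, nabF u v]
      = ip (Q (b u) v) w + gM x [LC_M u v, J x w] + gM x [v, J x (LC_M u w)]" for u
  proof -
    have "amb.nabla (dF x u) [N x, dF x w, dF x v]
        = - (k / 4) * amb.g2.assoc_form (dF x u) (N x) (dF x w) (dF x v)"
      unfolding nabla_phi_eq amb.g2.star_phi_eq by simp
    also have "amb.g2.assoc_form (dF x u) (N x) (dF x w) (dF x v) = ip (Q (J x u) v) w"
      using amb.g2.assoc_form_skew(1)[of "dF x u" "N x" "dF x w" "dF x v"]
        amb.g2.assoc_form_skew(2)[of "N x" "dF x u" "dF x v" "dF x w"]
        assoc_form_N[of u v w] by simp
    finally have 1: "amb.nabla (dF x u) [N x, dF x w, dF x v] = - (k / 4) * ip (Q (J x u) v) w" .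
    have nabN: "nabN u = - dF x (A u)"
    proof -
      obtain a where a: "dF x a = nabN u" using tangent[OF N_nabN] by blast
      have "a = - A u"
        by (rule M.ip_nondegenerate) (simp only: M.ip_simps ip_A, simp only: ip_eq a dF_nabN)
      then show ?thesis using a dF_simps by metis
    qed
    have neg: "\<phi> (F x) [- a, c, d] = - \<phi> (F x) [a, c, d]"
      and addscale: "\<phi> (F x) [c, a + r *\<^sub>R c', d] = \<phi> (F x) [c, a, d] + r * \<phi> (F x) [c, c', d]"
        "\<phi> (F x) [c, d, a + r *\<^sub>R c'] = \<phi> (F x) [c, d, a] + r * \<phi> (F x) [c, d, c']" for a c d c' r
      unfolding amb.g2.ip_prod[symmetric] by simp_all
    have zero: "\<phi> (F x) [c, c, d] = 0" "\<phi> (F x) [c, d, c] = 0" for c d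
      unfolding amb.g2.ip_prod[symmetric] by simp_all
    have 2: "\<phi> (F x) [nabN u, dF x w, dF x v] = ip (Q (A u) v) w"
      unfolding nabN neg phi_tangent using alg.triple_skew[of "A u" w v] by simp
    have 3: "\<phi> (F x) [N x, nabF u w, dF x v] = gM x [v, J x (LC_M u w)]"
      unfolding nabF_eq addscale zero phi_N using M.ip_commute by simp
    have 4: "\<phi> (F x) [N x, dF x w, nabF u v] = gM x [LC_M u v, J x w]"
      unfolding nabF_eq addscale zero phi_N using M.ip_commute by simp
    show ?thesis unfolding 1 2 3 4 b_def by simp
  qed
  ultimately have "((\<lambda>y. \<phi> (F y) [N y, dF y w, dF y v]) has_derivative
      (\<lambda>u. ip (Q (b u) v) w + gM x [LC_M u v, J x w] + gM x [v, J x (LC_M u w)])) (at x)" by simp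
  then show ?thesis
  proof (rule has_derivative_on_open_cong[OF _ U])
    fix y assume y: "y \<in> U"
    show "\<phi> (F y) [N y, dF y w, dF y v] = gM y [v, J y w]"
      unfolding J[OF y, symmetric] by (rule inner_form.ip_commute[OF M.inner[OF y]])
  qed
qed

lemma nabla_omega_eq: "cov_deriv LC_M omega x u [v, w] = ip (Q (b u) v) w"
  unfolding cov_deriv_2
  using fun_cong[OF frechet_derivative_at[OF omega_deriv[of v w], symmetric], of u] by simp

text \<open>\<open>J\<close> is known only as a metric dual, so its differentiability is that of the
  solution of a linear system with differentiable coefficients.\<close>

lemma J_diff: "(\<lambda>y. J y v) differentiable (at x)"
proof (rule M.differentiable_raise)
  show "gM y [J y v, w] = \<phi> (F y) [N y, dF y v, dF y w]" if "y \<in> U" for y w by (rule J[OF that])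
  show "(\<lambda>y. \<phi> (F y) [N y, dF y v, dF y w]) differentiable (at x)" for w
    using phi_along[OF N_deriv dF_deriv dF_deriv] unfolding differentiable_def by blast
qed

lemma gM_deriv: "((\<lambda>y. gM y [v, w]) has_derivative
    (\<lambda>u. (\<lambda>u vs. fd (\<lambda>y. gM y vs) x u) u [v, w])) (at x)"
  using frechet_works[OF M.diff] by simp

lemma nabla_J_eq: "cov_deriv_endo LC_M J x u w = - Q (b u) w"
proof (rule M.ip_nondegenerate)
  fix v
  let ?J' = "\<lambda>u. fd (\<lambda>y. J y w) x u"
  have "((\<lambda>y. gM y [v, J y w]) has_derivative
      (\<lambda>u. M.dg u v (J x w) + gM x [0, J x w] + gM x [v, ?J' u])) (at x)"
    by (rule has_derivative_multilinear_2(1)[OF U M.multilinear_g gM_deriv has_derivative_const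
          frechet_works[OF J_diff]])
  from has_derivative_unique[OF this omega_deriv]
  have "M.dg u v (J x w) + gM x [0, J x w] + gM x [v, ?J' u]
      = ip (Q (b u) v) w + gM x [LC_M u v, J x w] + gM x [v, J x (LC_M u w)]" by meson
  then have "gM x [v, cov_deriv_endo LC_M J x u w] = ip (Q (b u) v) w"
    by (simp add: M.levi_civita_metric cov_deriv_endo_def)
  then show "gM x [cov_deriv_endo LC_M J x u w, v] = gM x [- Q (b u) w, v]"
    using M.ip_commute alg.triple_skew[of "b u" v w] by simp
qed

abbreviation "p0 \<equiv> \<lambda>y vs. \<phi> (F y) (map (dF y) vs)"

text \<open>The terms with \<open>k\<close> are the restriction of \<open>nabla_phi_eq\<close>,
  those with \<open>B\<close> come from the normal part of \<open>nabF\<close>. Together they are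
  minus the wedge of \<open>b u\<close> with the Kaehler form, the shape that
  \<open>torsion_identity\<close> compensates.\<close>

lemma p0_deriv: "((\<lambda>y. p0 y [v, w, z]) has_derivative (\<lambda>u.
    - (k / 4) * (ip u (J x v) * ip w (J x z) + ip u (J x w) * ip z (J x v) + ip u (J x z) * ip v (J x w))
    - (B u v * ip w (J x z) + B u w * ip z (J x v) + B u z * ip v (J x w))
    + p0 x [LC_M u v, w, z] + p0 x [v, LC_M u w, z] + p0 x [v, w, LC_M u z])) (at x)"
proof -
  have "((\<lambda>y. \<phi> (F y) [dF y v, dF y w, dF y z]) has_derivative
      (\<lambda>u. amb.nabla (dF x u) [dF x v, dF x w, dF x z] + \<phi> (F x) [nabF u v, dF x w, dF x z]
        + \<phi> (F x) [dF x v, nabF u w, dF x z] + \<phi> (F x) [dF x v, dF x w, nabF u z])) (at x)"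
    unfolding nabF_def by (rule phi_along[OF dF_deriv dF_deriv dF_deriv])
  moreover have "amb.nabla (dF x u) [dF x v, dF x w, dF x z] + \<phi> (F x) [nabF u v, dF x w, dF x z]
        + \<phi> (F x) [dF x v, nabF u w, dF x z] + \<phi> (F x) [dF x v, dF x w, nabF u z]
      = - (k / 4) * (ip u (J x v) * ip w (J x z) + ip u (J x w) * ip z (J x v) + ip u (J x z) * ip v (J x w))
    - (B u v * ip w (J x z) + B u w * ip z (J x v) + B u z * ip v (J x w))
    + p0 x [LC_M u v, w, z] + p0 x [v, LC_M u w, z] + p0 x [v, w, LC_M u z]" for u
  proof -
    have 1: "amb.nabla (dF x u) [dF x v, dF x w, dF x z] = - (k / 4) * (ip u (J x v) * ip w (J x z)
        + ip u (J x w) * ip z (J x v) + ip u (J x z) * ip v (J x w))"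
      unfolding nabla_phi_eq amb.g2.star_phi_eq assoc_form_dF by (simp add: algebra_simps)
    have addscale: "\<phi> (F x) [a + r *\<^sub>R c', c, d] = \<phi> (F x) [a, c, d] + r * \<phi> (F x) [c', c, d]"
      "\<phi> (F x) [c, a + r *\<^sub>R c', d] = \<phi> (F x) [c, a, d] + r * \<phi> (F x) [c, c', d]"
      "\<phi> (F x) [c, d, a + r *\<^sub>R c'] = \<phi> (F x) [c, d, a] + r * \<phi> (F x) [c, d, c']" for a c d c' r
      unfolding amb.g2.ip_prod[symmetric] by simp_all
    have n: "\<phi> (F x) [N x, dF x w, dF x z] = - ip w (J x z)"
      "\<phi> (F x) [dF x v, N x, dF x z] = - ip z (J x v)"
      "\<phi> (F x) [dF x v, dF x w, N x] = - ip v (J x w)"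
      using phi_cycle[of "dF x v" "N x" "dF x z"] phi_cycle[of "N x" "dF x v" "dF x w"]
      by (simp_all add: phi_N)
    show ?thesis unfolding 1 nabF_eq addscale n by simp
  qed
  ultimately show ?thesis by simp
qed

text \<open>The connection \<open>\<nabla> + \<eta> + \<xi>\<close> at \<open>x\<close>.\<close>
definition "conn \<eta> u v = LC_M u v + (- \<eta> (J x u)) *\<^sub>R J x v
  + (- 1 / 2) *\<^sub>R J x (cov_deriv_endo LC_M J x u v)"

lemma conn_eq: "conn \<eta> u v = LC_M u v - \<eta> (J x u) *\<^sub>R J x v + (1 / 2) *\<^sub>R J x (Q (b u) v)"
  by (simp add: conn_def nabla_J_eq)

lemma conn_omega: "cov_deriv (conn \<eta>) omega x u [v, w] = 0"
proof -
  have "fd (\<lambda>y. gM y [v, J y w]) x u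
      = ip (Q (b u) v) w + gM x [LC_M u v, J x w] + gM x [v, J x (LC_M u w)]"
    using fun_cong[OF frechet_derivative_at[OF omega_deriv[of v w], symmetric], of u] .
  then show ?thesis
    unfolding cov_deriv_2 conn_eq
    using alg.triple_skew[of "b u" w v] M.ip_commute[of v "Q (b u) w"] by simp
qed

lemma p0_eq: "p0 x [u, v, w] = ip (Q u v) w"
  by (simp add: phi_tangent)

text \<open>By \<open>torsion_identity\<close> the \<xi> term cancels everything except the action
  of \<eta>; there \<open>J\<close> can be moved from each of the three arguments to the first,
  whence the factor 3.\<close>

lemma conn_p0: "cov_deriv (conn \<eta>) p0 x u [v, w, z] = 3 * \<eta> (J x u) * ip (Q (J x v) w) z"
proof -
  have d: "fd (\<lambda>y. p0 y [v, w, z]) x u =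
    - (k / 4) * (ip u (J x v) * ip w (J x z) + ip u (J x w) * ip z (J x v) + ip u (J x z) * ip v (J x w))
    - (B u v * ip w (J x z) + B u w * ip z (J x v) + B u z * ip v (J x w))
    + p0 x [LC_M u v, w, z] + p0 x [v, LC_M u w, z] + p0 x [v, w, LC_M u z]"
    using fun_cong[OF frechet_derivative_at[OF p0_deriv[of v w z], symmetric], of u] .
  have "ip (b u) v = B u v + k / 4 * ip u (J x v)" for v by (simp add: ip_b)
  then show ?thesis
    unfolding cov_deriv_3 d conn_eq p0_eq
    using alg.torsion_identity[of "b u" v w z] by (simp add: algebra_simps)
qed

text \<open>The \<eta> term commutes with \<open>J\<close>, and the \<xi> term contributes minus the
  covariant derivative of \<open>J\<close>. Thus \<open>chi\<close> can be differentiated by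
  inserting \<open>J\<close> into \<open>conn_p0\<close>.\<close>

lemma conn_J: "cov_deriv_endo (conn \<eta>) J x u v = 0"
proof -
  have "cov_deriv_endo (conn \<eta>) J x u v = cov_deriv_endo LC_M J x u v + Q (b u) v"
    unfolding cov_deriv_endo_def conn_eq
    by (simp add: algebra_simps flip: scaleR_add_left)
  then show ?thesis by (simp add: nabla_J_eq)
qed

text \<open>Minus the pullback of \<open>n \<lrcorner> *\<phi>\<close>, by
  \<open>assoc_form_N\<close>; in this form it is built from \<open>p0\<close> and \<open>J\<close>,
  whose derivatives are known.\<close>

abbreviation "chi \<equiv> \<lambda>y vs. p0 y [J y (vs ! 0), vs ! 1, vs ! 2]"

lemma multilinear_p0: "y \<in> U \<Longrightarrow> multilinear 3 (p0 y)"
proof -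
  assume y: "y \<in> U"
  note p = amb.phi[OF F_in[OF y], unfolded multilinear_3_iff, rule_format]
  have l: "linear (\<lambda>a. \<phi> (F y) [a, c, d])" "linear (\<lambda>a. \<phi> (F y) [c, a, d])"
    "linear (\<lambda>a. \<phi> (F y) [c, d, a])" for c d
    using p by blast+
  show "multilinear 3 (p0 y)"
    unfolding multilinear_3_iff
    by (intro allI conjI linearI)
      (simp_all add: linear_rules[OF linear_dF[OF y]] linear_rules[OF l(1)] linear_rules[OF l(2)]
        linear_rules[OF l(3)])
qed

lemma p0_diff: "((\<lambda>y. p0 y [v, w, z]) has_derivative
    (\<lambda>u. (\<lambda>u vs. fd (\<lambda>y. p0 y vs) x u) u [v, w, z])) (at x)"
proof -
  have "(\<lambda>y. p0 y [v, w, z]) differentiable (at x)"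
    using p0_deriv[of v w z] unfolding differentiable_def by blast
  from frechet_works[OF this] show ?thesis .
qed

lemma chi_deriv: "((\<lambda>y. chi y [v, w, z]) has_derivative
    (\<lambda>u. fd (\<lambda>y. p0 y [J x v, w, z]) x u
      + p0 x [fd (\<lambda>y. J y v) x u, w, z])) (at x)"
proof -
  have "((\<lambda>y. p0 y [J y v, w, z]) has_derivative
    (\<lambda>u. fd (\<lambda>y. p0 y [J x v, w, z]) x u
      + p0 x [fd (\<lambda>y. J y v) x u, w, z] + p0 x [J x v, 0, z] + p0 x [J x v, w, 0])) (at x)"
    by (rule has_derivative_multilinear_3(1)[where T = p0
        and T' = "\<lambda>u vs. fd (\<lambda>y. p0 y vs) x u", OF U multilinear_p0 p0_diff
        frechet_works[OF J_diff] has_derivative_const has_derivative_const])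
  then show ?thesis unfolding p0_eq by simp
qed

lemma conn_chi: "cov_deriv (conn \<eta>) chi x u [v, w, z] = - 3 * \<eta> (J x u) * ip (Q v w) z"
proof -
  have "fd (\<lambda>y. chi y [v, w, z]) x u
      = fd (\<lambda>y. p0 y [J x v, w, z]) x u
      + p0 x [fd (\<lambda>y. J y v) x u, w, z]"
    using fun_cong[OF frechet_derivative_at[OF chi_deriv[of v w z], symmetric], of u] .
  then have "cov_deriv (conn \<eta>) chi x u [v, w, z] = cov_deriv (conn \<eta>) p0 x u [J x v, w, z]
      + p0 x [cov_deriv_endo (conn \<eta>) J x u v, w, z]"
    unfolding cov_deriv_3 cov_deriv_endo_def p0_eq by (simp del: alg.Q_J_left)
  then show ?thesis unfolding conn_p0 conn_J p0_eq by simp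
qed

section \<open>The phase and the one-form of class \<open>W5\<close>\<close>

context
  fixes \<theta> :: "real ^ 6 \<Rightarrow> real"
  assumes \<theta>: "\<theta> differentiable (at x)"
begin

abbreviation "d\<theta> u \<equiv> fd \<theta> x u"
abbreviation "psip \<equiv> \<lambda>y vs. cos (\<theta> y) * p0 y vs + sin (\<theta> y) * chi y vs"
abbreviation "psim \<equiv> \<lambda>y vs. sin (\<theta> y) * p0 y vs - cos (\<theta> y) * chi y vs"

text \<open>Differentiating the phase rotates the pair by \<open>d\<theta> u\<close>, and \<eta>
  rotates it by \<open>3 * \<eta> (J x u)\<close>; the two rotations add.\<close>

lemma conn_psi:
  "cov_deriv (conn \<eta>) psip x u [v, w, z] = - (d\<theta> u + 3 * \<eta> (J x u)) * psim x [v, w, z]"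
  "cov_deriv (conn \<eta>) psim x u [v, w, z] = (d\<theta> u + 3 * \<eta> (J x u)) * psip x [v, w, z]"
proof -
  let ?p = "\<lambda>u. fd (\<lambda>y. p0 y [v, w, z]) x u"
  let ?c = "\<lambda>u. fd (\<lambda>y. chi y [v, w, z]) x u"
  have th: "(\<theta> has_derivative d\<theta>) (at x)" by (rule frechet_works[OF \<theta>])
  have cs: "((\<lambda>y. cos (\<theta> y)) has_derivative (\<lambda>u. d\<theta> u * - sin (\<theta> x))) (at x)"
    "((\<lambda>y. sin (\<theta> y)) has_derivative (\<lambda>u. d\<theta> u * cos (\<theta> x))) (at x)"
    using th by (auto intro!: derivative_eq_intros)
  have p: "((\<lambda>y. p0 y [v, w, z]) has_derivative ?p) (at x)" by (rule p0_diff)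
  have c: "((\<lambda>y. chi y [v, w, z]) has_derivative ?c) (at x)"
    by (rule frechet_works) (use chi_deriv[of v w z] in \<open>unfold differentiable_def, blast\<close>)
  have d: "fd (\<lambda>y. psip y [v, w, z]) x u
      = (cos (\<theta> x) * ?p u + d\<theta> u * - sin (\<theta> x) * p0 x [v, w, z])
        + (sin (\<theta> x) * ?c u + d\<theta> u * cos (\<theta> x) * chi x [v, w, z])"
    "fd (\<lambda>y. psim y [v, w, z]) x u
      = (sin (\<theta> x) * ?p u + d\<theta> u * cos (\<theta> x) * p0 x [v, w, z])
        - (cos (\<theta> x) * ?c u + d\<theta> u * - sin (\<theta> x) * chi x [v, w, z])"
    using fun_cong[OF frechet_derivative_at[OF has_derivative_add[OF has_derivative_mult[OF cs(1) p]
          has_derivative_mult[OF cs(2) c]], symmetric], of u]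
      fun_cong[OF frechet_derivative_at[OF has_derivative_diff[OF has_derivative_mult[OF cs(2) p]
          has_derivative_mult[OF cs(1) c]], symmetric], of u] .
  have "cov_deriv (conn \<eta>) psip x u [v, w, z] = cos (\<theta> x) * cov_deriv (conn \<eta>) p0 x u [v, w, z]
      + sin (\<theta> x) * cov_deriv (conn \<eta>) chi x u [v, w, z]
      - d\<theta> u * sin (\<theta> x) * p0 x [v, w, z] + d\<theta> u * cos (\<theta> x) * chi x [v, w, z]"
    unfolding cov_deriv_3 d by (simp add: algebra_simps)
  then show "cov_deriv (conn \<eta>) psip x u [v, w, z] = - (d\<theta> u + 3 * \<eta> (J x u)) * psim x [v, w, z]"
    unfolding conn_p0 conn_chi by (simp add: phi_tangent algebra_simps)
  have "cov_deriv (conn \<eta>) psim x u [v, w, z] = sin (\<theta> x) * cov_deriv (conn \<eta>) p0 x u [v, w, z]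
      - cos (\<theta> x) * cov_deriv (conn \<eta>) chi x u [v, w, z]
      + d\<theta> u * cos (\<theta> x) * p0 x [v, w, z] + d\<theta> u * sin (\<theta> x) * chi x [v, w, z]"
    unfolding cov_deriv_3 d by (simp add: algebra_simps)
  then show "cov_deriv (conn \<eta>) psim x u [v, w, z] = (d\<theta> u + 3 * \<eta> (J x u)) * psip x [v, w, z]"
    unfolding conn_p0 conn_chi by (simp add: phi_tangent algebra_simps)
qed

text \<open>Needed to conclude from \<open>conn_psi\<close> that the rotation coefficient itself is
  zero. If \<open>psim\<close> vanished, \<open>Q_inj\<close> would give a linear relation between a
  unit vector and its orthogonal image under \<open>J\<close>, with coefficients sine and
  cosine.\<close>

lemma psim_nonzero: "\<exists>v w z. psim x [v, w, z] \<noteq> 0"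
proof (rule ccontr)
  assume "\<not> ?thesis"
  then have *: "ip (Q (sin (\<theta> x) *\<^sub>R v - cos (\<theta> x) *\<^sub>R J x v) w) z = ip (Q 0 w) z" for v w z
    by (simp add: phi_tangent)
  obtain v where v: "gM x [v, v] = 1" using M.exists_orthogonal[of "{}"] by auto
  have "sin (\<theta> x) *\<^sub>R v - cos (\<theta> x) *\<^sub>R J x v = 0" by (rule alg.Q_inj) (rule *)
  then have "gM x [sin (\<theta> x) *\<^sub>R v - cos (\<theta> x) *\<^sub>R J x v, v] = 0"
    "gM x [sin (\<theta> x) *\<^sub>R v - cos (\<theta> x) *\<^sub>R J x v, J x v] = 0"
    by (simp_all only: M.ip_simps)
  then have "sin (\<theta> x) = 0" "cos (\<theta> x) = 0" using v by simp_all
  then show False using sin_cos_squared_add[of "\<theta> x"] by simp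
qed

lemma eta_eq: "(THE \<eta>. linear \<eta> \<and>
     (\<forall>u v w. cov_deriv (conn \<eta>) omega x u [v, w] = 0) \<and>
     (\<forall>u v w z. cov_deriv (conn \<eta>) psip x u [v, w, z] = 0) \<and>
     (\<forall>u v w z. cov_deriv (conn \<eta>) psim x u [v, w, z] = 0)) = (\<lambda>v. d\<theta> (J x v) / 3)"
proof (rule the_equality)
  have l: "linear d\<theta>" by (rule has_derivative_linear[OF frechet_works[OF \<theta>]])
  have "linear (\<lambda>v. d\<theta> (J x v) / 3)"
    by (intro linearI) (simp_all add: linear_rules[OF l] add_divide_distrib)
  then show "linear (\<lambda>v. d\<theta> (J x v) / 3) \<and>
     (\<forall>u v w. cov_deriv (conn (\<lambda>v. d\<theta> (J x v) / 3)) omega x u [v, w] = 0) \<and>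
     (\<forall>u v w z. cov_deriv (conn (\<lambda>v. d\<theta> (J x v) / 3)) psip x u [v, w, z] = 0) \<and>
     (\<forall>u v w z. cov_deriv (conn (\<lambda>v. d\<theta> (J x v) / 3)) psim x u [v, w, z] = 0)"
    unfolding conn_omega conn_psi by (simp add: linear_neg[OF l])
next
  fix \<eta> assume \<eta>: "linear \<eta> \<and> (\<forall>u v w. cov_deriv (conn \<eta>) omega x u [v, w] = 0) \<and>
     (\<forall>u v w z. cov_deriv (conn \<eta>) psip x u [v, w, z] = 0) \<and>
     (\<forall>u v w z. cov_deriv (conn \<eta>) psim x u [v, w, z] = 0)"
  obtain p q r where nz: "psim x [p, q, r] \<noteq> 0" using psim_nonzero by blast
  have "cov_deriv (conn \<eta>) psip x u [p, q, r] = 0" for u using \<eta> by blast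
  then have "d\<theta> u + 3 * \<eta> (J x u) = 0" for u
    using nz unfolding conn_psi mult_eq_0_iff neg_equal_0_iff_equal by blast
  \<comment> \<open>As \<open>J\<close> squares to minus the identity, evaluating at
    \<open>J x v\<close> solves for \<eta>.\<close>
  from this[of "J x v" for v] have "d\<theta> (J x v) + 3 * \<eta> (- v) = 0" for v by simp
  then show "\<eta> = (\<lambda>v. d\<theta> (J x v) / 3)"
    using linear_neg[OF conjunct1[OF \<eta>]] by (intro ext) (simp add: field_simps)
qed

lemma eta_zero_iff: "(\<forall>v. d\<theta> (J x v) / 3 = 0) \<longleftrightarrow> (\<forall>v. d\<theta> v = 0)"
proof
  assume *: "\<forall>v. d\<theta> (J x v) / 3 = 0"
  show "\<forall>v. d\<theta> v = 0"
  proof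
    show "d\<theta> v = 0" for v using *[rule_format, of "- J x v"] by simp
  qed
qed simp

end

end

section \<open>The exterior derivative, and behaviour under change of charts\<close>

lemma Ck_on_mono: "Ck_on k S f \<Longrightarrow> T \<subseteq> S \<Longrightarrow> Ck_on k T f"
  by (induction k arbitrary: f) (auto intro: continuous_on_subset)

lemma smooth_on_differentiable: "smooth_on S f \<Longrightarrow> x \<in> S \<Longrightarrow> f differentiable (at x)"
proof -
  assume "smooth_on S f" "x \<in> S"
  then have "Ck_on (Suc 0) S f" by (simp only: smooth_on_def)
  then show "f differentiable (at x)" using \<open>x \<in> S\<close> by simp
qed

lemma (in g2_alg) assoc_form_nonzero: "\<exists>x y z w. assoc_form x y z w \<noteq> 0"
proof (rule ccontr)
  assume "\<not> ?thesis"
  then have 0: "assoc_form x y z w = 0" for x y z w by blast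
  obtain e where e: "frame e" by (rule frame_exists)
  have "ip (e 0) (e 0) = 0" using assoc_form_contract[OF e, of "e 0" "e 0"] by (simp add: 0)
  then show False using e by (simp add: frame_def)
qed

text \<open>The Christoffel terms cancel in pairs, because \<open>LC\<close> is symmetric and \<phi>
  is skew.\<close>

lemma (in g2_at) ext_deriv_nabla:
  "ext_deriv \<phi> x [a, b, c, d] = nabla a [b, c, d] - nabla b [a, c, d] + nabla c [a, b, d] - nabla d [a, b, c]"
proof -
  have skew: "\<phi> x [p, r, q] = - \<phi> x [p, q, r]" "\<phi> x [q, p, r] = - \<phi> x [p, q, r]" for p q r
    unfolding g2.ip_prod[symmetric] by (rule g2.triple_skew) (simp add: g2.P_skew[of q p])
  have s: "{..<length [a, b, c, d]} = {0, 1, 2, 3::nat}" by auto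
  have "ext_deriv \<phi> x [a, b, c, d] = fd (\<lambda>y. \<phi> y [b, c, d]) x a
      - fd (\<lambda>y. \<phi> y [a, c, d]) x b
      + fd (\<lambda>y. \<phi> y [a, b, d]) x c
      - fd (\<lambda>y. \<phi> y [a, b, c]) x d"
    unfolding ext_deriv_def s by (simp add: numeral_2_eq_2 numeral_3_eq_3)
  then show ?thesis
    unfolding nabla_apply
    using levi_civita_sym[of a b] levi_civita_sym[of a c] levi_civita_sym[of a d]
      levi_civita_sym[of b c] levi_civita_sym[of b d] levi_civita_sym[of c d]
      skew(2)[of "LC a b" c d] skew(2)[of "LC a c" b d] skew(1)[of b "LC a c" d] skew(1)[of b "LC a d" c]
      skew(1)[of c "LC a d" b] skew(2)[of "LC b c" a d] skew(1)[of a "LC b c" d] skew(1)[of a "LC b d" c]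
      skew(2)[of "LC a d" b c] skew(1)[of a "LC c d" b] skew(2)[of "LC b d" a c]
    by simp
qed

text \<open>The choice of frame in \<open>star_phi\<close> hides its tensorial nature. A linear map
  that respects \<open>g\<close> and \<phi> is injective, hence bijective, and so respects the
  product through which \<open>star_phi\<close> is expressed.\<close>

lemma star_phi_transport:
  assumes g: "g2_tensor g \<phi> e" and g': "g2_tensor g' \<phi>' e'" and L: "linear L"
    and gL: "\<And>u v. g [u, v] = g' [L u, L v]"
    and \<phi>L: "\<And>u v w. \<phi> [u, v, w] = \<phi>' [L u, L v, L w]"
  shows "star_phi g \<phi> [x, y, z, w] = star_phi g' \<phi>' [L x, L y, L z, L w]"
proof -
  interpret G: g2_tensor g \<phi> e by (rule g)
  interpret G': g2_tensor g' \<phi>' e' by (rule g')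
  have "v = 0" if "L v = 0" for v
    using G.ip_eq_0_iff[of v] that by (simp add: gL)
  then have "inj L" using L by (simp add: linear_injective_0)
  then have surj: "surj L" using L linear_injective_imp_surjective by blast
  have prod: "L (G.prod u v) = G'.prod (L u) (L v)" for u v
  proof (rule G'.ip_nondegenerate)
    fix t
    obtain t' where t: "t = L t'" using surj by auto
    show "g' [L (G.prod u v), t] = g' [G'.prod (L u) (L v), t]"
      unfolding t G'.ip_prod by (simp add: G.ip_prod \<phi>L flip: gL)
  qed
  show ?thesis
    unfolding G.star_phi_eq G'.star_phi_eq G.assoc_form_def G'.assoc_form_def prod[symmetric]
    by (simp only: gL)
qed

lemma smooth_atlasD:
  assumes "smooth_atlas A"
  shows "\<exists>c\<in>A. p \<in> fst c" "c \<in> A \<Longrightarrow> open (fst c)" "c \<in> A \<Longrightarrow> open (chart_img c)"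
    "c \<in> A \<Longrightarrow> homeomorphism (fst c) (chart_img c) (snd c) (chart_inv c)"
    "c \<in> A \<Longrightarrow> d \<in> A \<Longrightarrow> smooth_on (snd c ` (fst c \<inter> fst d)) (coord_rep c d (\<lambda>p. p))"
proof -
  note s = assms[unfolded smooth_atlas_def]
  have 1: "(\<Union>c\<in>A. fst c) = UNIV"
    and 2: "\<forall>c\<in>A. open (fst c) \<and> open (chart_img c) \<and>
        homeomorphism (fst c) (chart_img c) (snd c) (chart_inv c)"
    and 3: "\<forall>c\<in>A. \<forall>d\<in>A. smooth_on (snd c ` (fst c \<inter> fst d)) (coord_rep c d (\<lambda>p. p))"
    by (rule conjunct1[OF s] conjunct1[OF conjunct2[OF s]] conjunct2[OF conjunct2[OF s]])+
  have "p \<in> (\<Union>c\<in>A. fst c)" unfolding 1 by simp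
  then show "\<exists>c\<in>A. p \<in> fst c" by (rule UN_E) (rule bexI)
  show "c \<in> A \<Longrightarrow> open (fst c)" "c \<in> A \<Longrightarrow> open (chart_img c)"
    "c \<in> A \<Longrightarrow> homeomorphism (fst c) (chart_img c) (snd c) (chart_inv c)"
    using bspec[OF 2, of c] by blast+
  show "c \<in> A \<Longrightarrow> d \<in> A \<Longrightarrow> smooth_on (snd c ` (fst c \<inter> fst d)) (coord_rep c d (\<lambda>p. p))"
    using bspec[OF bspec[OF 3, of c], of d] by blast
qed

lemma atlas_open_image:
  assumes A: "smooth_atlas A" and c: "c \<in> A" and W: "open W" shows "open (snd c ` (fst c \<inter> W))"
proof -
  have "openin (top_of_set (chart_img c)) (snd c ` (fst c \<inter> W))"
    by (rule homeomorphism_imp_open_map[OF smooth_atlasD(4)[OF A c]]) (use W in \<open>simp add: openin_open_Int\<close>)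
  then show ?thesis by (rule openin_open_trans[OF _ smooth_atlasD(3)[OF A c]])
qed

lemma atlas_inv:
  assumes "smooth_atlas A" "c \<in> A" "p \<in> fst c" shows "chart_inv c (snd c p) = p"
  using homeomorphism_apply1[OF smooth_atlasD(4)[OF assms(1,2)] assms(3)] .

lemma chart_at: assumes "smooth_atlas A" shows "chart_at A p \<in> A" "p \<in> fst (chart_at A p)"
proof -
  have "\<exists>c. c \<in> A \<and> p \<in> fst c" using smooth_atlasD(1)[OF assms] by blast
  from someI_ex[OF this] show "chart_at A p \<in> A" "p \<in> fst (chart_at A p)"
    unfolding chart_at_def by blast+
qed

lemma atlas_transition:
  assumes "smooth_atlas A" "c \<in> A" "c' \<in> A" "p \<in> fst c" "p \<in> fst c'"
  shows "coord_rep c c' (\<lambda>p. p) differentiable (at (snd c p))"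
proof (rule smooth_on_differentiable)
  show "smooth_on (snd c ` (fst c \<inter> fst c')) (coord_rep c c' (\<lambda>p. p))"
    by (rule smooth_atlasD(5)[OF assms(1-3)])
  show "snd c p \<in> snd c ` (fst c \<inter> fst c')" using assms(4,5) by simp
qed

lemma chart_pointsI: "c \<in> A \<Longrightarrow> x \<in> chart_img c \<Longrightarrow> (c, x) \<in> chart_points A"
  by (simp add: chart_points_def)

section \<open>Hypersurfaces of manifolds\<close>

locale g2_hypersurface =
  fixes A :: "('a::{t2_space, second_countable_topology}, 7) chart set"
    and g \<phi> :: "('a, 7) tensor_field"
    and k :: real
    and AM :: "('b::{t2_space, second_countable_topology}, 6) chart set"
    and \<iota> :: "'b \<Rightarrow> 'a"
    and n :: "('b, 'a, 7) field_along"
    and \<theta> :: "'b \<Rightarrow> real"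
  assumes A: "smooth_atlas A" and g: "riemannian_metric A g" and \<phi>: "g2_structure A g \<phi>"
    and X1: "type_X1 A g \<phi>"
    and d\<phi>: "\<forall>(c, x)\<in>chart_points A. \<forall>u v w z.
           ext_deriv (\<phi> c) x [u, v, w, z] = k * star_phi (g c x) (\<phi> c x) [u, v, w, z]"
    and AM: "smooth_atlas AM" and imm: "immersion AM A \<iota>" and nor: "unit_normal_field AM A g \<iota> n"
    and \<theta>: "smooth_fun AM \<theta>"
begin

lemma metric_facts:
  assumes "c \<in> A" "z \<in> chart_img c"
  shows "inner_form (\<lambda>u v. g c z [u, v])" "(\<lambda>z. g c z [u, v]) differentiable (at z)"
    "multilinear 3 (\<phi> c z)" "(\<lambda>z. \<phi> c z [u, v, w]) differentiable (at z)"
proof -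
  have cz: "(c, z) \<in> chart_points A" using assms by (simp add: chart_points_def)
  have tg: "is_tensor_field A 2 g" and pos: "\<forall>(c, x)\<in>chart_points A. (\<forall>u v. g c x [u, v] = g c x [v, u]) \<and>
        (\<forall>v. v \<noteq> 0 \<longrightarrow> g c x [v, v] > 0)"
    by (rule conjunct1[OF g[unfolded riemannian_metric_def]] conjunct2[OF g[unfolded riemannian_metric_def]])+
  have t\<phi>: "is_tensor_field A 3 \<phi>"
    by (rule conjunct1[OF conjunct1[OF \<phi>[unfolded g2_structure_def is_form_def]]])
  have m: "multilinear k (T c z)" "length vs = k \<Longrightarrow> smooth_on (chart_img c) (\<lambda>z. T c z vs)"
    if "is_tensor_field A k T" for k vs and T :: "('a, 7) tensor_field"
  proof -
    have 1: "\<forall>(c, x)\<in>chart_points A. multilinear k (T c x)"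
      and 2: "\<forall>c\<in>A. \<forall>vs. length vs = k \<longrightarrow> smooth_on (chart_img c) (\<lambda>x. T c x vs)"
      using conjunct1[OF that[unfolded is_tensor_field_def]]
        conjunct1[OF conjunct2[OF that[unfolded is_tensor_field_def]]] .
    show "multilinear k (T c z)" using bspec[OF 1 cz] by simp
    show "length vs = k \<Longrightarrow> smooth_on (chart_img c) (\<lambda>z. T c z vs)" using bspec[OF 2 assms(1)] by blast
  qed
  show "multilinear 3 (\<phi> c z)" by (rule m(1)[OF t\<phi>])
  show "inner_form (\<lambda>u v. g c z [u, v])"
    using m(1)[OF tg] bspec[OF pos cz] unfolding inner_form_def bilinear_def multilinear_2_iff by simp
  show "(\<lambda>z. g c z [u, v]) differentiable (at z)" "(\<lambda>z. \<phi> c z [u, v, w]) differentiable (at z)"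
    by (rule smooth_on_differentiable[OF m(2)[OF tg] assms(2)], simp,
        rule smooth_on_differentiable[OF m(2)[OF t\<phi>] assms(2)], simp)
qed

lemma g2_at_exists:
  assumes "c \<in> A" "z \<in> chart_img c"
  shows "\<exists>V e. V \<subseteq> chart_img c \<and> g2_at V (g c) z (\<phi> c) e"
proof -
  have "(c, z) \<in> chart_points A" using assms by (simp add: chart_points_def)
  from bspec[OF conjunct2[OF \<phi>[unfolded g2_structure_def]] this, unfolded case_prod_conv]
  obtain V e where V: "open V" "z \<in> V" "V \<subseteq> chart_img c" "\<And>i. smooth_on V (\<lambda>y. e y i)"
    "\<And>y. y \<in> V \<Longrightarrow> g2_frame (g c y) (\<phi> c y) (e y)" by blast
  have "g2_at V (g c) z (\<phi> c) e"
  proof (intro g2_at.intro metric_at.intro g2_at_axioms.intro)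
    show "(\<lambda>y. e y i) differentiable (at z)" for i by (rule smooth_on_differentiable[OF V(4,2)])
    show "inner_form (\<lambda>u v. g c y [u, v])" "multilinear 3 (\<phi> c y)" "g2_frame (g c y) (\<phi> c y) (e y)"
      if "y \<in> V" for y
      using metric_facts(1,3)[OF assms(1)] V(5) subsetD[OF V(3)] that by auto
  qed (rule V(1) V(2) metric_facts[OF assms])+
  then show ?thesis using V(3) by blast
qed

lemma g2_tensor_exists:
  assumes "c \<in> A" "z \<in> chart_img c" shows "\<exists>e. g2_tensor (g c z) (\<phi> c z) e"
proof -
  obtain V e where "g2_at V (g c) z (\<phi> c) e" using g2_at_exists[OF assms] by blast
  then interpret g2_at V "g c" z "\<phi> c" e .
  show ?thesis using g2.g2_tensor_axioms by blast
qed

text \<open>Type \<open>X1\<close> provides some constant \<open>k'\<close>. Antisymmetrising the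
  covariant derivative over four arguments makes the exterior derivative \<open>k'\<close> times
  \<open>star_phi\<close>, and since \<open>star_phi\<close> is not zero, \<open>k'\<close> is the
  given \<open>k\<close>.\<close>

lemma r_bar_eq:
  assumes "c \<in> A" "z \<in> chart_img c" shows "r_bar g \<phi> c z u v = k / 4 * g c z [u, v]"
    and "cov_deriv (levi_civita (g c) z) (\<phi> c) z u [a, b, d] = k / 4 * star_phi (g c z) (\<phi> c z) [u, a, b, d]"
proof -
  obtain k' where "\<forall>(c, x)\<in>chart_points A. \<forall>u v. r_bar g \<phi> c x u v = k' / 4 * g c x [u, v]"
    using X1 unfolding type_X1_def by blast
  from bspec[OF this chart_pointsI[OF assms]]
  have k': "r_bar g \<phi> c z u v = k' / 4 * g c z [u, v]" for u v by simp
  obtain V e where "g2_at V (g c) z (\<phi> c) e" using g2_at_exists[OF assms] by blast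
  then interpret g2_at V "g c" z "\<phi> c" e .
  have nabla: "nabla u [a, b, d] = k' / 4 * star_phi (g c z) (\<phi> c z) [u, a, b, d]" for u a b d
    by (rule nabla_phi_r_bar) (use k' in \<open>simp add: r_bar_def\<close>)
  obtain p q r s where nz: "g2.assoc_form p q r s \<noteq> 0" using g2.assoc_form_nonzero by blast
  have "k * star_phi (g c z) (\<phi> c z) [p, q, r, s] = ext_deriv (\<phi> c) z [p, q, r, s]"
    using bspec[OF d\<phi> chart_pointsI[OF assms]] by simp
  also have "\<dots> = k' * star_phi (g c z) (\<phi> c z) [p, q, r, s]"
    unfolding ext_deriv_nabla nabla g2.star_phi_eq
    using g2.assoc_form_skew(1)[of q p r s] g2.assoc_form_skew(1)[of r p q s]
      g2.assoc_form_skew(3)[of p r q s] g2.assoc_form_skew(1)[of s p q r]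
      g2.assoc_form_skew(3)[of p s q r] g2.assoc_form_skew(2)[of p q s r]
    by (simp add: algebra_simps)
  finally have "k = k'" using nz by (simp add: g2.star_phi_eq)
  then show "r_bar g \<phi> c z u v = k / 4 * g c z [u, v]"
    "cov_deriv (levi_civita (g c) z) (\<phi> c) z u [a, b, d] = k / 4 * star_phi (g c z) (\<phi> c z) [u, a, b, d]"
    using k' nabla by auto
qed

lemma type_P_iff: "type_P A g \<phi> \<longleftrightarrow> k = 0"
proof
  assume "k = 0"
  then show "type_P A g \<phi>" using r_bar_eq(1) by (auto simp: type_P_def chart_points_def)
next
  assume P: "type_P A g \<phi>"
  \<comment> \<open>Types are inhabited, so there is a point at which to test.\<close>
  obtain p :: 'a where True by simp
  obtain c where c: "c \<in> A" "p \<in> fst c" using smooth_atlasD(1)[OF A] by blast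
  then have z: "snd c p \<in> chart_img c" by blast
  interpret inner_form "\<lambda>u v. g c (snd c p) [u, v]" by (rule metric_facts(1)[OF c(1) z])
  obtain v where v: "g c (snd c p) [v, v] = 1" using exists_orthogonal[of "{}"] by auto
  have "r_bar g \<phi> c (snd c p) v v = 0"
    using bspec[OF P[unfolded type_P_def] chart_pointsI[OF c(1) z]] by simp
  then show "k = 0" using r_bar_eq(1)[OF c(1) z, of v v] v by simp
qed

section \<open>Hypersurface data in a fixed pair of charts\<close>

context
  fixes d :: "('b, 6) chart" and c :: "('a, 7) chart"
  assumes d: "d \<in> AM" and c: "c \<in> A"
begin

definition "overlap = snd d ` (fst d \<inter> \<iota> -` fst c)"
abbreviation "F \<equiv> coord_rep d c \<iota>"

lemma open_overlap: "open overlap"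
proof -
  have "continuous_on UNIV \<iota>" using imm unfolding immersion_def by blast
  then have "open (\<iota> -` fst c)" using smooth_atlasD(2)[OF A c] by (simp add: open_vimage)
  then show ?thesis unfolding overlap_def by (rule atlas_open_image[OF AM d])
qed

lemma overlap:
  assumes "y \<in> overlap"
  shows "chart_inv d y \<in> fst d" "\<iota> (chart_inv d y) \<in> fst c" "snd d (chart_inv d y) = y"
    "F y = snd c (\<iota> (chart_inv d y))" "F y \<in> chart_img c" "y \<in> chart_img d"
proof -
  obtain q where q: "q \<in> fst d" "\<iota> q \<in> fst c" "y = snd d q" using assms unfolding overlap_def by auto
  have "chart_inv d y = q" unfolding q(3) by (rule atlas_inv[OF AM d q(1)])
  with q show "chart_inv d y \<in> fst d" "\<iota> (chart_inv d y) \<in> fst c" "snd d (chart_inv d y) = y"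
    "F y = snd c (\<iota> (chart_inv d y))" "F y \<in> chart_img c" "y \<in> chart_img d"
    by (auto simp: coord_rep_def)
qed

lemma in_overlapI: "y \<in> chart_img d \<Longrightarrow> \<iota> (chart_inv d y) \<in> fst c \<Longrightarrow> y \<in> overlap"
  unfolding overlap_def using atlas_inv[OF AM d] by auto

lemma F_smooth: "smooth_on overlap F" and F_inj: "y \<in> overlap \<Longrightarrow> inj (fd F y)"
proof -
  note i = bspec[OF bspec[OF conjunct2[OF imm[unfolded immersion_def]] d] c, folded overlap_def]
  show "smooth_on overlap F" by (rule conjunct1[OF i])
  show "y \<in> overlap \<Longrightarrow> inj (fd F y)" by (rule bspec[OF conjunct2[OF i]])
qed

lemma F_deriv: "y \<in> overlap \<Longrightarrow> (F has_derivative fd F y) (at y)"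
  by (rule frechet_works[OF smooth_on_differentiable[OF F_smooth]])

lemma N_smooth: "smooth_on overlap (\<lambda>y. n c (chart_inv d y))"
  using bspec[OF bspec[OF conjunct1[OF conjunct1[OF nor[unfolded unit_normal_field_def
    is_field_along_def]]] d] c, folded overlap_def] .

lemma N_unit: "y \<in> overlap \<Longrightarrow> g c (F y) [n c (chart_inv d y), n c (chart_inv d y)] = 1"
  and N_orth: "y \<in> overlap \<Longrightarrow> g c (F y) [fd F y v, n c (chart_inv d y)] = 0"
proof -
  assume y: "y \<in> overlap"
  note p = overlap[OF y]
  have q: "chart_inv d y \<in> fst d \<inter> \<iota> -` fst c" using p by simp
  show "g c (F y) [n c (chart_inv d y), n c (chart_inv d y)] = 1"
    "g c (F y) [fd F y v, n c (chart_inv d y)] = 0"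
    using bspec[OF bspec[OF bspec[OF conjunct2[OF nor[unfolded unit_normal_field_def]] d] c] q]
    unfolding p(3) p(4)[symmetric] by blast+
qed

lemma cross_exists:
  assumes y: "y \<in> overlap"
  shows "\<exists>w. fd F y w
      = cross_prod (g c (F y)) (\<phi> c (F y)) (n c (chart_inv d y)) (fd F y v)" (is ?ex)
    and "g c (F y) [cross_prod (g c (F y)) (\<phi> c (F y)) X Y, Z] = \<phi> c (F y) [X, Y, Z]"
proof -
  obtain e where "g2_tensor (g c (F y)) (\<phi> c (F y)) e"
    using g2_tensor_exists[OF c overlap(5)[OF y]] by blast
  then interpret g2_tensor "g c (F y)" "\<phi> c (F y)" e .
  show ?ex
    unfolding cross_prod_eq
    by (rule hyperplane_image[OF has_derivative_linear[OF F_deriv[OF y]] F_inj[OF y] _ N_unit[OF y] N_orth[OF y]])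
      simp_all
  show "g c (F y) [cross_prod (g c (F y)) (\<phi> c (F y)) X Y, Z] = \<phi> c (F y) [X, Y, Z]"
    unfolding cross_prod_eq by (rule ip_prod)
qed

lemma change_chart:
  assumes y: "y \<in> overlap" and c': "c' \<in> A" "\<iota> (chart_inv d y) \<in> fst c'"
  shows "coord_rep d c' \<iota> y = coord_rep c c' (\<lambda>p. p) (F y)" (is ?val)
    and "fd (coord_rep d c' \<iota>) y
      = (\<lambda>v. fd (coord_rep c c' (\<lambda>p. p)) (F y) (fd F y v))" (is ?der)
    and "n c' (chart_inv d y)
      = fd (coord_rep c c' (\<lambda>p. p)) (F y) (n c (chart_inv d y))" (is ?nor)
    and "F y \<in> snd c ` (fst c \<inter> fst c')" (is ?mem)
proof -
  have val: "coord_rep c c' (\<lambda>p. p) (F z) = coord_rep d c' \<iota> z" if "z \<in> overlap" for z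
    unfolding overlap(4)[OF that]
    by (simp add: coord_rep_def atlas_inv[OF A c overlap(2)[OF that]])
  show ?val using val[OF y] by simp
  show ?mem unfolding overlap(4)[OF y] using overlap(2)[OF y] c'(2) by blast
  have "coord_rep c c' (\<lambda>p. p) differentiable (at (F y))"
    unfolding overlap(4)[OF y] by (rule atlas_transition[OF A c c'(1) overlap(2)[OF y] c'(2)])
  from has_derivative_compose[OF F_deriv[OF y] frechet_works[OF this]]
  have "(coord_rep d c' \<iota> has_derivative
      (\<lambda>v. fd (coord_rep c c' (\<lambda>p. p)) (F y) (fd F y v))) (at y)"
    by (rule has_derivative_on_open_cong[OF _ open_overlap y val])
  then show ?der by (rule frechet_derivative_at[symmetric])
  have "\<forall>c\<in>A. \<forall>c'\<in>A. \<forall>p\<in>\<iota> -` (fst c \<inter> fst c').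
        n c' p = fd (coord_rep c c' (\<lambda>q. q)) (snd c (\<iota> p)) (n c p)"
    by (rule conjunct2[OF conjunct1[OF nor[unfolded unit_normal_field_def is_field_along_def]]])
  from bspec[OF bspec[OF bspec[OF this c] c'(1)], of "chart_inv d y"]
  show ?nor using overlap(2)[OF y] c'(2) unfolding overlap(4)[OF y] by simp
qed

end

lemma tensor_law:
  assumes "is_tensor_field A m T" "c \<in> A" "c' \<in> A" "z \<in> snd c ` (fst c \<inter> fst c')" "length vs = m"
  shows "T c z vs = T c' (coord_rep c c' (\<lambda>p. p) z)
    (map (fd (coord_rep c c' (\<lambda>p. p)) z) vs)"
  using bspec[OF bspec[OF bspec[OF conjunct2[OF conjunct2[OF assms(1)[unfolded is_tensor_field_def]]]
    assms(2)] assms(3)] assms(4)] assms(5) by blast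

lemma is_tensor_field_g: "is_tensor_field A 2 g" and is_tensor_field_phi: "is_tensor_field A 3 \<phi>"
  by (rule conjunct1[OF g[unfolded riemannian_metric_def]],
      rule conjunct1[OF conjunct1[OF \<phi>[unfolded g2_structure_def is_form_def]]])

lemma star_law:
  assumes c: "c \<in> A" "c' \<in> A" and z: "z \<in> snd c ` (fst c \<inter> fst c')"
  defines "D \<equiv> fd (coord_rep c c' (\<lambda>p. p)) z"
  shows "star_phi (g c z) (\<phi> c z) [u, v, w, t]
    = star_phi (g c' (coord_rep c c' (\<lambda>p. p) z)) (\<phi> c' (coord_rep c c' (\<lambda>p. p) z)) [D u, D v, D w, D t]"
proof -
  obtain p where p: "z = snd c p" "p \<in> fst c" "p \<in> fst c'" using z by blast
  have z': "coord_rep c c' (\<lambda>p. p) z \<in> chart_img c'"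
    using p by (simp add: coord_rep_def atlas_inv[OF A c(1)])
  have zc: "z \<in> chart_img c" using p by blast
  obtain e e' where "g2_tensor (g c z) (\<phi> c z) e"
    "g2_tensor (g c' (coord_rep c c' (\<lambda>p. p) z)) (\<phi> c' (coord_rep c c' (\<lambda>p. p) z)) e'"
    using g2_tensor_exists[OF c(1) zc] g2_tensor_exists[OF c(2) z'] by blast
  then show ?thesis
  proof (rule star_phi_transport)
    have "coord_rep c c' (\<lambda>p. p) differentiable (at z)"
      unfolding p(1) by (rule atlas_transition[OF A c p(2,3)])
    then show "linear D" unfolding D_def by (intro has_derivative_linear[OF frechet_works])
    show "g c z [u, v] = g c' (coord_rep c c' (\<lambda>p. p) z) [D u, D v]" for u v
      using tensor_law[OF is_tensor_field_g c z, of "[u, v]"] by (simp add: D_def)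
    show "\<phi> c z [u, v, w] = \<phi> c' (coord_rep c c' (\<lambda>p. p) z) [D u, D v, D w]" for u v w
      using tensor_law[OF is_tensor_field_phi c z, of "[u, v, w]"] by (simp add: D_def)
  qed
qed

section \<open>Independence of the chart picked at each point\<close>

context
  fixes d :: "('b, 6) chart" and c :: "('a, 7) chart" and y
  assumes d: "d \<in> AM" and c: "c \<in> A" and y: "y \<in> overlap d c"
begin

abbreviation (input) "p \<equiv> chart_inv d y"
abbreviation (input) "c' \<equiv> chart_at A (\<iota> p)"
abbreviation (input) "dF \<equiv> fd (coord_rep d c \<iota>) y"

lemma y': "y \<in> overlap d c'"
  by (rule in_overlapI[OF d chart_at(1)[OF A] overlap(6)[OF d c y] chart_at(2)[OF A]])

lemmas chg = change_chart[OF d c y chart_at[OF A]]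

text \<open>The chart picked by \<open>pullback\<close> may jump between nearby points; only the
  expression in a fixed chart \<open>c\<close> is visibly differentiable.\<close>

lemma pullback_eq:
  assumes "is_tensor_field A m T" "length vs = m"
  shows "pullback A \<iota> T d y vs = T c (coord_rep d c \<iota> y) (map dF vs)"
proof -
  have "T c (coord_rep d c \<iota> y) (map dF vs) = T c' (coord_rep d c' \<iota> y)
      (map (fd (coord_rep c c' (\<lambda>p. p)) (coord_rep d c \<iota> y)) (map dF vs))"
    unfolding chg(1) by (rule tensor_law[OF assms(1) c chart_at(1)[OF A] chg(4)]) (simp add: assms(2))
  then show ?thesis by (simp add: pullback_def Let_def chg(2) o_def)
qed

lemma pullback_star_eq:
  "pullback_contr A \<iota> n (\<lambda>c z. star_phi (g c z) (\<phi> c z)) d y [u, v, w]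
    = star_phi (g c (coord_rep d c \<iota> y)) (\<phi> c (coord_rep d c \<iota> y)) [n c p, dF u, dF v, dF w]"
  unfolding star_law[OF c chart_at(1)[OF A] chg(4)]
  by (simp add: pullback_contr_def Let_def chg)

text \<open>Stated after pairing with the metric, since in this form the transformation law of
  \<phi> carries it to the fixed chart and \<open>hypersurface_at\<close> can use it.\<close>

lemma induced_I_eq:
  "pullback A \<iota> g d y [induced_I A g \<phi> \<iota> n d y v, u] = \<phi> c (coord_rep d c \<iota> y) [n c p, dF v, dF u]"
proof -
  let ?F' = "coord_rep d c' \<iota>"
  let ?dF' = "fd ?F' y"
  let ?X = "cross_prod (g c' (?F' y)) (\<phi> c' (?F' y)) (n c' p) (?dF' v)"
  have inj: "inj ?dF'" by (rule F_inj[OF d chart_at(1)[OF A] y'])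
  obtain w where w: "?dF' w = ?X" using cross_exists(1)[OF d chart_at(1)[OF A] y'] by blast
  have "induced_I A g \<phi> \<iota> n d y v = w"
    unfolding induced_I_def Let_def
    by (rule the_equality, rule w, rule injD[OF inj], simp only: w)
  then have "pullback A \<iota> g d y [induced_I A g \<phi> \<iota> n d y v, u] = g c' (?F' y) [?X, ?dF' u]"
    by (simp add: pullback_def Let_def w)
  also have "\<dots> = \<phi> c' (?F' y) [n c' p, ?dF' v, ?dF' u]"
    by (rule cross_exists(2)[OF d chart_at(1)[OF A] y'])
  also have "\<dots> = \<phi> c (coord_rep d c \<iota> y) [n c p, dF v, dF u]"
    using tensor_law[OF is_tensor_field_phi c chart_at(1)[OF A] chg(4), of "[n c p, dF v, dF u]"]
    by (simp add: chg)
  finally show ?thesis .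
qed

end

lemma hypersurface_at_point:
  assumes d: "d \<in> AM" and c: "c \<in> A" and x: "x \<in> overlap d c"
  shows "\<exists>V e U. U \<subseteq> overlap d c \<and> V \<subseteq> chart_img c \<and> hypersurface_at V (g c) (\<phi> c) e (coord_rep d c \<iota>) x U
    (\<lambda>y. n c (chart_inv d y)) (pullback A \<iota> g d) (induced_I A g \<phi> \<iota> n d) k"
proof -
  let ?F = "coord_rep d c \<iota>"
  obtain V e where V: "V \<subseteq> chart_img c" and g2: "g2_at V (g c) (?F x) (\<phi> c) e"
    using g2_at_exists[OF c overlap(5)[OF d c x]] by blast
  interpret g2_at V "g c" "?F x" "\<phi> c" e by (rule g2)
  have cont: "continuous_on (overlap d c) ?F"
    using F_smooth[OF d c] unfolding smooth_on_def by (metis Ck_on.simps(1))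
  \<comment> \<open>The overlap is shrunk so that its image lies in the domain of the adapted frame
    field.\<close>
  define U where "U = overlap d c \<inter> ?F -` V"
  have U: "open U" "x \<in> U" "U \<subseteq> overlap d c" "\<And>y. y \<in> U \<Longrightarrow> ?F y \<in> V"
    using continuous_open_preimage[OF cont open_overlap[OF d c] S(1)] x S(2) by (auto simp: U_def)
  have in_o: "y \<in> overlap d c" if "y \<in> U" for y using that U(3) by blast
  have "hypersurface_at V (g c) (\<phi> c) e ?F x U (\<lambda>y. n c (chart_inv d y)) (pullback A \<iota> g d)
      (induced_I A g \<phi> \<iota> n d) k"
  proof (intro hypersurface_at.intro hypersurface_at_axioms.intro)
    show "g2_at V (g c) (?F x) (\<phi> c) e" by (rule g2)
    show "open U" "x \<in> U" by (rule U)+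
    show "?F y \<in> V" if "y \<in> U" for y by (rule U(4)[OF that])
    show "Ck_on 2 U ?F"
      using Ck_on_mono[OF _ U(3)] F_smooth[OF d c] unfolding smooth_on_def by blast
    show "inj (fd ?F y)" if "y \<in> U" for y by (rule F_inj[OF d c in_o[OF that]])
    show "(\<lambda>y. n c (chart_inv d y)) differentiable (at x)"
      by (rule smooth_on_differentiable[OF N_smooth[OF d c] x])
    show "g c (?F y) [n c (chart_inv d y), n c (chart_inv d y)] = 1" if "y \<in> U" for y
      by (rule N_unit[OF d c in_o[OF that]])
    show "g c (?F y) [fd ?F y v, n c (chart_inv d y)] = 0" if "y \<in> U" for y v
      by (rule N_orth[OF d c in_o[OF that]])
    show "pullback A \<iota> g d y [u, v]
        = g c (?F y) [fd ?F y u, fd ?F y v]" if "y \<in> U" for y u v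
      using pullback_eq[OF d c in_o[OF that] is_tensor_field_g, of "[u, v]"] by simp
    show "pullback A \<iota> g d y [induced_I A g \<phi> \<iota> n d y u, v] = \<phi> c (?F y)
        [n c (chart_inv d y), fd ?F y u, fd ?F y v]"
      if "y \<in> U" for y u v
      by (rule induced_I_eq[OF d c in_o[OF that]])
    show "nabla u [a, b, t] = k / 4 * star_phi (g c (?F x)) (\<phi> c (?F x)) [u, a, b, t]" for u a b t
      by (rule r_bar_eq(2)[OF c overlap(5)[OF d c x]])
  qed
  then show ?thesis using U(3) V by blast
qed

section \<open>Pointwise conditions for the classes\<close>

abbreviation "gM \<equiv> pullback A \<iota> g"
abbreviation "I \<equiv> induced_I A g \<phi> \<iota> n"
abbreviation "B \<equiv> second_fundamental_form A g \<iota> n"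
abbreviation "h \<equiv> mean_curvature A g \<iota> n"
abbreviation "\<Theta> d x \<equiv> \<theta> (chart_inv d x)"

definition "component_type U d x \<longleftrightarrow>
  (\<exists>f. gh_components (gM d x) (I d x) (induced_psi_plus A g \<phi> \<iota> n \<theta> d x) (nabla_omega gM I d x) f \<and>
     (\<forall>w\<in>{W1p, W1m, W2p, W2m, W3, W4} - U. \<forall>x y z. f w [x, y, z] = 0))"

text \<open>Each of \<open>w1p\<close> to \<open>w5\<close> is the condition under which the
  component in the class of that name vanishes, so a type demands the conditions of the classes it
  omits.\<close>

definition "w1p d x \<longleftrightarrow> 4 * h d x * cos (\<Theta> d x) = k * sin (\<Theta> d x)"
definition "w1m d x \<longleftrightarrow> - 4 * h d x * sin (\<Theta> d x) = k * cos (\<Theta> d x)"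
definition "w2p d x \<longleftrightarrow> (\<forall>u v. cos (\<Theta> d x) * (B d x u v + B d x (I d x u) (I d x v))
  = 2 * h d x * cos (\<Theta> d x) * gM d x [u, v])"
definition "w2m d x \<longleftrightarrow> (\<forall>u v. sin (\<Theta> d x) * (B d x u v + B d x (I d x u) (I d x v))
  = 2 * h d x * sin (\<Theta> d x) * gM d x [u, v])"
definition "w3 d x \<longleftrightarrow> (\<forall>u v. B d x (I d x u) (I d x v) = B d x u v)"
definition "w5 d x \<longleftrightarrow> (\<forall>v. differential \<theta> d x v = 0)"

lemmas w_defs = w1p_def w1m_def w2p_def w2m_def w3_def w5_def

lemma type_at_point:
  assumes dx: "(d, x) \<in> chart_points AM"
  shows "W4 \<notin> U \<Longrightarrow> component_type U d x \<longleftrightarrow>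
      (W1p \<notin> U \<longrightarrow> w1p d x) \<and> (W1m \<notin> U \<longrightarrow> w1m d x) \<and> (W2p \<notin> U \<longrightarrow> w2p d x) \<and>
      (W2m \<notin> U \<longrightarrow> w2m d x) \<and> (W3 \<notin> U \<longrightarrow> w3 d x)"
    and "(\<forall>v. su3_eta gM I (induced_psi_plus A g \<phi> \<iota> n \<theta>) (induced_psi_minus A g \<phi> \<iota> n \<theta>) d x v = 0)
      \<longleftrightarrow> w5 d x"
    and "gM d x [I d x u, I d x v] = gM d x [u, v]"
    and "\<forall>u v. B d x (I d x u) (I d x v) = - B d x u v \<Longrightarrow> h d x = 0"
    and "\<exists>v. gM d x [v, v] = 1"
proof -
  define c where "c = chart_at A (\<iota> (chart_inv d x))"
  have d: "d \<in> AM" and x_img: "x \<in> chart_img d" using dx by (auto simp: chart_points_def)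
  have c: "c \<in> A" unfolding c_def by (rule chart_at(1)[OF A])
  have x: "x \<in> overlap d c"
    by (rule in_overlapI[OF d c x_img]) (unfold c_def, rule chart_at(2)[OF A])
  let ?F = "coord_rep d c \<iota>"
  let ?N = "\<lambda>y. n c (chart_inv d y)"
  obtain V e W where W: "W \<subseteq> overlap d c" and V: "V \<subseteq> chart_img c" and
    "hypersurface_at V (g c) (\<phi> c) e ?F x W ?N (gM d) (I d) k"
    using hypersurface_at_point[OF d c x] by blast
  then interpret H: hypersurface_at V "g c" "\<phi> c" e ?F x W ?N "gM d" "I d" k by blast
  have in_o: "y \<in> overlap d c" if "y \<in> W" for y using that W by blast
  have B_eq: "B d x u v = H.B u v" for u v
    unfolding second_fundamental_form_def Let_def c_def[symmetric] H.B_def H.nabF_def ..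
  then have B: "B d x = H.B" by (simp add: fun_eq_iff)
  have I_push: "H.dF y (I d y a) = cross_prod (g c (?F y)) (\<phi> c (?F y)) (?N y) (H.dF y a)"
    if y: "y \<in> W" for y a
  proof -
    obtain w where w: "H.dF y w = cross_prod (g c (?F y)) (\<phi> c (?F y)) (?N y) (H.dF y a)"
      using cross_exists(1)[OF d c in_o[OF y]] by blast
    have "gM d y [I d y a, u] = gM d y [w, u]" for u
      unfolding H.J[OF y] unfolding H.gM[OF y] w by (rule cross_exists(2)[OF d c in_o[OF y], symmetric])
    then have "I d y a = w" by (rule inner_form.ip_nondegenerate[OF H.M.inner[OF y]])
    then show ?thesis using w by simp
  qed
  \<comment> \<open>The metric corrections vanish on the normal, so contracting
    \<open>star_phi\<close> with it is, up to sign, \<phi> with \<open>I\<close> in the first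
    argument; the induced forms thereby become combinations of \<open>p0\<close> and
    \<open>chi\<close>.\<close>
  have star: "star_phi (g c (?F y)) (\<phi> c (?F y)) [?N y, H.dF y a, H.dF y b, H.dF y r]
      = - \<phi> c (?F y) [H.dF y (I d y a), H.dF y b, H.dF y r]" if y: "y \<in> W" for y a b r
  proof -
    obtain e' where "g2_tensor (g c (?F y)) (\<phi> c (?F y)) e'"
      using g2_tensor_exists[OF c overlap(5)[OF d c in_o[OF y]]] by blast
    then interpret G: g2_tensor "g c (?F y)" "\<phi> c (?F y)" e' .
    have orth: "g c (?F y) [?N y, H.dF y v] = 0" for v
      using H.N_orth[OF y, of v] G.ip_commute by metis
    have "G.assoc_form (?N y) (H.dF y a) (H.dF y b) (H.dF y r)
        = g c (?F y) [G.prod (?N y) (H.dF y a), G.prod (H.dF y b) (H.dF y r)]"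
      unfolding G.assoc_form_def orth by simp
    also have "\<dots> = g c (?F y) [G.prod (G.prod (?N y) (H.dF y a)) (H.dF y b), H.dF y r]"
      by (metis G.triple_cycle G.ip_commute)
    finally show ?thesis
      unfolding G.star_phi_eq I_push[OF y] G.cross_prod_eq G.ip_prod[symmetric] by simp
  qed
  have psi: "induced_psi_plus A g \<phi> \<iota> n \<theta> d y vs = cos (\<Theta> d y) * H.p0 y vs + sin (\<Theta> d y) * H.chi y vs"
    "induced_psi_minus A g \<phi> \<iota> n \<theta> d y vs = sin (\<Theta> d y) * H.p0 y vs - cos (\<Theta> d y) * H.chi y vs"
    if y: "y \<in> W" and len: "length vs = 3" for y vs
  proof -
    obtain a b r where vs: "vs = [a, b, r]" using len by (auto simp: length_Suc_conv numeral_3_eq_3)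
    have "pullback A \<iota> \<phi> d y [a, b, r] = H.p0 y [a, b, r]"
      by (rule pullback_eq[OF d c in_o[OF y] is_tensor_field_phi]) simp
    moreover have "pullback_contr A \<iota> n (\<lambda>c z. star_phi (g c z) (\<phi> c z)) d y [a, b, r] = - H.chi y [a, b, r]"
      unfolding pullback_star_eq[OF d c in_o[OF y]] star[OF y] by simp
    ultimately show "induced_psi_plus A g \<phi> \<iota> n \<theta> d y vs
        = cos (\<Theta> d y) * H.p0 y vs + sin (\<Theta> d y) * H.chi y vs"
      "induced_psi_minus A g \<phi> \<iota> n \<theta> d y vs = sin (\<Theta> d y) * H.p0 y vs - cos (\<Theta> d y) * H.chi y vs"
      by (simp_all only: vs induced_psi_plus_def induced_psi_minus_def)
  qed
  have h: "h d x = 1 / 6 * trace_form (gM d x) H.B"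
    unfolding mean_curvature_def B ..
  show "component_type U d x \<longleftrightarrow>
      (W1p \<notin> U \<longrightarrow> w1p d x) \<and> (W1m \<notin> U \<longrightarrow> w1m d x) \<and> (W2p \<notin> U \<longrightarrow> w2p d x) \<and>
      (W2m \<notin> U \<longrightarrow> w2m d x) \<and> (W3 \<notin> U \<longrightarrow> w3 d x)" if U: "W4 \<notin> U"
    unfolding component_type_def w_defs B
  proof (rule H.alg.type_iff[OF H.bilinear_B H.B_sym sin_cos_squared_add2 refl _ H.ip_b _ h U])
    show "induced_psi_plus A g \<phi> \<iota> n \<theta> d x [u, v, w]
        = cos (\<Theta> d x) * gM d x [H.Q u v, w] + sin (\<Theta> d x) * gM d x [H.Q (I d x u) v, w]" for u v w
      using psi(1)[OF H.U(2), of "[u, v, w]"] by (simp add: H.phi_tangent del: H.alg.Q_J_left)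
    show "nabla_omega gM I d x [u, v, w] = gM d x [H.Q (H.b u) v, w]" for u v w
      unfolding nabla_omega_def kaehler_form_def[abs_def] using H.nabla_omega_eq by simp
  qed
  have \<theta>d: "\<Theta> d differentiable (at x)"
    using bspec[OF \<theta>[unfolded smooth_fun_def] d] x_img by (rule smooth_on_differentiable)
  have conn: "su3_connection gM I \<eta> d x = H.conn \<eta>" for \<eta>
    by (simp add: fun_eq_iff su3_connection_def H.conn_def)
  \<comment> \<open>The formulas \<open>psi\<close> hold on all of \<open>W\<close>, as a derivative
    at \<open>x\<close> requires.\<close>
  have cov: "cov_deriv (H.conn \<eta>) (induced_psi_plus A g \<phi> \<iota> n \<theta> d) x u [v, w, z]
      = cov_deriv (H.conn \<eta>) (\<lambda>y vs. cos (\<Theta> d y) * H.p0 y vs + sin (\<Theta> d y) * H.chi y vs) x u [v, w, z]"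
    "cov_deriv (H.conn \<eta>) (induced_psi_minus A g \<phi> \<iota> n \<theta> d) x u [v, w, z]
      = cov_deriv (H.conn \<eta>) (\<lambda>y vs. sin (\<Theta> d y) * H.p0 y vs - cos (\<Theta> d y) * H.chi y vs) x u [v, w, z]"
    for \<eta> u v w z
    by (rule cov_deriv_cong[OF H.U], rule psi, assumption, simp)+
  have "su3_eta gM I (induced_psi_plus A g \<phi> \<iota> n \<theta>) (induced_psi_minus A g \<phi> \<iota> n \<theta>) d x
      = (\<lambda>v. fd (\<Theta> d) x (I d x v) / 3)"
    unfolding su3_eta_def conn cov kaehler_form_def[abs_def] by (rule H.eta_eq[OF \<theta>d])
  then show "(\<forall>v. su3_eta gM I (induced_psi_plus A g \<phi> \<iota> n \<theta>) (induced_psi_minus A g \<phi> \<iota> n \<theta>) d x v = 0)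
      \<longleftrightarrow> w5 d x"
    using H.eta_zero_iff[OF \<theta>d] by (simp only: w5_def differential_def)
  show "gM d x [I d x u, I d x v] = gM d x [u, v]" by (rule H.alg.ip_J_J)
  show "\<exists>v. gM d x [v, v] = 1" by (rule H.M.exists_orthogonal[of "{}"]) auto
  show "h d x = 0" if "\<forall>u v. B d x (I d x u) (I d x v) = - B d x u v"
  proof -
    define f where "f = some_frame (gM d x)"
    obtain f' where f': "H.M.frame f'" by (rule H.M.frame_exists)
    have f: "H.M.frame f"
      unfolding f_def some_frame_def inner_form_frame_eq[OF H.M.inner[OF H.U(2)]]
      by (rule someI[of H.M.frame]) (rule f')
    \<comment> \<open>\<open>I B\<close> and \<open>B\<close> have the same trace, so
      \<open>I B = - B\<close> makes that trace its own negative.\<close>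
    have "(\<Sum>i\<in>UNIV. H.B (I d x (f i)) (I d x (f i))) = (\<Sum>i\<in>UNIV. H.B (f i) (f i))"
      by (rule H.M.frame_comp_sum[OF f H.alg.linear_J H.alg.ip_J_J H.bilinear_B])
    then have "(\<Sum>i\<in>UNIV. H.B (f i) (f i)) = 0" using that unfolding B by (simp add: sum_negf)
    then show ?thesis unfolding h trace_form_def f_def by simp
  qed
qed

lemma induced_type_iff:
  "induced_type A g \<phi> AM \<iota> n \<theta> U \<longleftrightarrow> (\<forall>(d, x)\<in>chart_points AM. component_type U d x \<and>
     (W5 \<notin> U \<longrightarrow> w5 d x))"
  unfolding induced_type_def su3_type_def
  using type_at_point(2) by (intro ball_cong refl) (auto simp: component_type_def)

lemma chart_points_nonempty: "\<exists>d x. (d, x) \<in> chart_points AM"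
proof -
  obtain q :: 'b where True by simp
  obtain d where "d \<in> AM" "q \<in> fst d" using smooth_atlasD(1)[OF AM] by blast
  then have "(d, snd d q) \<in> chart_points AM" by (auto simp: chart_points_def)
  then show ?thesis by blast
qed

lemma induced_type_point:
  assumes "W4 \<notin> U"
  shows "induced_type A g \<phi> AM \<iota> n \<theta> U \<longleftrightarrow> (\<forall>(d, x)\<in>chart_points AM.
    (W1p \<notin> U \<longrightarrow> w1p d x) \<and> (W1m \<notin> U \<longrightarrow> w1m d x) \<and> (W2p \<notin> U \<longrightarrow> w2p d x) \<and>
    (W2m \<notin> U \<longrightarrow> w2m d x) \<and> (W3 \<notin> U \<longrightarrow> w3 d x) \<and> (W5 \<notin> U \<longrightarrow> w5 d x))"
  unfolding induced_type_iff
  by (intro ball_cong refl) (clarsimp simp only: type_at_point(1)[OF _ assms] conj_assoc)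

text \<open>The two conditions are a homogeneous linear system for \<open>4 h\<close> and
  \<open>k\<close> with an orthogonal matrix of cosines and sines.\<close>

lemma w1_iff: "w1p d x \<and> w1m d x \<longleftrightarrow> h d x = 0 \<and> k = 0"
proof
  define c s where "c = cos (\<Theta> d x)" and "s = sin (\<Theta> d x)"
  have cs: "c * c + s * s = 1"
    using sin_cos_squared_add2[of "\<Theta> d x"] by (simp add: c_def s_def power2_eq_square)
  assume "w1p d x \<and> w1m d x"
  then have 1: "4 * h d x * c = k * s" and 2: "- 4 * h d x * s = k * c"
    by (simp_all add: w1p_def w1m_def c_def s_def)
  have "4 * h d x = 4 * h d x * (c * c + s * s)" by (simp add: cs)
  also have "\<dots> = (4 * h d x * c) * c - (- 4 * h d x * s) * s" by (simp add: algebra_simps)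
  also have "\<dots> = 0" unfolding 1 2 by (simp add: algebra_simps)
  finally have h0: "h d x = 0" by simp
  have "k = k * (c * c + s * s)" by (simp add: cs)
  also have "\<dots> = (k * c) * c + (k * s) * s" by (simp add: algebra_simps)
  also have "\<dots> = 0" unfolding 1[symmetric] 2[symmetric] h0 by simp
  finally show "h d x = 0 \<and> k = 0" using h0 by simp
qed (unfold w1p_def w1m_def, simp)

text \<open>Cosine and sine never vanish together, so the weights can be cancelled.\<close>

lemma w2_iff: "w2p d x \<and> w2m d x \<longleftrightarrow>
  (\<forall>u v. B d x u v + B d x (I d x u) (I d x v) = 2 * h d x * gM d x [u, v])"
proof -
  have "c * p = 2 * t * c * q \<and> s * p = 2 * t * s * q \<longleftrightarrow> p = 2 * t * q" if "c \<noteq> 0 \<or> s \<noteq> 0"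
    for c s p q t :: real
    using that by auto
  moreover have "cos (\<Theta> d x) \<noteq> 0 \<or> sin (\<Theta> d x) \<noteq> 0"
    using sin_zero_abs_cos_one[of "\<Theta> d x"] by auto
  ultimately show ?thesis unfolding w2p_def w2m_def by metis
qed

text \<open>With \<open>h = 0\<close> the identity of \<open>w2_iff\<close> reads
  \<open>I B = - B\<close>; conversely, \<open>I B = - B\<close> has vanishing trace by
  \<open>type_at_point\<close>.\<close>

lemma minimal_of_anti_invariant:
  assumes dx: "(d, x) \<in> chart_points AM"
  shows "h d x = 0 \<and> w2p d x \<and> w2m d x \<longleftrightarrow> (\<forall>u v. B d x (I d x u) (I d x v) = - B d x u v)"
proof
  assume "h d x = 0 \<and> w2p d x \<and> w2m d x"
  then have "B d x u v + B d x (I d x u) (I d x v) = 0" for u v using w2_iff[of d x] by simp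
  then show "\<forall>u v. B d x (I d x u) (I d x v) = - B d x u v"
    by (simp add: eq_neg_iff_add_eq_0 add.commute)
next
  assume *: "\<forall>u v. B d x (I d x u) (I d x v) = - B d x u v"
  then have "h d x = 0" by (rule type_at_point(4)[OF dx])
  then show "h d x = 0 \<and> w2p d x \<and> w2m d x" using * by (simp add: w2_iff)
qed

text \<open>\<open>w3\<close> makes the two summands in \<open>w2_iff\<close> equal; conversely, a
  multiple of the metric is invariant because \<open>I\<close> is an isometry.\<close>

lemma umbilic_iff:
  assumes dx: "(d, x) \<in> chart_points AM"
  shows "w2p d x \<and> w2m d x \<and> w3 d x \<longleftrightarrow> (\<forall>u v. B d x u v = h d x * gM d x [u, v])"
proof
  assume "w2p d x \<and> w2m d x \<and> w3 d x"
  then have "B d x u v + B d x u v = 2 * h d x * gM d x [u, v]" for u v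
    using w2_iff[of d x] by (simp add: w3_def)
  then show "\<forall>u v. B d x u v = h d x * gM d x [u, v]" by simp
next
  assume "\<forall>u v. B d x u v = h d x * gM d x [u, v]"
  then show "w2p d x \<and> w2m d x \<and> w3 d x"
    unfolding conj_assoc[symmetric] w2_iff w3_def by (simp add: type_at_point(3)[OF dx])
qed

lemma geodesic_iff:
  assumes dx: "(d, x) \<in> chart_points AM"
  shows "h d x = 0 \<and> w2p d x \<and> w2m d x \<and> w3 d x \<longleftrightarrow> (\<forall>u v. B d x u v = 0)"
proof
  assume "h d x = 0 \<and> w2p d x \<and> w2m d x \<and> w3 d x"
  then show "\<forall>u v. B d x u v = 0" using umbilic_iff[OF dx] by simp
next
  assume *: "\<forall>u v. B d x u v = 0"
  then have h0: "h d x = 0" by (intro type_at_point(4)[OF dx]) simp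
  moreover have "w2p d x \<and> w2m d x \<and> w3 d x" using umbilic_iff[OF dx] * h0 by simp
  ultimately show "h d x = 0 \<and> w2p d x \<and> w2m d x \<and> w3 d x" by simp
qed

text \<open>\<open>k\<close> is the same at all points, but moving it out of the quantifier needs
  the hypersurface to have one.\<close>

lemma ball_and_k:
  "(\<forall>(d, x)\<in>chart_points AM. P d x \<and> k = 0) \<longleftrightarrow> (\<forall>(d, x)\<in>chart_points AM. P d x) \<and> k = 0"
  using chart_points_nonempty by fast

end

theorem theorem4p3:
  fixes A :: "('a::{t2_space, second_countable_topology}, 7) chart set"
    and g \<phi> :: "('a, 7) tensor_field"
    and k :: real
    and AM :: "('b::{t2_space, second_countable_topology}, 6) chart set"
    and \<iota> :: "'b \<Rightarrow> 'a"
    and n :: "('b, 'a, 7) field_along"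
    and \<theta> :: "'b \<Rightarrow> real"
  assumes "smooth_atlas A"
    and "riemannian_metric A g"
    and "g2_structure A g \<phi>"
    and "type_X1 A g \<phi>"
    and "\<forall>(c, x)\<in>chart_points A. \<forall>u v w z.
           ext_deriv (\<phi> c) x [u, v, w, z] = k * star_phi (g c x) (\<phi> c x) [u, v, w, z]"
    and "smooth_atlas AM"
    and "immersion AM A \<iota>"
    and "unit_normal_field AM A g \<iota> n"
    and "smooth_fun AM \<theta>"
  shows
    "let gM = pullback A \<iota> g;
         I = induced_I A g \<phi> \<iota> n;
         B = second_fundamental_form A g \<iota> n;
         IB = (\<lambda>d x u v. B d x (I d x u) (I d x v));
         h = mean_curvature A g \<iota> n;
         \<Theta> = (\<lambda>d x. \<theta> (chart_inv d x));
         M_type = induced_type A g \<phi> AM \<iota> n \<theta>;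
         M = chart_points AM;
         theta_constant = (\<forall>(d, x)\<in>M. \<forall>v. differential \<theta> d x v = 0);
         minimal = (\<forall>(d, x)\<in>M. h d x = 0);
         totally_umbilic = (\<forall>(d, x)\<in>M. \<forall>u v. B d x u v = h d x * gM d x [u, v]);
         totally_geodesic = (\<forall>(d, x)\<in>M. \<forall>u v. B d x u v = 0)
     in
       M_type {W1p, W1m, W2p, W2m, W3, W5} \<and>
       (M_type {W1p, W1m, W2p, W2m, W3} \<longleftrightarrow> theta_constant) \<and>
       (M_type {W1p, W1m, W2p, W2m, W5} \<longleftrightarrow>
          (\<forall>(d, x)\<in>M. \<forall>u v. IB d x u v = B d x u v)) \<and>
       (M_type {W1p, W1m, W2p, W3, W5} \<longleftrightarrow>
          (\<forall>(d, x)\<in>M. \<forall>u v. sin (\<Theta> d x) * (B d x u v + IB d x u v)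
             = 2 * h d x * sin (\<Theta> d x) * gM d x [u, v])) \<and>
       (M_type {W1p, W1m, W2m, W3, W5} \<longleftrightarrow>
          (\<forall>(d, x)\<in>M. \<forall>u v. cos (\<Theta> d x) * (B d x u v + IB d x u v)
             = 2 * h d x * cos (\<Theta> d x) * gM d x [u, v])) \<and>
       (M_type {W1p, W2p, W2m, W3, W5} \<longleftrightarrow>
          (\<forall>(d, x)\<in>M. - 4 * h d x * sin (\<Theta> d x) = k * cos (\<Theta> d x))) \<and>
       (M_type {W1m, W2p, W2m, W3, W5} \<longleftrightarrow>
          (\<forall>(d, x)\<in>M. 4 * h d x * cos (\<Theta> d x) = k * sin (\<Theta> d x))) \<and>
       (M_type {W1p, W1m, W3, W5} \<longleftrightarrow>
          (\<forall>(d, x)\<in>M. \<forall>u v. B d x u v + IB d x u v = 2 * h d x * gM d x [u, v])) \<and>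
       (M_type {W2p, W2m, W3, W5} \<longleftrightarrow> minimal \<and> type_P A g \<phi>) \<and>
       (M_type {W1p, W1m, W5} \<longleftrightarrow> totally_umbilic) \<and>
       (M_type {W2p, W2m, W5} \<longleftrightarrow>
          (\<forall>(d, x)\<in>M. \<forall>u v. IB d x u v = B d x u v) \<and> minimal \<and> type_P A g \<phi>) \<and>
       (M_type {W3, W5} \<longleftrightarrow>
          (\<forall>(d, x)\<in>M. \<forall>u v. IB d x u v = - B d x u v) \<and> type_P A g \<phi>) \<and>
       (M_type {W5} \<longleftrightarrow> totally_geodesic \<and> type_P A g \<phi>) \<and>
       (M_type {} \<longleftrightarrow> totally_geodesic \<and> theta_constant \<and> type_P A g \<phi>)"
proof -
  interpret g2_hypersurface A g \<phi> k AM \<iota> n \<theta>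
    using assms by (rule g2_hypersurface.intro)
  have cong: "(\<forall>(d, x)\<in>chart_points AM. P d x) \<longleftrightarrow> (\<forall>(d, x)\<in>chart_points AM. R d x)"
    if "\<And>d x. (d, x) \<in> chart_points AM \<Longrightarrow> P d x \<longleftrightarrow> R d x" for P R
    using that by fast
  have "induced_type A g \<phi> AM \<iota> n \<theta> {W1p, W1m, W2p, W2m, W3, W5}"
    by (simp add: induced_type_point)
  moreover have "induced_type A g \<phi> AM \<iota> n \<theta> {W1p, W1m, W2p, W2m, W3} \<longleftrightarrow>
      (\<forall>(d, x)\<in>chart_points AM. w5 d x)"
    "induced_type A g \<phi> AM \<iota> n \<theta> {W1p, W1m, W2p, W2m, W5} \<longleftrightarrow> (\<forall>(d, x)\<in>chart_points AM. w3 d x)"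
    "induced_type A g \<phi> AM \<iota> n \<theta> {W1p, W1m, W2p, W3, W5} \<longleftrightarrow> (\<forall>(d, x)\<in>chart_points AM. w2m d x)"
    "induced_type A g \<phi> AM \<iota> n \<theta> {W1p, W1m, W2m, W3, W5} \<longleftrightarrow> (\<forall>(d, x)\<in>chart_points AM. w2p d x)"
    "induced_type A g \<phi> AM \<iota> n \<theta> {W1p, W2p, W2m, W3, W5} \<longleftrightarrow> (\<forall>(d, x)\<in>chart_points AM. w1m d x)"
    "induced_type A g \<phi> AM \<iota> n \<theta> {W1m, W2p, W2m, W3, W5} \<longleftrightarrow> (\<forall>(d, x)\<in>chart_points AM. w1p d x)"
    by (simp_all add: induced_type_point)
  moreover have "induced_type A g \<phi> AM \<iota> n \<theta> {W1p, W1m, W3, W5} \<longleftrightarrow>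
      (\<forall>(d, x)\<in>chart_points AM. \<forall>u v. B d x u v + B d x (I d x u) (I d x v) = 2 * h d x * gM d x [u, v])"
    unfolding w2_iff[symmetric] by (simp add: induced_type_point)
  \<comment> \<open>Omitting both \<open>W1\<close> classes means \<open>h = 0\<close> and
    \<open>k = 0\<close> by \<open>w1_iff\<close>, and \<open>k = 0\<close> is type \<open>P\<close>
    by \<open>type_P_iff\<close>.\<close>
  moreover have "induced_type A g \<phi> AM \<iota> n \<theta> {W2p, W2m, W3, W5} \<longleftrightarrow>
      (\<forall>(d, x)\<in>chart_points AM. h d x = 0) \<and> k = 0"
    unfolding ball_and_k[symmetric] w1_iff[symmetric] by (simp add: induced_type_point)
  moreover have "induced_type A g \<phi> AM \<iota> n \<theta> {W1p, W1m, W5} \<longleftrightarrow>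
      (\<forall>(d, x)\<in>chart_points AM. \<forall>u v. B d x u v = h d x * gM d x [u, v])"
    by (simp add: induced_type_point) (intro cong umbilic_iff)
  moreover have "induced_type A g \<phi> AM \<iota> n \<theta> {W2p, W2m, W5} \<longleftrightarrow>
      (\<forall>(d, x)\<in>chart_points AM. w3 d x) \<and> (\<forall>(d, x)\<in>chart_points AM. h d x = 0) \<and> k = 0"
  proof -
    have "induced_type A g \<phi> AM \<iota> n \<theta> {W2p, W2m, W5} \<longleftrightarrow>
        (\<forall>(d, x)\<in>chart_points AM. (w3 d x \<and> h d x = 0) \<and> k = 0)"
      using w1_iff by (simp add: induced_type_point) (intro cong, blast)
    then show ?thesis unfolding ball_and_k by fast
  qed
  \<comment> \<open>Minimality does not appear on the right because
    \<open>minimal_of_anti_invariant\<close> recovers it from \<open>I B = - B\<close>.\<close>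
  moreover have "induced_type A g \<phi> AM \<iota> n \<theta> {W3, W5} \<longleftrightarrow>
      (\<forall>(d, x)\<in>chart_points AM. \<forall>u v. B d x (I d x u) (I d x v) = - B d x u v) \<and> k = 0"
    unfolding ball_and_k[symmetric] using w1_iff minimal_of_anti_invariant
    by (simp add: induced_type_point) (intro cong, blast)
  moreover have "induced_type A g \<phi> AM \<iota> n \<theta> {W5} \<longleftrightarrow>
      (\<forall>(d, x)\<in>chart_points AM. \<forall>u v. B d x u v = 0) \<and> k = 0"
    unfolding ball_and_k[symmetric] using w1_iff geodesic_iff
    by (simp add: induced_type_point) (intro cong, blast)
  moreover have "induced_type A g \<phi> AM \<iota> n \<theta> {} \<longleftrightarrow>
      (\<forall>(d, x)\<in>chart_points AM. \<forall>u v. B d x u v = 0) \<and> (\<forall>(d, x)\<in>chart_points AM. w5 d x) \<and> k = 0"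
  proof -
    have "induced_type A g \<phi> AM \<iota> n \<theta> {} \<longleftrightarrow>
        (\<forall>(d, x)\<in>chart_points AM. ((\<forall>u v. B d x u v = 0) \<and> w5 d x) \<and> k = 0)"
      using w1_iff geodesic_iff by (simp add: induced_type_point) (intro cong, blast)
    then show ?thesis unfolding ball_and_k by fast
  qed
  ultimately show ?thesis
    unfolding Let_def type_P_iff w_defs by blast
qed

end
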